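(* Let $N\ge2$, let $\Omega\subset\mathbb{R}^N$ be a smooth bounded domain, and let $q(p)$ be a function of $p$ with $\lim_{p\to\infty}q(p)/p=Q$, where either $Q\in(0,1)$ and $N<q(p)<p$, or $Q\in(1,\infty)$ and $N<p<q(p)$. Let $\Lambda>\Lambda_\infty$ be fixed and take $\lambda_p>0$ satisfying $\lim_{p\to\infty}(\lambda_p)^{1/p}=\Lambda$. For $p$ large, denote by $u_p$ a nonnegative least energy solution of $$-(\Delta_p+\Delta_{q(p)})u=\lambda_p\|u\|_\infty^{p-1}\delta_{x_u}\ \text{ in }\Omega,\qquad u=0\ \text{ on }\partial\Omega,$$ and by $x_p$ the only maximum point of $u_p$. Then there exist a sequence $p_n\to\infty$, a point $x_\Lambda\in\Omega$ and a function $u_\Lambda\in W^{1,\infty}(\Omega)\cap C_0(\overline\Omega)$ such that $x_{p_n}\to x_\Lambda$ and $u_{p_n}\to u_\Lambda$ uniformly in $\overline\Omega$. Moreover, $$\|\nabla u_\Lambda\|_\infty\le\left(\frac{\Lambda_\infty}{\Lambda}\right)^{\frac1{1-Q}}$$ and $$u_\Lambda(x_\Lambda)=\|u_\Lambda\|_\infty\ge\begin{cases}(\Lambda_\infty)^{-1}\left(\Lambda_\infty/\Lambda\right)^{\frac{1}{1-Q}}&\text{if }Q\in(0,1),\\ (\Lambda_\infty)^{-1}&\text{if }Q\in(1,\infty).\end{cases}$$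
   Context: $\|\cdot\|_s$ is the norm of $L^s(\Omega)$. $C_0(\overline\Omega):=\{u\in C(\overline\Omega):u=0\text{ on }\partial\Omega\}$ and $\Lambda_\infty:=\min\{\|\nabla u\|_\infty/\|u\|_\infty:0\not\equiv u\in W^{1,\infty}(\Omega)\cap C_0(\overline\Omega)\}$. $(\Delta_p+\Delta_q)u:=\operatorname{div}[(|\nabla u|^{p-2}+|\nabla u|^{q-2})\nabla u]$; $x_u$ denotes the maximum point of $|u|$ and $\delta_{x_u}$ the Dirac delta supported at $x_u$. Least energy solutions: with $q=q(p)$ and $\lambda=\lambda_p$, let $X_{p,q}:=W_0^{1,\max\{p,q\}}(\Omega)\hookrightarrow C(\overline\Omega)$, $J_\lambda(u):=\frac1p\|\nabla u\|_p^p+\frac1q\|\nabla u\|_q^q-\frac{\lambda}{p}\|u\|_\infty^p$ for $u\in X_{p,q}$, and $\mathcal N_{\lambda,\infty}:=\{u\in X_{p,q}\setminus\{0\}:\|\nabla u\|_p^p+\|\nabla u\|_q^q=\lambda\|u\|_\infty^p\}$. A least energy solution is a function $u\in X_{p,q}$ minimizing $J_\lambda$ over $X_{p,q}$ if $N<p<q$, or over $\mathcal N_{\lambda,\infty}$ (with $u\in\mathcal N_{\lambda,\infty}$) if $N<q<p$. Nonnegative least energy solutions exist, and have a unique maximum point, whenever $\lambda>\lambda_\infty(p):=\min\{\|\nabla v\|_p^p/\|v\|_\infty^p:v\in W_0^{1,p}(\Omega)\setminus\{0\}\}$; since $\lambda_\infty(p)^{1/p}\to\Lambda_\infty$ as $p\to\infty$,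 this is the case for $\lambda=\lambda_p$ and all $p$ large enough. *)

theory Defs
  imports "HOL-Analysis.Analysis" "HOL-Probability.Essential_Supremum"
begin

section \<open>Smooth functions and smooth domains\<close>

primrec Ck :: "nat \<Rightarrow> ('a::euclidean_space \<Rightarrow> real) \<Rightarrow> bool" where
  "Ck 0 f \<longleftrightarrow> continuous_on UNIV f"
| "Ck (Suc k) f \<longleftrightarrow>
     f differentiable_on UNIV \<and> (\<forall>v. Ck k (\<lambda>x. frechet_derivative f (at x) v))"

definition smooth :: "('a::euclidean_space \<Rightarrow> real) \<Rightarrow> bool" where
  "smooth f \<longleftrightarrow> (\<forall>k. Ck k f)"

text \<open>Near each boundary point the domain is, up to relabelling and reflecting the coordinate
  axes, the strict epigraph of a smooth function of the remaining coordinates; \<open>\<gamma>\<close> is evaluated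
  only on the coordinate hyperplane orthogonal to \<open>b\<close>.\<close>

definition smooth_boundary :: "'a::euclidean_space set \<Rightarrow> bool" where
  "smooth_boundary \<Omega> \<longleftrightarrow>
     (\<forall>x0\<in>frontier \<Omega>. \<exists>r>0. \<exists>b\<in>Basis. \<exists>\<sigma>\<in>{1, -1::real}. \<exists>\<gamma>. smooth \<gamma> \<and>
        \<Omega> \<inter> ball x0 r = {x \<in> ball x0 r. \<gamma> (x - (x \<bullet> b) *\<^sub>R b) < \<sigma> * (x \<bullet> b)})"

definition smooth_bounded_domain :: "'a::euclidean_space set \<Rightarrow> bool" where
  "smooth_bounded_domain \<Omega> \<longleftrightarrow>
     open \<Omega> \<and> connected \<Omega> \<and> \<Omega> \<noteq> {} \<and> bounded \<Omega> \<and> smooth_boundary \<Omega>"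

section \<open>Lebesgue and Sobolev spaces\<close>

text \<open>Functions on \<open>\<Omega>\<close> are represented by functions on the whole space whose values outside
  \<open>\<Omega>\<close> (or outside its closure, for continuous representatives) are irrelevant.
  The exponent \<open>s\<close> ranges over \<open>[1, \<infinity>]\<close>.\<close>

definition Lspace :: "'a::euclidean_space set \<Rightarrow> ereal \<Rightarrow> ('a \<Rightarrow> 'b::euclidean_space) set" where
  "Lspace \<Omega> s = {f \<in> borel_measurable (lebesgue_on \<Omega>).
     if s = \<infinity> then esssup (lebesgue_on \<Omega>) (\<lambda>x. ereal (norm (f x))) < \<infinity>
     else integrable (lebesgue_on \<Omega>) (\<lambda>x. norm (f x) powr real_of_ereal s)}"

definition Lnorm :: "'a::euclidean_space set \<Rightarrow> ereal \<Rightarrow> ('a \<Rightarrow> 'b::euclidean_space) \<Rightarrow> real" where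
  "Lnorm \<Omega> s f =
     (if s = \<infinity> then real_of_ereal (esssup (lebesgue_on \<Omega>) (\<lambda>x. ereal (norm (f x))))
      else (LINT x|lebesgue_on \<Omega>. norm (f x) powr real_of_ereal s) powr (1 / real_of_ereal s))"

definition test_functions :: "'a::euclidean_space set \<Rightarrow> ('a \<Rightarrow> real) set" where
  "test_functions \<Omega> =
     {\<phi>. smooth \<phi> \<and> compact (closure {x. \<phi> x \<noteq> 0}) \<and> closure {x. \<phi> x \<noteq> 0} \<subseteq> \<Omega>}"

definition locally_integrable ::
  "'a::euclidean_space set \<Rightarrow> ('a \<Rightarrow> 'b::euclidean_space) \<Rightarrow> bool" where
  "locally_integrable \<Omega> f \<longleftrightarrow> (\<forall>K. compact K \<and> K \<subseteq> \<Omega> \<longrightarrow> set_integrable lebesgue K f)"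

definition has_weak_gradient ::
  "'a::euclidean_space set \<Rightarrow> ('a \<Rightarrow> real) \<Rightarrow> ('a \<Rightarrow> 'a) \<Rightarrow> bool" where
  "has_weak_gradient \<Omega> u g \<longleftrightarrow>
     locally_integrable \<Omega> u \<and> locally_integrable \<Omega> g \<and>
     (\<forall>\<phi>\<in>test_functions \<Omega>. \<forall>b\<in>Basis.
        (LINT x|lebesgue_on \<Omega>. u x * frechet_derivative \<phi> (at x) b)
          = - (LINT x|lebesgue_on \<Omega>. (g x \<bullet> b) * \<phi> x))"

text \<open>Weak gradients are unique only up to null sets; the choice made here does not
  affect any of the notions below, which depend on the class of the gradient only.\<close>

definition weak_gradient :: "'a::euclidean_space set \<Rightarrow> ('a \<Rightarrow> real) \<Rightarrow> 'a \<Rightarrow> 'a" where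
  "weak_gradient \<Omega> u = (SOME g. has_weak_gradient \<Omega> u g)"

definition W1 :: "'a::euclidean_space set \<Rightarrow> ereal \<Rightarrow> ('a \<Rightarrow> real) set" where
  "W1 \<Omega> s = {u \<in> Lspace \<Omega> s. \<exists>g \<in> Lspace \<Omega> s. has_weak_gradient \<Omega> u g}"

definition W1_norm :: "'a::euclidean_space set \<Rightarrow> ereal \<Rightarrow> ('a \<Rightarrow> real) \<Rightarrow> real" where
  "W1_norm \<Omega> s u = Lnorm \<Omega> s u + Lnorm \<Omega> s (weak_gradient \<Omega> u)"

definition W01 :: "'a::euclidean_space set \<Rightarrow> ereal \<Rightarrow> ('a \<Rightarrow> real) set" where
  "W01 \<Omega> s = {u \<in> W1 \<Omega> s. \<exists>\<phi>::nat \<Rightarrow> 'a \<Rightarrow> real.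
     (\<forall>n. \<phi> n \<in> test_functions \<Omega>) \<and>
     (\<lambda>n. W1_norm \<Omega> s (\<lambda>x. \<phi> n x - u x)) \<longlonglongrightarrow> 0}"

definition C0 :: "'a::euclidean_space set \<Rightarrow> ('a \<Rightarrow> real) set" where
  "C0 \<Omega> = {u. continuous_on (closure \<Omega>) u \<and> (\<forall>x\<in>frontier \<Omega>. u x = 0)}"

text \<open>The infimum is attained, so it is the minimum.\<close>

definition Lambda_inf :: "'a::euclidean_space set \<Rightarrow> real" where
  "Lambda_inf \<Omega> = Inf {Lnorm \<Omega> \<infinity> (weak_gradient \<Omega> u) / Lnorm \<Omega> \<infinity> u | u.
     u \<in> W1 \<Omega> \<infinity> \<inter> C0 \<Omega> \<and> (\<exists>x\<in>\<Omega>. u x \<noteq> 0)}"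

section \<open>Least energy solutions\<close>

text \<open>Elements of \<open>Xpq\<close> are the representatives continuous up to the boundary; they exist
  since the exponent exceeds the dimension.\<close>

definition Xpq :: "'a::euclidean_space set \<Rightarrow> real \<Rightarrow> real \<Rightarrow> ('a \<Rightarrow> real) set" where
  "Xpq \<Omega> p q = {u \<in> W01 \<Omega> (ereal (max p q)). continuous_on (closure \<Omega>) u}"

definition J :: "'a::euclidean_space set \<Rightarrow> real \<Rightarrow> real \<Rightarrow> real \<Rightarrow> ('a \<Rightarrow> real) \<Rightarrow> real" where
  "J \<Omega> p q lam u =
     1 / p * Lnorm \<Omega> (ereal p) (weak_gradient \<Omega> u) powr p
     + 1 / q * Lnorm \<Omega> (ereal q) (weak_gradient \<Omega> u) powr q
     - lam / p * Lnorm \<Omega> \<infinity> u powr p"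

definition Nehari :: "'a::euclidean_space set \<Rightarrow> real \<Rightarrow> real \<Rightarrow> real \<Rightarrow> ('a \<Rightarrow> real) set" where
  "Nehari \<Omega> p q lam = {u \<in> Xpq \<Omega> p q. (\<exists>x\<in>\<Omega>. u x \<noteq> 0) \<and>
     Lnorm \<Omega> (ereal p) (weak_gradient \<Omega> u) powr p
     + Lnorm \<Omega> (ereal q) (weak_gradient \<Omega> u) powr q
     = lam * Lnorm \<Omega> \<infinity> u powr p}"

definition least_energy_solution ::
  "'a::euclidean_space set \<Rightarrow> real \<Rightarrow> real \<Rightarrow> real \<Rightarrow> ('a \<Rightarrow> real) \<Rightarrow> bool" where
  "least_energy_solution \<Omega> p q lam u \<longleftrightarrow>
     (real DIM('a) < p \<and> p < q \<and>
        u \<in> Xpq \<Omega> p q \<and> (\<forall>v\<in>Xpq \<Omega> p q. J \<Omega> p q lam u \<le> J \<Omega> p q lam v)) \<or>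
     (real DIM('a) < q \<and> q < p \<and>
        u \<in> Nehari \<Omega> p q lam \<and> (\<forall>v\<in>Nehari \<Omega> p q lam. J \<Omega> p q lam u \<le> J \<Omega> p q lam v))"

definition max_points :: "'a::euclidean_space set \<Rightarrow> ('a \<Rightarrow> real) \<Rightarrow> 'a set" where
  "max_points \<Omega> u = {x \<in> closure \<Omega>. \<forall>y\<in>closure \<Omega>. \<bar>u y\<bar> \<le> \<bar>u x\<bar>}"

end

(*
  A least energy solution u = u_p is compared with the multiple of a test function v lying on the
  Nehari set.  Writing b for the L^q norm of its gradient, V for the measure of the domain and
  m for a lower bound of the maximum of v with |grad v| <= 1, this gives
  b^(p-q) (lam m^p - V) <= V^(p/q), while the Nehari identity gives b^q <= lam |u|_inf^p.
  Taking p-th roots, b^(1-q/p) stays in a compact subset of (0, oo), so along a subsequence b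
  tends to some G > 0, and Morrey's estimate with the fixed exponent 2 N gives uniform
  convergence to some U.  Lower semicontinuity yields Lambda_inf |U|_inf <= |grad U|_inf <= G;
  together with the limits G^(1-Q) <= Lambda_inf / Lambda and G^Q <= Lambda |U|_inf of the two
  estimates, all bounds follow.

  The steep test functions needed for the first limit are smoothed cones over the largest ball
  in the domain; they are good enough since Lambda_inf is at least the inverse of its radius, as
  is seen by following a segment from an interior point to the nearest boundary point.
*)
theory Submission
  imports Defs "HOL-Complex_Analysis.Great_Picard" "HOL-Computational_Algebra.Polynomial"
begin

section \<open>Smooth cutoff functions\<close>

text \<open>Elements of the Sobolev spaces with zero boundary values are known only through
  approximating test functions, and \<open>weak_gradient\<close> is an arbitrary representative.
  Morrey's estimate is therefore proved for test functions with their classical gradient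
  \<open>grad\<close> and carried over by uniform limits, while uniqueness almost everywhere makes
  the choice of representative harmless.

  With the exponent m = 2 N the singularity t powr (- N / m) met in Morrey's estimate is 1 / sqrt t,
  with primitive 2 sqrt t. Keeping this exponent fixed also gives one constant for all p and q, as
  is needed when both tend to infinity.

  The sign of 1 - Q decides whether the comparison bounds \<open>b\<close> from above or from below.
  The quantity \<open>y p = b p powr (1 - q p / p)\<close> treats both cases at once: the comparison
  bounds it from above, and the Nehari inequality together with |u| <= C b bounds it from below by a
  positive number. Only then is \<open>b\<close> recovered through the power 1 / (1 - q p / p),
  whose limit is finite because Q differs from 1.\<close>

lemma Ck_Suc_imp: "Ck (Suc k) f \<Longrightarrow> Ck k f"
proof (induction k arbitrary: f)
  case 0
  then show ?case by (auto intro: differentiable_imp_continuous_on)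
next
  case (Suc k)
  then show ?case by (metis Ck.simps(2))
qed

lemma Ck_differentiable: "Ck (Suc k) f \<Longrightarrow> f differentiable (at x)"
  by (auto simp: differentiable_on_def)

lemma Ck_SucI:
  assumes "\<And>x. (f has_derivative f' x) (at x)" "\<And>v. Ck k (\<lambda>x. f' x v)"
  shows "Ck (Suc k) f"
proof -
  have "frechet_derivative f (at x) = f' x" for x
    using assms(1) frechet_derivative_at by metis
  then show ?thesis
    using assms by (auto simp: differentiable_on_def intro: differentiableI differentiable_at_withinI)
qed

lemma Ck_has_derivative:
  "Ck (Suc k) f \<Longrightarrow> (f has_derivative frechet_derivative f (at x)) (at x)"
  by (meson Ck_differentiable frechet_derivative_works)

lemma Ck_const: "Ck k (\<lambda>x. c)"
proof (induction k arbitrary: c)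
  case (Suc k)
  show ?case by (rule Ck_SucI[where f'="\<lambda>x v. 0"]) (auto simp: Suc)
qed auto

lemma Ck_linear:
  assumes "bounded_linear f" shows "Ck k f"
proof (cases k)
  case 0
  then show ?thesis using assms by (simp add: linear_continuous_on)
next
  case (Suc m)
  then show ?thesis
    using Ck_SucI[where f'="\<lambda>x. f"] assms by (simp add: Ck_const bounded_linear_imp_has_derivative)
qed

lemma Ck_add: "Ck k f \<Longrightarrow> Ck k g \<Longrightarrow> Ck k (\<lambda>x. f x + g x)"
proof (induction k arbitrary: f g)
  case (Suc k)
  show ?case
    by (rule Ck_SucI[OF has_derivative_add[OF Ck_has_derivative[OF Suc.prems(1)] Ck_has_derivative[OF Suc.prems(2)]]])
       (use Suc in auto)
qed (auto intro: continuous_intros)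

lemma Ck_mult: "Ck k f \<Longrightarrow> Ck k g \<Longrightarrow> Ck k (\<lambda>x. f x * g x)"
proof (induction k arbitrary: f g)
  case (Suc k)
  show ?case
    by (rule Ck_SucI[OF has_derivative_mult[OF Ck_has_derivative[OF Suc.prems(1)] Ck_has_derivative[OF Suc.prems(2)]]])
       (use Suc Ck_Suc_imp[OF Suc.prems(1)] Ck_Suc_imp[OF Suc.prems(2)] in \<open>auto intro!: Ck_add\<close>)
qed (auto intro: continuous_intros)

text \<open>Carrying the whole sequence of derivatives of the outer function makes the induction
  close: the chain rule turns \<open>F n\<close> into \<open>F (Suc n)\<close> times a derivative of
  \<open>g\<close>, so no formula for higher derivatives of a composition is needed. The set
  \<open>U\<close> admits outer functions that are smooth only on part of the line, such as the
  square root.\<close>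

lemma Ck_compose_family:
  fixes F :: "nat \<Rightarrow> real \<Rightarrow> real"
  assumes "\<And>n t. t \<in> U \<Longrightarrow> (F n has_real_derivative F (Suc n) t) (at t)"
    and "Ck k g" "\<And>x. g x \<in> U"
  shows "Ck k (\<lambda>x. F n (g x))"
  using assms(2)
proof (induction k arbitrary: n)
  case 0
  have "isCont (F n) (g x)" for x
    using assms(1)[OF assms(3)] DERIV_isCont by blast
  moreover have "isCont g x" for x
    using 0 by (simp add: continuous_on_eq_continuous_at)
  ultimately show ?case
    by (auto simp: continuous_on_eq_continuous_at intro: isCont_o2)
next
  case (Suc k)
  have D: "((\<lambda>x. F n (g x)) has_derivative (\<lambda>v. F (Suc n) (g x) * frechet_derivative g (at x) v)) (at x)" for x
    using has_derivative_compose[OF Ck_has_derivative[OF Suc.prems]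
        assms(1)[OF assms(3), unfolded has_field_derivative_def]] by blast
  show ?case
    using Suc.prems by (intro Ck_SucI[OF D] Ck_mult Suc.IH Ck_Suc_imp[OF Suc.prems]) auto
qed

section \<open>Closure properties of smooth functions\<close>

lemma smooth_const: "smooth (\<lambda>x. c)" by (simp add: smooth_def Ck_const)
lemma smooth_add: "smooth f \<Longrightarrow> smooth g \<Longrightarrow> smooth (\<lambda>x. f x + g x)" by (simp add: smooth_def Ck_add)
lemma smooth_mult: "smooth f \<Longrightarrow> smooth g \<Longrightarrow> smooth (\<lambda>x. f x * g x)" by (simp add: smooth_def Ck_mult)
lemma smooth_linear: "bounded_linear f \<Longrightarrow> smooth f" by (simp add: smooth_def Ck_linear)
lemma smooth_diff: "smooth f \<Longrightarrow> smooth g \<Longrightarrow> smooth (\<lambda>x. f x - g x)"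
  using smooth_add[of f "\<lambda>x. (-1) * g x"] smooth_mult[OF smooth_const, of g "-1"] by simp
lemma smooth_inner: "smooth (\<lambda>x. x \<bullet> b)" by (simp add: smooth_linear bounded_linear_inner_left)
lemma smooth_prod: "finite A \<Longrightarrow> (\<And>i. i \<in> A \<Longrightarrow> smooth (f i)) \<Longrightarrow> smooth (\<lambda>x. \<Prod>i\<in>A. f i x)"
  by (induction A rule: finite_induct) (auto intro: smooth_const smooth_mult)
lemma smooth_sum: "finite A \<Longrightarrow> (\<And>i. i \<in> A \<Longrightarrow> smooth (f i)) \<Longrightarrow> smooth (\<lambda>x. \<Sum>i\<in>A. f i x)"
  by (induction A rule: finite_induct) (auto intro: smooth_const smooth_add)

lemma smooth_has_derivative:
  "smooth f \<Longrightarrow> (f has_derivative frechet_derivative f (at x)) (at x)"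
  unfolding smooth_def using Ck_has_derivative by blast

lemma smooth_frechet_derivative: "smooth f \<Longrightarrow> smooth (\<lambda>x. frechet_derivative f (at x) v)"
  by (metis Ck.simps(2) smooth_def)

lemma smooth_continuous_on: "smooth f \<Longrightarrow> continuous_on S f"
  by (metis Ck.simps(1) continuous_on_subset smooth_def top_greatest)

text \<open>The n-th derivative of exp (- 1 / t) on t > 0 is P (1 / t) exp (- 1 / t) for a
  polynomial P. Differentiating once more replaces P by X^2 (P - P'), which is the recursion;
  \<open>[:0, 0, 1:]\<close> is X^2.\<close>

primrec flat_poly :: "nat \<Rightarrow> real poly" where
  "flat_poly 0 = 1"
| "flat_poly (Suc n) = [:0, 0, 1:] * (flat_poly n - pderiv (flat_poly n))"

definition flat_deriv :: "nat \<Rightarrow> real \<Rightarrow> real" where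
  "flat_deriv n t = (if t > 0 then poly (flat_poly n) (1/t) * exp (- (1/t)) else 0)"

definition flat :: "real \<Rightarrow> real" where
  "flat t = (if t > 0 then exp (- (1/t)) else 0)"

lemma flat_deriv_0: "flat_deriv 0 = flat"
  by (auto simp: flat_deriv_def flat_def)

text \<open>Substituting x = 1 / t reduces this to the decay of x^i / exp x at infinity. It gives
  the derivatives of \<open>flat\<close> at 0.\<close>

lemma poly_times_exp_tendsto_0:
  fixes P :: "real poly"
  shows "((\<lambda>t. poly P (1/t) * exp (- (1/t))) \<longlongrightarrow> 0) (at_right 0)"
proof -
  have "((\<lambda>x. poly P x * exp (- x)) \<longlongrightarrow> 0) at_top"
  proof -
    have "((\<lambda>x. (\<Sum>i\<le>degree P. coeff P i * (x ^ i / exp x))) \<longlongrightarrow> (\<Sum>i\<le>degree P. coeff P i * 0)) at_top"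
      by (intro tendsto_sum tendsto_mult tendsto_const tendsto_power_div_exp_0)
    moreover have "(\<Sum>i\<le>degree P. coeff P i * (x ^ i / exp x)) = poly P x * exp (- x)" for x
      by (simp add: poly_altdef exp_minus sum_distrib_right divide_inverse mult.assoc)
    ultimately show ?thesis by simp
  qed
  then have "((\<lambda>t. poly P (inverse t) * exp (- inverse t)) \<longlongrightarrow> 0) (at_right 0)"
    using filterlim_compose filterlim_inverse_at_top_right by fast
  then show ?thesis by (simp add: inverse_eq_divide)
qed

lemma flat_deriv_has_derivative:
  "(flat_deriv n has_real_derivative flat_deriv (Suc n) t) (at t)"
proof -
  consider "t > 0" | "t < 0" | "t = 0" by linarith
  then show ?thesis
  proof cases
    case 1
    have "((\<lambda>t. 1/t) has_real_derivative - (1 / t * (1 / t))) (at t)"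
      using 1 DERIV_inverse[of t] by (simp add: inverse_eq_divide power2_eq_square)
    note D = this
    have "((\<lambda>t. poly (flat_poly n) (1/t) * exp (- (1/t))) has_real_derivative
        poly (pderiv (flat_poly n)) (1/t) * - (1 / t * (1 / t)) * exp (- (1/t))
        + exp (- (1/t)) * - (- (1 / t * (1 / t))) * poly (flat_poly n) (1/t)) (at t)"
      by (rule DERIV_mult[OF DERIV_chain2[OF poly_DERIV D] DERIV_fun_exp[OF DERIV_minus[OF D]]])
    moreover have "poly (pderiv (flat_poly n)) (1/t) * - (1 / t * (1 / t)) * exp (- (1/t))
        + exp (- (1/t)) * - (- (1 / t * (1 / t))) * poly (flat_poly n) (1/t) = flat_deriv (Suc n) t"
      using 1 by (simp add: flat_deriv_def algebra_simps)
    ultimately have "((\<lambda>t. poly (flat_poly n) (1/t) * exp (- (1/t))) has_real_derivative flat_deriv (Suc n) t) (at t)"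
      by simp
    then show ?thesis
      by (rule has_field_derivative_transform_within_open[of _ _ _ "{0<..}"])
        (use 1 in \<open>auto simp: flat_deriv_def\<close>)
  next
    case 2
    have "((\<lambda>t. 0) has_real_derivative flat_deriv (Suc n) t) (at t)"
      using 2 by (auto simp: flat_deriv_def)
    then show ?thesis
      by (rule has_field_derivative_transform_within_open[of _ _ _ "{..<0}"])
        (use 2 in \<open>auto simp: flat_deriv_def\<close>)
  next
    case 3
    \<comment> \<open>The division by h in the difference quotient is one more factor 1 / h, hence
      only multiplies the polynomial by X.\<close>
    have R: "((\<lambda>h. flat_deriv n h / h) \<longlongrightarrow> 0) (at_right 0)"
    proof (rule Lim_transform_eventually[OF poly_times_exp_tendsto_0[of "[:0,1:] * flat_poly n"]])
      show "\<forall>\<^sub>F x in at_right 0. poly ([:0, 1:] * flat_poly n) (1 / x) * exp (- (1 / x)) = flat_deriv n x / x"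
        unfolding eventually_at_right_field by (rule exI[of _ 1]) (simp add: flat_deriv_def)
    qed
    have L: "((\<lambda>h. flat_deriv n h / h) \<longlongrightarrow> 0) (at_left 0)"
    proof (rule Lim_transform_eventually[OF tendsto_const])
      show "\<forall>\<^sub>F x in at_left 0. 0 = flat_deriv n x / x"
        unfolding eventually_at_left_field by (rule exI[of _ "-1"]) (simp add: flat_deriv_def)
    qed
    have "((\<lambda>h. flat_deriv n h / h) \<longlongrightarrow> 0) (at 0)"
      using L R by (rule filterlim_split_at)
    moreover have "flat_deriv m 0 = 0" for m by (simp add: flat_deriv_def)
    ultimately show ?thesis unfolding DERIV_def 3 by (simp del: flat_poly.simps)
  qed
qed

lemma smooth_flat: "smooth g \<Longrightarrow> smooth (\<lambda>x. flat (g x))"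
  unfolding smooth_def flat_deriv_0[symmetric]
  using Ck_compose_family[of UNIV flat_deriv, OF flat_deriv_has_derivative] by blast

lemma smooth_sqrt:
  assumes "smooth g" "\<And>x. g x > 0"
  shows "smooth (\<lambda>x. sqrt (g x))"
proof -
  \<comment> \<open>The n-th derivative of the square root, with its falling factorial as
    coefficient.\<close>
  define F :: "nat \<Rightarrow> real \<Rightarrow> real" where
    "F n t = (\<Prod>i<n. 1/2 - real i) * t powr (1/2 - real n)" for n t
  have "(F n has_real_derivative F (Suc n) t) (at t)" if "t \<in> {0<..}" for n t
  proof -
    have "((\<lambda>t. (\<Prod>i<n. 1/2 - real i) * t powr (1/2 - real n)) has_real_derivative
        (\<Prod>i<n. 1/2 - real i) * ((1/2 - real n) * t powr (1/2 - real n - 1))) (at t)"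
      using that by (intro DERIV_cmult has_real_derivative_powr) auto
    moreover have "1/2 - real n - 1 = 1/2 - real (Suc n)" by simp
    ultimately show ?thesis
      unfolding F_def prod.lessThan_Suc by (simp only: mult.assoc)
  qed
  then have "Ck k (\<lambda>x. F 0 (g x))" for k
    by (rule Ck_compose_family[where U="{0<..}" and F=F]) (use assms in \<open>auto simp: smooth_def\<close>)
  moreover have "F 0 (g x) = sqrt (g x)" for x
    using assms(2)[of x] by (simp add: F_def powr_half_sqrt)
  ultimately show ?thesis by (simp add: smooth_def)
qed

section \<open>Bumps on boxes and smoothed cones\<close>

lemma flat_nonneg: "flat t \<ge> 0" by (simp add: flat_def)
lemma flat_le_1: "flat t \<le> 1" by (simp add: flat_def)

lemma flat_scale_tendsto: "t > 0 \<Longrightarrow> (\<lambda>n. flat (real (Suc n) * t)) \<longlonglongrightarrow> 1"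
proof -
  assume t: "t > 0"
  have "(\<lambda>n. exp (- (1/t * (1 / real (Suc n))))) \<longlonglongrightarrow> exp (- (1/t * 0))"
    using LIMSEQ_inverse_real_of_nat
    by (intro tendsto_intros) (simp add: inverse_eq_divide)
  moreover have "0 < t + t * real n" for n using t by (intro add_pos_nonneg) auto
  ultimately show ?thesis using t by (simp add: flat_def field_simps)
qed

text \<open>Each factor is positive exactly on one side of a face, so the product is positive
  exactly on the open box. As n grows the transition at the faces sharpens, and the bumps tend to
  the indicator of the box.\<close>

definition box_bump :: "nat \<Rightarrow> 'a::euclidean_space \<Rightarrow> 'a \<Rightarrow> 'a \<Rightarrow> real" where
  "box_bump n a b x =
     (\<Prod>i\<in>Basis. flat (real (Suc n) * (x \<bullet> i - a \<bullet> i)) * flat (real (Suc n) * (b \<bullet> i - x \<bullet> i)))"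

lemma smooth_box_bump: "smooth (box_bump n a b)"
  unfolding box_bump_def [abs_def]
  by (intro smooth_prod smooth_mult smooth_flat smooth_diff smooth_inner smooth_const) auto

lemma box_bump_nonneg: "box_bump n a b x \<ge> 0"
  unfolding box_bump_def by (intro prod_nonneg) (auto simp: flat_nonneg)

lemma box_bump_le_1: "box_bump n a b x \<le> 1"
  unfolding box_bump_def by (intro prod_le_1) (auto simp: flat_nonneg flat_le_1 mult_le_one)

lemma box_bump_pos_iff: "box_bump n a b x > 0 \<longleftrightarrow> x \<in> box a b"
proof -
  have "box_bump n a b x \<noteq> 0 \<longleftrightarrow> x \<in> box a b"
    by (auto simp: box_bump_def mem_box flat_def zero_less_mult_iff)
  then show ?thesis using box_bump_nonneg[of n a b x] by linarith
qed

lemma box_bump_eq_0: "x \<notin> box a b \<Longrightarrow> box_bump n a b x = 0"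
  using box_bump_pos_iff[of n a b x] box_bump_nonneg[of n a b x] by linarith

lemma box_bump_tendsto: "(\<lambda>n. box_bump n a b x) \<longlonglongrightarrow> indicator (box a b) x"
proof (cases "x \<in> box a b")
  case True
  have "(\<lambda>n. box_bump n a b x) \<longlonglongrightarrow> (\<Prod>i\<in>(Basis::'a set). 1 * 1)"
    unfolding box_bump_def
    by (intro tendsto_prod tendsto_mult flat_scale_tendsto) (use True in \<open>auto simp: mem_box\<close>)
  then show ?thesis using True by simp
qed (auto simp: box_bump_eq_0)

lemma box_bump_test:
  assumes "cbox a b \<subseteq> \<Omega>" shows "box_bump n a b \<in> test_functions \<Omega>"
proof -
  have "closure {x. box_bump n a b x \<noteq> 0} \<subseteq> cbox a b"
    using box_subset_cbox[of a b] box_bump_eq_0[of _ a b n] by (intro closure_minimal) auto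
  moreover from this have "compact (closure {x. box_bump n a b x \<noteq> 0})"
    by (meson bounded_cbox bounded_subset closed_closure compact_eq_bounded_closed)
  ultimately show ?thesis
    using assms smooth_box_bump by (auto simp: test_functions_def)
qed

text \<open>For d > 0 this is s exp (- d / s) when s > 0 and 0 otherwise, a smooth substitute for
  the positive part that approaches it as d tends to 0.\<close>

definition smooth_pos_part :: "real \<Rightarrow> real \<Rightarrow> real" where
  "smooth_pos_part d s = s * flat (s / d)"

text \<open>For s > 0 the slope is (1 + d / s) exp (- d / s), which is at most 1 by 1 + x <= exp x.
  The smoothing thus does not steepen the positive part, so the cones built from it keep slope at
  most 1.\<close>

lemma smooth_pos_part_derivative:
  assumes "d > 0"
  obtains c where "0 \<le> c" "c \<le> 1" "(smooth_pos_part d has_real_derivative c) (at s)"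
proof -
  have "(smooth_pos_part d has_real_derivative (1 * flat (s / d) + flat_deriv 1 (s / d) * (1 / d) * s)) (at s)"
    unfolding smooth_pos_part_def [abs_def]
    by (intro DERIV_mult DERIV_ident DERIV_chain2[where f=flat] DERIV_cdivide
        flat_deriv_has_derivative[of 0, unfolded flat_deriv_0 One_nat_def[symmetric]])
  moreover have "0 \<le> 1 * flat (s / d) + flat_deriv 1 (s / d) * (1 / d) * s \<and>
      1 * flat (s / d) + flat_deriv 1 (s / d) * (1 / d) * s \<le> 1"
  proof (cases "s > 0")
    case True
    have "1 * flat (s / d) + flat_deriv 1 (s / d) * (1 / d) * s = (1 + d / s) * exp (- (d / s))"
      using True assms by (simp add: flat_def flat_deriv_def One_nat_def field_simps)
    moreover have "(1 + d / s) * exp (- (d / s)) \<le> exp (d / s) * exp (- (d / s))"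
      by (intro mult_right_mono exp_ge_add_one_self) auto
    moreover have "exp (d / s) * exp (- (d / s)) = 1" by (simp add: exp_minus)
    ultimately show ?thesis using True assms by simp
  next
    case False
    then show ?thesis using assms by (simp add: flat_def flat_deriv_def zero_less_divide_iff)
  qed
  ultimately show ?thesis using that by blast
qed

text \<open>A smoothing of the cone max 0 (\<rho> - |x - x0|): the term \<open>d\<^sup>2\<close>
  under the root removes the singularity at the tip. The squared norm is written in coordinates so
  that smoothness follows from the rules for sums and products.\<close>

definition cone :: "real \<Rightarrow> real \<Rightarrow> 'a::euclidean_space \<Rightarrow> 'a \<Rightarrow> real" where
  "cone d \<rho> x0 x = smooth_pos_part d (\<rho> - sqrt (d\<^sup>2 + (\<Sum>i\<in>Basis. (x \<bullet> i - x0 \<bullet> i) * (x \<bullet> i - x0 \<bullet> i))))"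

lemma cone_altdef: "cone d \<rho> x0 x = smooth_pos_part d (\<rho> - sqrt (d\<^sup>2 + (x - x0) \<bullet> (x - x0)))"
  unfolding cone_def by (subst euclidean_inner) (simp add: inner_diff_left)

lemma smooth_cone: assumes "d > 0" shows "smooth (cone d \<rho> x0)"
  unfolding cone_def [abs_def] smooth_pos_part_def [abs_def] divide_inverse
  by (intro smooth_mult smooth_flat smooth_diff smooth_const smooth_sqrt smooth_add smooth_sum smooth_inner)
     (use assms in \<open>auto intro!: add_pos_nonneg sum_nonneg\<close>)

text \<open>The slope is a product of two numbers at most 1: that of the smoothed positive part, and
  |x - x0| / r, where r is the regularized distance.\<close>

lemma cone_derivative_bound:
  assumes "d > 0" shows "\<bar>frechet_derivative (cone d \<rho> x0) (at x) v\<bar> \<le> norm v"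
proof -
  define r where "r = sqrt (d\<^sup>2 + (x - x0) \<bullet> (x - x0))"
  have r: "r > 0" using assms by (simp add: r_def add_pos_nonneg)
  obtain c where c: "0 \<le> c" "c \<le> 1" "(smooth_pos_part d has_real_derivative c) (at (\<rho> - r))"
    using smooth_pos_part_derivative[OF assms] .
  have "((\<lambda>x. \<rho> - sqrt (d\<^sup>2 + (x - x0) \<bullet> (x - x0))) has_derivative (\<lambda>v. - (((x - x0) \<bullet> v) / r))) (at x)"
    using r unfolding r_def
    by (auto intro!: derivative_eq_intros simp: inner_commute field_simps)
  from has_derivative_compose[OF this c(3)[unfolded has_field_derivative_def r_def]]
  have "(cone d \<rho> x0 has_derivative (\<lambda>v. c * - (((x - x0) \<bullet> v) / r))) (at x)"
    unfolding cone_altdef [abs_def] by simp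
  then have *: "frechet_derivative (cone d \<rho> x0) (at x) v = c * - (((x - x0) \<bullet> v) / r)"
    by (metis frechet_derivative_at)
  have "norm (x - x0) \<le> r"
    unfolding r_def norm_eq_sqrt_inner by simp
  then have "\<bar>(x - x0) \<bullet> v\<bar> \<le> r * norm v"
    by (meson Cauchy_Schwarz_ineq2 mult_right_mono norm_ge_zero order_trans)
  then have "\<bar>((x - x0) \<bullet> v) / r\<bar> \<le> norm v" using r by (simp add: field_simps)
  then have "c * \<bar>((x - x0) \<bullet> v) / r\<bar> \<le> 1 * norm v" using c by (intro mult_mono) auto
  then show ?thesis using c unfolding * by (simp add: abs_mult)
qed

lemma cone_nonzero_imp:
  assumes "d > 0" "cone d \<rho> x0 x \<noteq> 0" shows "x \<in> cball x0 \<rho>"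
proof -
  have "\<rho> - sqrt (d\<^sup>2 + (x - x0) \<bullet> (x - x0)) > 0"
    using assms by (auto simp: cone_altdef smooth_pos_part_def flat_def zero_less_divide_iff split: if_splits)
  moreover have "norm (x - x0) \<le> sqrt (d\<^sup>2 + (x - x0) \<bullet> (x - x0))"
    unfolding norm_eq_sqrt_inner by simp
  ultimately show ?thesis by (simp add: dist_norm norm_minus_commute)
qed

lemma cone_test:
  assumes "d > 0" "cball x0 \<rho> \<subseteq> \<Omega>" shows "cone d \<rho> x0 \<in> test_functions \<Omega>"
proof -
  have "closure {x. cone d \<rho> x0 x \<noteq> 0} \<subseteq> cball x0 \<rho>"
    using cone_nonzero_imp[OF assms(1)] by (intro closure_minimal) auto
  moreover from this have "compact (closure {x. cone d \<rho> x0 x \<noteq> 0})"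
    by (meson bounded_cball bounded_subset closed_closure compact_eq_bounded_closed)
  ultimately show ?thesis
    using assms smooth_cone by (auto simp: test_functions_def)
qed

section \<open>Gradients of test functions\<close>

definition grad :: "('a::euclidean_space \<Rightarrow> real) \<Rightarrow> 'a \<Rightarrow> 'a" where
  "grad \<phi> x = (\<Sum>b\<in>Basis. frechet_derivative \<phi> (at x) b *\<^sub>R b)"

lemma frechet_eq_grad:
  assumes "smooth \<phi>" shows "frechet_derivative \<phi> (at x) v = grad \<phi> x \<bullet> v"
proof -
  interpret bounded_linear "frechet_derivative \<phi> (at x)"
    using smooth_has_derivative[OF assms] has_derivative_bounded_linear by blast
  have "frechet_derivative \<phi> (at x) v = frechet_derivative \<phi> (at x) (\<Sum>b\<in>Basis. (v \<bullet> b) *\<^sub>R b)"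
    by (simp add: euclidean_representation)
  also have "\<dots> = grad \<phi> x \<bullet> v"
    by (simp add: sum scaleR grad_def inner_sum_left, rule sum.cong) (simp_all add: inner_commute)
  finally show ?thesis .
qed

lemma smooth_has_grad: "smooth \<phi> \<Longrightarrow> (\<phi> has_derivative (\<lambda>v. grad \<phi> x \<bullet> v)) (at x)"
  using smooth_has_derivative[of \<phi> x] frechet_eq_grad[of \<phi> x]
  by (metis (no_types, lifting) ext)

lemma grad_unique:
  assumes "(\<phi> has_derivative (\<lambda>v. d \<bullet> v)) (at x)" shows "grad \<phi> x = d"
proof -
  have "frechet_derivative \<phi> (at x) = (\<lambda>v. d \<bullet> v)" using frechet_derivative_at[OF assms] by simp
  then show ?thesis unfolding grad_def by (simp add: euclidean_representation)
qed

lemma smooth_line_derivative: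
  "smooth \<phi> \<Longrightarrow> ((\<lambda>s. \<phi> (x + s *\<^sub>R z)) has_real_derivative grad \<phi> (x + s *\<^sub>R z) \<bullet> z) (at s)"
  unfolding has_field_derivative_def
  by (rule has_derivative_eq_rhs[OF has_derivative_compose[OF _ smooth_has_grad]])
     (auto intro!: derivative_eq_intros)

lemma continuous_grad: "smooth \<phi> \<Longrightarrow> continuous_on S (grad \<phi>)"
  unfolding grad_def
  by (intro continuous_intros smooth_continuous_on smooth_frechet_derivative)

lemma grad_add: "smooth f \<Longrightarrow> smooth g \<Longrightarrow> grad (\<lambda>x. f x + g x) x = grad f x + grad g x"
  by (rule grad_unique)
     (use has_derivative_add[OF smooth_has_grad smooth_has_grad] in \<open>simp add: inner_add_left\<close>)

lemma grad_diff: "smooth f \<Longrightarrow> smooth g \<Longrightarrow> grad (\<lambda>x. f x - g x) x = grad f x - grad g x"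
  by (rule grad_unique)
     (use has_derivative_diff[OF smooth_has_grad smooth_has_grad] in \<open>simp add: inner_diff_left\<close>)

lemma grad_cmult: "smooth f \<Longrightarrow> grad (\<lambda>x. c * f x) x = c *\<^sub>R grad f x"
  by (rule grad_unique) (use has_derivative_mult_right[OF smooth_has_grad] in simp)

lemma grad_mult: "smooth f \<Longrightarrow> smooth g \<Longrightarrow> grad (\<lambda>x. f x * g x) x = f x *\<^sub>R grad g x + g x *\<^sub>R grad f x"
  by (rule grad_unique)
     (use has_derivative_mult[OF smooth_has_grad smooth_has_grad] in \<open>simp add: inner_add_left mult.commute\<close>)

lemma norm_grad_le:
  assumes "smooth \<phi>" "\<And>h. \<bar>frechet_derivative \<phi> (at x) h\<bar> \<le> L * norm h" shows "norm (grad \<phi> x) \<le> L"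
proof (cases "grad \<phi> x = 0")
  case True
  \<comment> \<open>\<open>L\<close> is not assumed nonnegative; the hypothesis at a unit vector
    shows that it is.\<close>
  obtain b :: 'a where b: "b \<in> Basis" using nonempty_Basis by blast
  have "0 \<le> L * norm b" using assms(2) abs_ge_zero order_trans by blast
  then show ?thesis using True b by simp
next
  case False
  have "norm (grad \<phi> x) * norm (grad \<phi> x) \<le> L * norm (grad \<phi> x)"
    using assms(2)[of "grad \<phi> x"] by (simp add: frechet_eq_grad[OF assms(1)] power2_norm_eq_inner[symmetric] power2_eq_square)
  then show ?thesis using False by simp
qed

lemma test_smooth: "\<phi> \<in> test_functions \<Omega> \<Longrightarrow> smooth \<phi>" by (simp add: test_functions_def)

lemma test_support:
  assumes "\<phi> \<in> test_functions \<Omega>"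
  shows "\<exists>K. compact K \<and> K \<subseteq> \<Omega> \<and> (\<forall>x. x \<notin> K \<longrightarrow> \<phi> x = 0) \<and> (\<forall>x. x \<notin> K \<longrightarrow> grad \<phi> x = 0)"
proof -
  let ?K = "closure {x. \<phi> x \<noteq> 0}"
  have z: "\<phi> x = 0" if "x \<notin> ?K" for x
    using that closure_subset[of "{x. \<phi> x \<noteq> 0}"] by auto
  have "grad \<phi> x = 0" if "x \<notin> ?K" for x
  proof (rule grad_unique)
    have "((\<lambda>x. 0) has_derivative (\<lambda>v. 0 \<bullet> v)) (at x)" by simp
    moreover have "open (- ?K)" "x \<in> - ?K" using that by (auto intro: open_Compl)
    ultimately show "(\<phi> has_derivative (\<lambda>v. 0 \<bullet> v)) (at x)"
      by (rule has_derivative_transform_within_open) (metis z ComplD)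
  qed
  moreover have "compact ?K" "?K \<subseteq> \<Omega>" using assms by (simp_all add: test_functions_def)
  ultimately show ?thesis using z by blast
qed

lemma testI:
  assumes "smooth \<phi>" "compact K" "K \<subseteq> \<Omega>" "\<And>x. x \<notin> K \<Longrightarrow> \<phi> x = 0"
  shows "\<phi> \<in> test_functions \<Omega>"
proof -
  have "closure {x. \<phi> x \<noteq> 0} \<subseteq> K"
    using assms compact_imp_closed by (intro closure_minimal) auto
  moreover from this have "compact (closure {x. \<phi> x \<noteq> 0})"
    by (meson assms(2) bounded_subset closed_closure compact_eq_bounded_closed)
  ultimately show ?thesis using assms by (auto simp: test_functions_def)
qed

lemma test_add:
  assumes "f \<in> test_functions \<Omega>" "g \<in> test_functions \<Omega>"
  shows "(\<lambda>x. f x + g x) \<in> test_functions \<Omega>"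
proof -
  obtain K where K: "compact K" "K \<subseteq> \<Omega>" "\<And>x. x \<notin> K \<Longrightarrow> f x = 0"
    "\<And>x. x \<notin> K \<Longrightarrow> grad f x = 0" using test_support[OF assms(1)] by blast
  obtain K' where K': "compact K'" "K' \<subseteq> \<Omega>" "\<And>x. x \<notin> K' \<Longrightarrow> g x = 0"
    "\<And>x. x \<notin> K' \<Longrightarrow> grad g x = 0" using test_support[OF assms(2)] by blast
  show ?thesis
    by (rule testI[where K="K \<union> K'", OF smooth_add[OF test_smooth[OF assms(1)] test_smooth[OF assms(2)]]])
       (simp_all add: K K' compact_Un)
qed

lemma test_mult: assumes "smooth f" "g \<in> test_functions \<Omega>" shows "(\<lambda>x. f x * g x) \<in> test_functions \<Omega>"
proof -
  obtain K where K: "compact K" "K \<subseteq> \<Omega>" "\<And>x. x \<notin> K \<Longrightarrow> g x = 0"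
    "\<And>x. x \<notin> K \<Longrightarrow> grad g x = 0" using test_support[OF assms(2)] by blast
  show ?thesis
    by (rule testI[where K=K, OF smooth_mult[OF assms(1) test_smooth[OF assms(2)]]]) (simp_all add: K)
qed

lemma test_cmult: "g \<in> test_functions \<Omega> \<Longrightarrow> (\<lambda>x. c * g x) \<in> test_functions \<Omega>"
  using test_mult smooth_const by blast

lemma test_diff: "f \<in> test_functions \<Omega> \<Longrightarrow> g \<in> test_functions \<Omega> \<Longrightarrow> (\<lambda>x. f x - g x) \<in> test_functions \<Omega>"
  using test_add[of f \<Omega> "\<lambda>x. (-1) * g x"] test_cmult[of g \<Omega> "-1"] by simp

lemma test_grad_bound:
  assumes "\<phi> \<in> test_functions \<Omega>" obtains B where "B \<ge> 0" "\<And>x. norm (grad \<phi> x) \<le> B"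
proof -
  obtain K where K: "compact K" "K \<subseteq> \<Omega>" "\<And>x. x \<notin> K \<Longrightarrow> \<phi> x = 0"
    "\<And>x. x \<notin> K \<Longrightarrow> grad \<phi> x = 0" using test_support[OF assms] by blast
  have "bounded (grad \<phi> ` K)"
    using K continuous_grad[OF test_smooth[OF assms]] compact_continuous_image compact_imp_bounded by blast
  then obtain B where "\<And>x. x \<in> K \<Longrightarrow> norm (grad \<phi> x) \<le> B" by (auto simp: bounded_iff)
  then have "norm (grad \<phi> x) \<le> max 0 B" for x using K by (cases "x \<in> K") (auto intro: le_max_iff_disj[THEN iffD2])
  then show ?thesis using that[of "max 0 B"] by auto
qed

lemma test_bound:
  assumes "\<phi> \<in> test_functions \<Omega>" obtains B where "B \<ge> 0" "\<And>x. \<bar>\<phi> x\<bar> \<le> B"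
proof -
  obtain K where K: "compact K" "K \<subseteq> \<Omega>" "\<And>x. x \<notin> K \<Longrightarrow> \<phi> x = 0"
    "\<And>x. x \<notin> K \<Longrightarrow> grad \<phi> x = 0" using test_support[OF assms] by blast
  have "bounded (\<phi> ` K)"
    using K smooth_continuous_on[OF test_smooth[OF assms]] compact_continuous_image compact_imp_bounded by blast
  then obtain B where "\<And>x. x \<in> K \<Longrightarrow> \<bar>\<phi> x\<bar> \<le> B" by (auto simp: bounded_iff)
  then have "\<bar>\<phi> x\<bar> \<le> max 0 B" for x using K by (cases "x \<in> K") (auto intro: le_max_iff_disj[THEN iffD2])
  then show ?thesis using that[of "max 0 B"] by auto
qed

section \<open>Differentiation under the integral sign\<close>

lemma integrable_compact_support:
  fixes f :: "'a::euclidean_space \<Rightarrow> 'b::euclidean_space"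
  assumes "compact K" "continuous_on UNIV f" "\<And>x. x \<notin> K \<Longrightarrow> f x = 0"
  shows "integrable lborel f"
proof -
  have "integrable lborel (\<lambda>x. indicator K x *\<^sub>R f x)"
    using borel_integrable_compact[of K f] assms continuous_on_subset by blast
  moreover have "(\<lambda>x. indicator K x *\<^sub>R f x) = f" using assms(3) by (auto simp: indicator_def fun_eq_iff)
  ultimately show ?thesis by simp
qed

text \<open>The mean value inequality bounds every difference quotient by \<open>w\<close>, so
  dominated convergence applies along any sequence tending to \<open>s0\<close>. Measurability of
  the derivative at \<open>s0\<close> comes for free, as it is a pointwise limit of the
  quotients.\<close>

lemma has_real_derivative_integral:
  fixes f f' :: "real \<Rightarrow> 'a \<Rightarrow> real"
  assumes e: "e > 0"
    and int: "\<And>s. \<bar>s - s0\<bar> < e \<Longrightarrow> integrable M (f s)"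
    and der: "\<And>s x. \<bar>s - s0\<bar> < e \<Longrightarrow> ((\<lambda>s. f s x) has_real_derivative f' s x) (at s)"
    and bnd: "\<And>s x. \<bar>s - s0\<bar> < e \<Longrightarrow> \<bar>f' s x\<bar> \<le> w x"
    and w: "integrable M w"
  shows "((\<lambda>s. LINT x|M. f s x) has_real_derivative (LINT x|M. f' s0 x)) (at s0)"
proof -
  have "((\<lambda>s. LINT x|M. f s x) has_field_derivative (LINT x|M. f' s0 x)) (at s0)"
    unfolding has_field_derivative_iff tendsto_at_iff_sequentially comp_def
  proof (intro allI impI)
    fix X :: "nat \<Rightarrow> real"
    assume X0: "\<forall>i. X i \<in> UNIV - {s0}" and X: "X \<longlonglongrightarrow> s0"
    from X e have "\<forall>\<^sub>F n in sequentially. \<bar>X n - s0\<bar> < e" by (auto simp: tendsto_iff dist_real_def)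
    then obtain N where N: "\<And>n. n \<ge> N \<Longrightarrow> \<bar>X n - s0\<bar> < e" by (auto simp: eventually_sequentially)
    \<comment> \<open>Dropping the first terms puts the whole sequence inside the interval where the
      hypotheses hold.\<close>
    define Y where "Y n = X (n + N)" for n
    have Y: "Y n \<noteq> s0" "\<bar>Y n - s0\<bar> < e" for n using X0 N by (auto simp: Y_def)
    have Y0: "Y \<longlonglongrightarrow> s0" unfolding Y_def using X LIMSEQ_ignore_initial_segment by blast
    let ?g = "\<lambda>n x. (f (Y n) x - f s0 x) / (Y n - s0)"
    have i0 [simp]: "integrable M (f s0)" using int[of s0] e by simp
    have lim: "(\<lambda>n. ?g n x) \<longlonglongrightarrow> f' s0 x" for x
      using der[of s0 x] e Y Y0 unfolding has_field_derivative_iff tendsto_at_iff_sequentially comp_def by auto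
    have ig: "integrable M (?g n)" for n using int Y i0 by auto
    have "(\<lambda>n. LINT x|M. ?g n x) \<longlonglongrightarrow> (LINT x|M. f' s0 x)"
    proof (rule integral_dominated_convergence[OF _ _ w])
      show "?g n \<in> borel_measurable M" for n using ig by blast
      show "f' s0 \<in> borel_measurable M"
        by (rule borel_measurable_LIMSEQ_real[of M ?g]) (use lim ig in auto)
      show "AE x in M. (\<lambda>n. ?g n x) \<longlonglongrightarrow> f' s0 x" using lim by simp
      have "\<bar>?g n x\<bar> \<le> w x" for n x
      proof -
        have "convex {s. \<bar>s - s0\<bar> < e}"
          using convex_ball[of s0 e] by (simp add: ball_def dist_real_def abs_minus_commute)
        then have "norm (f (Y n) x - f s0 x) \<le> w x * norm (Y n - s0)"
          by (rule field_differentiable_bound[where f'="\<lambda>s. f' s x"])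
             (use der Y(2) e bnd in \<open>auto intro: has_field_derivative_at_within\<close>)
        then show ?thesis using Y(1)[of n] by (simp add: divide_le_eq)
      qed
      then show "AE x in M. norm (?g n x) \<le> w x" for n by simp
    qed
    moreover have "(LINT x|M. ?g n x) = ((LINT x|M. f (Y n) x) - (LINT x|M. f s0 x)) / (Y n - s0)" for n
      using Bochner_Integration.integral_diff[OF int[OF Y(2)[of n]] i0] by simp
    ultimately have "(\<lambda>n. ((LINT x|M. f (Y n) x) - (LINT x|M. f s0 x)) / (Y n - s0)) \<longlonglongrightarrow> (LINT x|M. f' s0 x)"
      by (simp only:)
    then have "(\<lambda>n. ((LINT x|M. f (X (n + N)) x) - (LINT x|M. f s0 x)) / (X (n + N) - s0)) \<longlonglongrightarrow> (LINT x|M. f' s0 x)"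
      by (simp only: Y_def)
    then show "(\<lambda>n. ((LINT x|M. f (X n) x) - (LINT x|M. f s0 x)) / (X n - s0)) \<longlonglongrightarrow> (LINT x|M. f' s0 x)"
      by (rule LIMSEQ_offset)
  qed
  then show ?thesis .
qed
lemma lborel_integral_translation:
  fixes f :: "'a::euclidean_space \<Rightarrow> real"
  assumes "f \<in> borel_measurable borel"
  shows "(LINT x|lborel. f (x + a)) = (LINT x|lborel. f x)"
proof -
  have "(LINT x|lborel. f x) = (LINT x|distr lborel borel ((+) a). f x)"
    by (simp add: lborel_distr_plus)
  also have "\<dots> = (LINT x|lborel. f (a + x))"
    using assms by (subst integral_distr) auto
  finally show ?thesis by (simp add: add.commute)
qed
lemma nn_integral_affine:
  fixes t :: "'a::euclidean_space"
  assumes [measurable]: "f \<in> borel_measurable borel" and c: "c \<noteq> 0"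
  shows "(\<integral>\<^sup>+x. f x \<partial>lborel) = ennreal (\<bar>c\<bar> ^ DIM('a)) * (\<integral>\<^sup>+x. f (t + c *\<^sub>R x) \<partial>lborel)"
  by (subst lborel_affine[OF c, of t])
     (simp add: nn_integral_density nn_integral_distr nn_integral_cmult)
text \<open>All translates of \<phi> have the same integral; differentiating this constant with
  respect to the translation gives the claim. This is the source of every integration by parts
  below.\<close>

lemma integral_grad_eq_0:
  fixes \<phi> :: "'a::euclidean_space \<Rightarrow> real"
  assumes "\<phi> \<in> test_functions \<Omega>" shows "(LINT x|lborel. grad \<phi> x \<bullet> b) = 0"
proof -
  note sm = test_smooth[OF assms]
  obtain K where K: "compact K" "K \<subseteq> \<Omega>" "\<And>x. x \<notin> K \<Longrightarrow> \<phi> x = 0"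
    "\<And>x. x \<notin> K \<Longrightarrow> grad \<phi> x = 0" using test_support[OF assms] by blast
  obtain B where B: "B \<ge> 0" "\<And>x. norm (grad \<phi> x) \<le> B" using test_grad_bound[OF assms] by blast
  obtain r where r: "\<And>x. x \<in> K \<Longrightarrow> norm x \<le> r" using compact_imp_bounded[OF K(1)] by (auto simp: bounded_iff)
  have [measurable]: "\<phi> \<in> borel_measurable borel"
    using smooth_continuous_on[OF sm] by (simp add: borel_measurable_continuous_onI)
  \<comment> \<open>Translations by \<open>s *\<^sub>R b\<close> with |s| < 1 move the support by at
    most the norm of \<open>b\<close>, so this ball contains the supports of all of them.\<close>
  let ?C = "cball 0 (r + norm b)"
  have far: "x + s *\<^sub>R b \<notin> K" if "x \<notin> ?C" "\<bar>s\<bar> < 1" for x s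
  proof
    assume "x + s *\<^sub>R b \<in> K"
    then have "norm x \<le> r + norm (s *\<^sub>R b)" using r norm_triangle_sub[of x "- (s *\<^sub>R b)"] by fastforce
    also have "norm (s *\<^sub>R b) \<le> norm b" using that(2) by (simp add: mult_left_le_one_le)
    finally show False using that(1) by simp
  qed
  have "((\<lambda>s. LINT x|lborel. \<phi> (x + s *\<^sub>R b)) has_real_derivative (LINT x|lborel. grad \<phi> (x + 0 *\<^sub>R b) \<bullet> b)) (at 0)"
  proof (rule has_real_derivative_integral[where e=1 and w="\<lambda>x. B * norm b * indicator ?C x"])
    fix s :: real assume s: "\<bar>s - 0\<bar> < 1"
    show "integrable lborel (\<lambda>x. \<phi> (x + s *\<^sub>R b))"
      using far s K by (intro integrable_compact_support[where K="?C"])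
        (auto intro!: continuous_on_compose2[OF smooth_continuous_on[OF sm, of UNIV]] continuous_intros)
    fix x
    show "\<bar>grad \<phi> (x + s *\<^sub>R b) \<bullet> b\<bar> \<le> B * norm b * indicator ?C x"
    proof (cases "x \<in> ?C")
      case True
      have "\<bar>grad \<phi> (x + s *\<^sub>R b) \<bullet> b\<bar> \<le> norm (grad \<phi> (x + s *\<^sub>R b)) * norm b" by (rule Cauchy_Schwarz_ineq2)
      also have "\<dots> \<le> B * norm b" using B by (intro mult_right_mono) auto
      finally show ?thesis using True by simp
    qed (use far s K in auto)
  next
    show "integrable lborel (\<lambda>x. B * norm b * indicator ?C x)"
      by (intro integrable_mult_right integrable_real_indicator emeasure_lborel_cball_finite) simp
  qed (auto intro: smooth_line_derivative[OF sm])
  moreover have "(LINT x|lborel. \<phi> (x + s *\<^sub>R b)) = (LINT x|lborel. \<phi> x)" for s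
    by (rule lborel_integral_translation) simp
  ultimately have "((\<lambda>s::real. LINT x|lborel. \<phi> x) has_real_derivative (LINT x|lborel. grad \<phi> x \<bullet> b)) (at 0)"
    by simp
  then show ?thesis using DERIV_unique DERIV_const by blast
qed

section \<open>Uniqueness of weak gradients\<close>

lemma integral_lebesgue_on_borel:
  fixes f :: "'a::euclidean_space \<Rightarrow> 'b::euclidean_space"
  assumes "open \<Omega>" "f \<in> borel_measurable borel" "\<And>x. x \<notin> \<Omega> \<Longrightarrow> f x = 0"
  shows "(LINT x|lebesgue_on \<Omega>. f x) = (LINT x|lborel. f x)"
proof -
  have [simp]: "(\<lambda>x. indicator \<Omega> x *\<^sub>R f x) = f" using assms(3) by (auto simp: fun_eq_iff indicator_def)
  have "(LINT x|lebesgue_on \<Omega>. f x) = (LINT x|lebesgue. indicator \<Omega> x *\<^sub>R f x)"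
    using assms by (subst integral_restrict_space) auto
  then show ?thesis using assms by (simp add: integral_completion)
qed

lemma integrable_lebesgue_on_borel:
  fixes f :: "'a::euclidean_space \<Rightarrow> 'b::euclidean_space"
  assumes "open \<Omega>" "integrable lborel f"
  shows "integrable (lebesgue_on \<Omega>) f"
proof -
  have "integrable lebesgue f" using assms by (simp add: integrable_completion)
  then have "integrable lebesgue (\<lambda>x. indicator \<Omega> x *\<^sub>R f x)"
    using assms by (intro integrable_mult_indicator) auto
  then show ?thesis using assms by (subst integrable_restrict_space) auto
qed

lemma locally_integrable_mult:
  fixes u :: "'a::euclidean_space \<Rightarrow> real"
  assumes "open \<Omega>" "locally_integrable \<Omega> u" "continuous_on UNIV h"
    "compact K" "K \<subseteq> \<Omega>" "\<And>x. x \<notin> K \<Longrightarrow> h x = 0"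
  shows "integrable (lebesgue_on \<Omega>) (\<lambda>x. u x * h x)"
proof -
  have u: "integrable lebesgue (\<lambda>x. indicator K x *\<^sub>R u x)"
    using assms by (auto simp: locally_integrable_def set_integrable_def)
  have "bounded (h ` K)"
    using assms continuous_on_subset compact_continuous_image compact_imp_bounded by blast
  then obtain B where "\<And>x. x \<in> K \<Longrightarrow> \<bar>h x\<bar> \<le> B" by (auto simp: bounded_iff)
  then have B: "\<bar>h x\<bar> \<le> max 0 B" for x using assms(6) by (cases "x \<in> K") (auto intro: le_max_iff_disj[THEN iffD2])
  have "h \<in> borel_measurable borel" using assms by (simp add: borel_measurable_continuous_onI)
  then have hm: "h \<in> borel_measurable lebesgue" by (simp add: measurable_completion)
  have "integrable lebesgue (\<lambda>x. (indicator K x *\<^sub>R u x) * h x)"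
  proof (rule Bochner_Integration.integrable_bound)
    show "integrable lebesgue (\<lambda>x. max 0 B * (indicator K x *\<^sub>R u x))" using u by simp
    show "(\<lambda>x. (indicator K x *\<^sub>R u x) * h x) \<in> borel_measurable lebesgue"
      by (intro borel_measurable_times borel_measurable_integrable[OF u] hm)
    show "AE x in lebesgue. norm ((indicator K x *\<^sub>R u x) * h x) \<le> norm (max 0 B * (indicator K x *\<^sub>R u x))"
      using B by (auto simp: abs_mult mult.commute[of _ "\<bar>h _\<bar>"] intro!: mult_right_mono)
  qed
  then have "integrable lebesgue (\<lambda>x. indicator \<Omega> x *\<^sub>R (indicator K x *\<^sub>R u x * h x))"
    using assms by (intro integrable_mult_indicator) auto
  moreover have "(\<lambda>x. indicator \<Omega> x *\<^sub>R (indicator K x *\<^sub>R u x * h x)) = (\<lambda>x. indicator \<Omega> x *\<^sub>R (u x * h x))"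
    using assms by (auto simp: fun_eq_iff indicator_def)
  ultimately show ?thesis using assms by (subst integrable_restrict_space) auto
qed

lemma locally_integrable_continuous:
  fixes f :: "'a::euclidean_space \<Rightarrow> 'b::euclidean_space"
  assumes "continuous_on \<Omega> f" shows "locally_integrable \<Omega> f"
  unfolding locally_integrable_def set_integrable_def
proof (intro allI impI)
  fix K assume K: "compact K \<and> K \<subseteq> \<Omega>"
  then have "integrable lborel (\<lambda>x. indicator K x *\<^sub>R f x)"
    using assms by (intro borel_integrable_compact) (auto intro: continuous_on_subset)
  then show "integrable lebesgue (\<lambda>x. indicator K x *\<^sub>R f x)" by (simp add: integrable_completion)
qed

lemma locally_integrable_inner:
  "locally_integrable \<Omega> g \<Longrightarrow> locally_integrable \<Omega> (\<lambda>x. g x \<bullet> b)"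
  unfolding locally_integrable_def set_integrable_def
  using integrable_inner_left[of b lebesgue] by (fastforce simp: inner_scaleR_left[symmetric] simp del: inner_scaleR_left)

lemma locally_integrable_diff:
  "locally_integrable \<Omega> f \<Longrightarrow> locally_integrable \<Omega> g \<Longrightarrow> locally_integrable \<Omega> (\<lambda>x. f x - g x)"
  unfolding locally_integrable_def by (auto intro: set_integral_diff)

lemma weak_gradient_integrable:
  assumes "open \<Omega>" "locally_integrable \<Omega> u" "\<phi> \<in> test_functions \<Omega>"
  shows "integrable (lebesgue_on \<Omega>) (\<lambda>x. u x * \<phi> x)"
    "integrable (lebesgue_on \<Omega>) (\<lambda>x. u x * frechet_derivative \<phi> (at x) b)"
proof -
  obtain K where K: "compact K" "K \<subseteq> \<Omega>" "\<And>x. x \<notin> K \<Longrightarrow> \<phi> x = 0" "\<And>x. x \<notin> K \<Longrightarrow> grad \<phi> x = 0"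
    using test_support[OF assms(3)] by blast
  note sm = test_smooth[OF assms(3)]
  show "integrable (lebesgue_on \<Omega>) (\<lambda>x. u x * \<phi> x)"
    by (rule locally_integrable_mult[OF assms(1,2) smooth_continuous_on[OF sm] K(1,2)]) (rule K(3))
  show "integrable (lebesgue_on \<Omega>) (\<lambda>x. u x * frechet_derivative \<phi> (at x) b)"
    by (rule locally_integrable_mult[OF assms(1,2) smooth_continuous_on[OF smooth_frechet_derivative[OF sm]] K(1,2)])
       (simp add: frechet_eq_grad[OF sm] K(4))
qed

text \<open>The gradient of the product \<open>u x * \<phi> x\<close>, which is again a test
  function, integrates to zero; the product rule then yields the integration by parts.\<close>

lemma has_weak_gradient_grad:
  assumes "open \<Omega>" "smooth u" shows "has_weak_gradient \<Omega> u (grad u)"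
  unfolding has_weak_gradient_def
proof (intro conjI ballI)
  show u: "locally_integrable \<Omega> u" using assms by (intro locally_integrable_continuous smooth_continuous_on)
  show g: "locally_integrable \<Omega> (grad u)" using assms by (intro locally_integrable_continuous continuous_grad)
  fix \<phi> :: "'a \<Rightarrow> real" and b :: 'a assume \<phi>: "\<phi> \<in> test_functions \<Omega>" and b: "b \<in> Basis"
  note sm = test_smooth[OF \<phi>]
  obtain K where K: "compact K" "K \<subseteq> \<Omega>" "\<And>x. x \<notin> K \<Longrightarrow> \<phi> x = 0" "\<And>x. x \<notin> K \<Longrightarrow> grad \<phi> x = 0"
    using test_support[OF \<phi>] by blast
  have t: "(\<lambda>x. u x * \<phi> x) \<in> test_functions \<Omega>" by (rule test_mult[OF assms(2) \<phi>])
  have eq: "grad (\<lambda>x. u x * \<phi> x) x \<bullet> b = u x * frechet_derivative \<phi> (at x) b + (grad u x \<bullet> b) * \<phi> x" for x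
    by (simp add: grad_mult[OF assms(2) sm] frechet_eq_grad[OF sm] inner_add_left)
  have "(LINT x|lebesgue_on \<Omega>. grad (\<lambda>x. u x * \<phi> x) x \<bullet> b) = (LINT x|lborel. grad (\<lambda>x. u x * \<phi> x) x \<bullet> b)"
  proof (rule integral_lebesgue_on_borel[OF assms(1)])
    show "(\<lambda>x. grad (\<lambda>x. u x * \<phi> x) x \<bullet> b) \<in> borel_measurable borel"
      by (intro borel_measurable_continuous_onI continuous_intros continuous_grad test_smooth[OF t])
    show "grad (\<lambda>x. u x * \<phi> x) x \<bullet> b = 0" if "x \<notin> \<Omega>" for x
    proof -
      have "x \<notin> K" using that K(2) by blast
      then show ?thesis by (subst eq) (simp add: frechet_eq_grad[OF sm] K(3,4))
    qed
  qed
  also have "\<dots> = 0" by (rule integral_grad_eq_0[OF t])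
  finally have "(LINT x|lebesgue_on \<Omega>. u x * frechet_derivative \<phi> (at x) b + (grad u x \<bullet> b) * \<phi> x) = 0"
    by (simp add: eq)
  then show "(LINT x|lebesgue_on \<Omega>. u x * frechet_derivative \<phi> (at x) b) = - (LINT x|lebesgue_on \<Omega>. (grad u x \<bullet> b) * \<phi> x)"
    using weak_gradient_integrable[OF assms(1) u \<phi>] weak_gradient_integrable[OF assms(1) locally_integrable_inner[OF g] \<phi>]
    by (simp add: Bochner_Integration.integral_add)
qed

lemma has_weak_gradient_diff:
  assumes "open \<Omega>" "has_weak_gradient \<Omega> u g" "has_weak_gradient \<Omega> v h"
  shows "has_weak_gradient \<Omega> (\<lambda>x. u x - v x) (\<lambda>x. g x - h x)"
proof -
  have L: "locally_integrable \<Omega> u" "locally_integrable \<Omega> v" "locally_integrable \<Omega> g" "locally_integrable \<Omega> h"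
    using assms by (auto simp: has_weak_gradient_def)
  show ?thesis
    unfolding has_weak_gradient_def
  proof (intro conjI ballI locally_integrable_diff L)
    fix \<phi> :: "'a \<Rightarrow> real" and b :: 'a assume \<phi>: "\<phi> \<in> test_functions \<Omega>" and b: "b \<in> Basis"
    have "(LINT x|lebesgue_on \<Omega>. u x * frechet_derivative \<phi> (at x) b) = - (LINT x|lebesgue_on \<Omega>. (g x \<bullet> b) * \<phi> x)"
      "(LINT x|lebesgue_on \<Omega>. v x * frechet_derivative \<phi> (at x) b) = - (LINT x|lebesgue_on \<Omega>. (h x \<bullet> b) * \<phi> x)"
      using assms(2,3) \<phi> b by (auto simp: has_weak_gradient_def)
    then show "(LINT x|lebesgue_on \<Omega>. (u x - v x) * frechet_derivative \<phi> (at x) b) =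
        - (LINT x|lebesgue_on \<Omega>. ((g x - h x) \<bullet> b) * \<phi> x)"
      using weak_gradient_integrable[OF assms(1) L(1) \<phi>] weak_gradient_integrable[OF assms(1) L(2) \<phi>]
        weak_gradient_integrable(1)[OF assms(1) locally_integrable_inner[OF L(3)] \<phi>]
        weak_gradient_integrable(1)[OF assms(1) locally_integrable_inner[OF L(4)] \<phi>]
      by (simp add: left_diff_distrib inner_diff_left)
  qed
qed

text \<open>The bumps on the box are admissible test functions bounded by 1 that tend to the
  indicator of the open box, so dominated convergence passes the hypothesis to that indicator. The
  boundary of the box carries no integral.\<close>

lemma integral_test_eq_0_imp_integral_box:
  fixes d :: "'a::euclidean_space \<Rightarrow> real"
  assumes "open \<Omega>" "locally_integrable \<Omega> d" "\<And>\<phi>. \<phi> \<in> test_functions \<Omega> \<Longrightarrow> (LINT x|lebesgue_on \<Omega>. d x * \<phi> x) = 0"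
    and sub: "cbox a c \<subseteq> \<Omega>"
  shows "integral (cbox a c) d = 0"
proof -
  have sd: "set_integrable lebesgue (cbox a c) d"
    using assms(2) sub compact_cbox by (auto simp: locally_integrable_def)
  have "set_integrable lebesgue (box a c) d"
    by (rule set_integrable_subset[OF sd]) (auto simp: box_subset_cbox)
  then have "integral (cbox a c) d = (LINT x:box a c|lebesgue. d x)"
    by (metis integral_open_interval set_lebesgue_integral_eq_integral(2))
  also have "\<dots> = 0"
  proof (rule LIMSEQ_unique)
    have eq: "(LINT x|lebesgue. (indicator (cbox a c) x *\<^sub>R d x) * box_bump n a c x) = 0" for n
    proof -
      have "(LINT x|lebesgue_on \<Omega>. d x * box_bump n a c x) = (LINT x|lebesgue. indicator \<Omega> x *\<^sub>R (d x * box_bump n a c x))"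
        using assms(1) by (subst integral_restrict_space) auto
      also have "(\<lambda>x. indicator \<Omega> x *\<^sub>R (d x * box_bump n a c x)) = (\<lambda>x. (indicator (cbox a c) x *\<^sub>R d x) * box_bump n a c x)"
        using sub box_subset_cbox[of a c] box_bump_eq_0[of _ a c n]
        by (auto simp: fun_eq_iff indicator_def subset_iff)
      finally show ?thesis using assms(3)[OF box_bump_test[OF sub]] by simp
    qed
    have "(\<lambda>n. LINT x|lebesgue. (indicator (cbox a c) x *\<^sub>R d x) * box_bump n a c x) \<longlonglongrightarrow>
        (LINT x|lebesgue. (indicator (cbox a c) x *\<^sub>R d x) * indicator (box a c) x)"
    proof (rule integral_dominated_convergence[where w="\<lambda>x. \<bar>indicator (cbox a c) x *\<^sub>R d x\<bar>"])
      have m: "(\<lambda>x. indicator (cbox a c) x *\<^sub>R d x) \<in> borel_measurable lebesgue"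
        using sd by (auto simp: set_integrable_def)
      then show "(\<lambda>x. (indicator (cbox a c) x *\<^sub>R d x) * indicator (box a c) x) \<in> borel_measurable lebesgue"
        by (intro borel_measurable_times borel_measurable_indicator sets_completionI_sets) auto
      show "(\<lambda>x. (indicator (cbox a c) x *\<^sub>R d x) * box_bump n a c x) \<in> borel_measurable lebesgue" for n
        using borel_measurable_continuous_onI[OF smooth_continuous_on[OF smooth_box_bump[of n a c]]]
        by (intro borel_measurable_times[OF m]) (simp add: measurable_completion)
      show "integrable lebesgue (\<lambda>x. \<bar>indicator (cbox a c) x *\<^sub>R d x\<bar>)"
        using sd by (auto simp: set_integrable_def)
      show "AE x in lebesgue. (\<lambda>n. (indicator (cbox a c) x *\<^sub>R d x) * box_bump n a c x) \<longlonglongrightarrow> (indicator (cbox a c) x *\<^sub>R d x) * indicator (box a c) x"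
        by (intro AE_I2 tendsto_mult tendsto_const box_bump_tendsto)
      show "AE x in lebesgue. norm ((indicator (cbox a c) x *\<^sub>R d x) * box_bump n a c x) \<le> \<bar>indicator (cbox a c) x *\<^sub>R d x\<bar>" for n
        using box_bump_nonneg[of n a c] box_bump_le_1[of n a c] by (auto simp: abs_mult intro!: mult_left_le)
    qed
    moreover have "(LINT x|lebesgue. (indicator (cbox a c) x *\<^sub>R d x) * indicator (box a c) x) = (LINT x:box a c|lebesgue. d x)"
      unfolding set_lebesgue_integral_def using box_subset_cbox[of a c]
      by (intro Bochner_Integration.integral_cong) (auto simp: indicator_def)
    ultimately show "(\<lambda>n. 0::real) \<longlonglongrightarrow> (LINT x:box a c|lebesgue. d x)" by (simp only: eq)
  qed auto
  finally show ?thesis .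
qed

text \<open>This is the fundamental lemma of the calculus of variations. At almost every point the
  function is the limit of its averages over small cubes with lower corner at that point, and these
  averages vanish by the preceding result.\<close>

lemma integral_test_eq_0_imp_AE:
  fixes d :: "'a::euclidean_space \<Rightarrow> real"
  assumes "open \<Omega>" "locally_integrable \<Omega> d" "\<And>\<phi>. \<phi> \<in> test_functions \<Omega> \<Longrightarrow> (LINT x|lebesgue_on \<Omega>. d x * \<phi> x) = 0"
  shows "AE x in lebesgue. x \<in> \<Omega> \<longrightarrow> d x = 0"
proof -
  have box: "AE x in lebesgue. x \<in> cbox a c \<longrightarrow> d x = 0" if sub: "cbox a c \<subseteq> \<Omega>" for a c
  proof -
    define F where "F x = indicator (cbox a c) x *\<^sub>R d x" for x
    have "integrable lebesgue F"
      using assms(2) sub compact_cbox by (auto simp: locally_integrable_def set_integrable_def F_def [abs_def])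
    then have "F integrable_on UNIV" by (rule integrable_on_lebesgue)
    then have "F integrable_on cbox p r" for p r using integrable_on_subcbox by blast
    then obtain N where N: "negligible N"
      "\<And>x e. \<lbrakk>x \<notin> N; 0 < e\<rbrakk> \<Longrightarrow> \<exists>\<delta>>0. \<forall>h. 0 < h \<and> h < \<delta> \<longrightarrow>
          norm (integral (cbox x (x + h *\<^sub>R One)) F /\<^sub>R h ^ DIM('a) - F x) < e"
      using integrable_ccontinuous_explicit[of F] by blast
    have "d x = 0" if x: "x \<in> box a c" "x \<notin> N" for x
    proof -
      have "\<bar>F x\<bar> < e" if "e > 0" for e
      proof -
        obtain \<delta> where \<delta>: "\<delta> > 0" "\<And>h. 0 < h \<Longrightarrow> h < \<delta> \<Longrightarrow> norm (integral (cbox x (x + h *\<^sub>R One)) F /\<^sub>R h ^ DIM('a) - F x) < e"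
          using N(2)[OF x(2) \<open>e > 0\<close>] by blast
        obtain \<epsilon> where \<epsilon>: "\<epsilon> > 0" "ball x \<epsilon> \<subseteq> box a c"
          using x(1) open_box open_contains_ball by blast
        \<comment> \<open>A cube of side h has diameter h times the norm of \<open>One\<close>, so
          this choice keeps it inside the ball of radius \<epsilon>, with h < \<delta> as
          well.\<close>
        define h where "h = min (\<delta> / 2) (\<epsilon> / (2 * norm (One::'a)))"
        have One: "norm (One::'a) > 0" by simp
        have h: "0 < h" "h < \<delta>" using \<delta>(1) \<epsilon>(1) One by (auto simp: h_def)
        have "cbox x (x + h *\<^sub>R One) \<subseteq> cball x (h * norm (One::'a))"
        proof
          fix y assume y: "y \<in> cbox x (x + h *\<^sub>R One)"
          have "norm (y - x) \<le> norm (h *\<^sub>R One::'a)"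
            using y by (intro norm_le_componentwise) (auto simp: mem_box inner_diff_left inner_add_left algebra_simps)
          then show "y \<in> cball x (h * norm (One::'a))" using h by (simp add: dist_norm norm_minus_commute)
        qed
        also have "h * norm (One::'a) \<le> \<epsilon> / (2 * norm (One::'a)) * norm (One::'a)"
          by (intro mult_right_mono) (auto simp: h_def)
        then have "h * norm (One::'a) < \<epsilon>" using One \<epsilon>(1) by simp
        then have "cball x (h * norm (One::'a)) \<subseteq> box a c" using \<epsilon>(2) by (auto simp: subset_iff)
        finally have s: "cbox x (x + h *\<^sub>R One) \<subseteq> cbox a c" using box_subset_cbox by blast
        have "integral (cbox x (x + h *\<^sub>R One)) F = integral (cbox x (x + h *\<^sub>R One)) d"
          using s by (intro Henstock_Kurzweil_Integration.integral_cong) (auto simp: F_def)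
        also have "\<dots> = 0" using s sub by (intro integral_test_eq_0_imp_integral_box[OF assms]) auto
        finally show ?thesis using \<delta>(2)[OF h] by simp
      qed
      then have "F x = 0" by (metis abs_ge_zero less_irrefl not_less zero_less_abs_iff)
      then show ?thesis using x(1) box_subset_cbox[of a c] by (auto simp: F_def)
    qed
    then have "{x. \<not> (x \<in> cbox a c \<longrightarrow> d x = 0)} \<subseteq> N \<union> (cbox a c - box a c)" by auto
    moreover have "N \<union> (cbox a c - box a c) \<in> null_sets lebesgue"
      using N(1) negligible_frontier_interval[of a c] by (simp add: negligible_iff_null_sets null_sets.Un)
    ultimately show ?thesis by (intro AE_I') auto
  qed
  \<comment> \<open>The argument above works inside one closed box; countably many boxes exhaust the
    open set, so the exceptional null sets can be united.\<close>
  obtain D where D: "countable D" "D \<subseteq> Pow \<Omega>" "\<And>X. X \<in> D \<Longrightarrow> \<exists>a b. X = cbox a b" "\<Union>D = \<Omega>"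
    using open_countable_Union_open_cbox[OF assms(1)] by blast
  have "AE x in lebesgue. \<forall>X\<in>D. x \<in> X \<longrightarrow> d x = 0"
  proof (subst AE_ball_countable[OF D(1)], intro ballI)
    fix X assume "X \<in> D"
    then obtain a b where "X = cbox a b" "cbox a b \<subseteq> \<Omega>" using D(2,3) by blast
    then show "AE x in lebesgue. x \<in> X \<longrightarrow> d x = 0" using box by blast
  qed
  then show ?thesis by eventually_elim (use D(4) in blast)
qed

text \<open>The difference of two weak gradients is a weak gradient of \<open>u - u\<close>, that is
  of zero, so each of its components integrates to zero against every test function. This makes the
  norms of \<open>weak_gradient\<close> independent of the choice in its definition.\<close>

lemma has_weak_gradient_unique:
  fixes u :: "'a::euclidean_space \<Rightarrow> real"
  assumes "open \<Omega>" "has_weak_gradient \<Omega> u g" "has_weak_gradient \<Omega> u h"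
  shows "AE x in lebesgue_on \<Omega>. g x = h x"
proof -
  have w: "has_weak_gradient \<Omega> (\<lambda>x. u x - u x) (\<lambda>x. g x - h x)"
    using has_weak_gradient_diff[OF assms] .
  have "AE x in lebesgue. \<forall>b\<in>Basis. x \<in> \<Omega> \<longrightarrow> (g x - h x) \<bullet> b = 0"
  proof (subst AE_ball_countable, simp add: countable_finite, intro ballI)
    fix b :: 'a assume "b \<in> Basis"
    with w have "(LINT x|lebesgue_on \<Omega>. (g x - h x) \<bullet> b * \<phi> x) = 0" if "\<phi> \<in> test_functions \<Omega>" for \<phi>
      using that unfolding has_weak_gradient_def by auto
    then show "AE x in lebesgue. x \<in> \<Omega> \<longrightarrow> (g x - h x) \<bullet> b = 0"
      using w by (intro integral_test_eq_0_imp_AE[OF assms(1)] locally_integrable_inner) (auto simp: has_weak_gradient_def)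
  qed
  then have "AE x in lebesgue. x \<in> \<Omega> \<longrightarrow> g x = h x"
    by eventually_elim (metis euclidean_eqI eq_iff_diff_eq_0 inner_zero_left)
  then show ?thesis using assms(1) by (subst AE_restrict_space_iff) auto
qed

section \<open>Lipschitz bound from a bounded weak gradient\<close>

text \<open>The definition only concerns basis directions; expanding \<open>z\<close> in coordinates
  gives all directions, as needed to move along segments.\<close>

lemma has_weak_gradient_direction:
  assumes "open \<Omega>" "has_weak_gradient \<Omega> v g" "\<phi> \<in> test_functions \<Omega>"
  shows "(LINT x|lebesgue_on \<Omega>. v x * (grad \<phi> x \<bullet> z)) = - (LINT x|lebesgue_on \<Omega>. (g x \<bullet> z) * \<phi> x)"
    and "integrable (lebesgue_on \<Omega>) (\<lambda>x. (g x \<bullet> z) * \<phi> x)"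
proof -
  note sm = test_smooth[OF assms(3)]
  have L: "locally_integrable \<Omega> v" "locally_integrable \<Omega> g" using assms by (auto simp: has_weak_gradient_def)
  note Ig = weak_gradient_integrable(1)[OF assms(1) locally_integrable_inner[OF L(2)] assms(3)]
  note Iv = weak_gradient_integrable(2)[OF assms(1) L(1) assms(3)]
  have b: "(LINT x|lebesgue_on \<Omega>. v x * (grad \<phi> x \<bullet> b)) = - (LINT x|lebesgue_on \<Omega>. (g x \<bullet> b) * \<phi> x)" if "b \<in> Basis" for b
    using assms(2,3) that by (auto simp: has_weak_gradient_def frechet_eq_grad[OF sm, symmetric])
  have 1: "v x * (grad \<phi> x \<bullet> z) = (\<Sum>b\<in>Basis. (z \<bullet> b) * (v x * (grad \<phi> x \<bullet> b)))" for x
    by (subst euclidean_inner[of _ z]) (simp add: sum_distrib_left mult_ac)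
  have 2: "(g x \<bullet> z) * \<phi> x = (\<Sum>b\<in>Basis. (z \<bullet> b) * ((g x \<bullet> b) * \<phi> x))" for x
    by (subst euclidean_inner[of _ z]) (simp add: sum_distrib_right mult_ac sum_distrib_left)
  have "(LINT x|lebesgue_on \<Omega>. v x * (grad \<phi> x \<bullet> z)) = (\<Sum>b\<in>Basis. (z \<bullet> b) * (LINT x|lebesgue_on \<Omega>. v x * (grad \<phi> x \<bullet> b)))"
    unfolding 1 using Iv[unfolded frechet_eq_grad[OF sm]] by (subst Bochner_Integration.integral_sum) auto
  also have "\<dots> = (\<Sum>b\<in>Basis. (z \<bullet> b) * - (LINT x|lebesgue_on \<Omega>. (g x \<bullet> b) * \<phi> x))"
    by (intro sum.cong refl) (simp add: b)
  also have "\<dots> = - (LINT x|lebesgue_on \<Omega>. (g x \<bullet> z) * \<phi> x)"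
    unfolding 2 using Ig by (subst Bochner_Integration.integral_sum) (auto simp: sum_negf)
  finally show "(LINT x|lebesgue_on \<Omega>. v x * (grad \<phi> x \<bullet> z)) = - (LINT x|lebesgue_on \<Omega>. (g x \<bullet> z) * \<phi> x)" .
  show "integrable (lebesgue_on \<Omega>) (\<lambda>x. (g x \<bullet> z) * \<phi> x)" by (rule Ig)
qed

lemma integral_box_bump_pos:
  fixes a b :: "'a::euclidean_space"
  assumes "\<And>i. i \<in> Basis \<Longrightarrow> a \<bullet> i < b \<bullet> i"
  shows "0 < (LINT x|lborel. box_bump n a b x)" "integrable lborel (box_bump n a b)"
proof -
  show int: "integrable lborel (box_bump n a b)"
    using box_subset_cbox[of a b] by (intro integrable_compact_support[OF compact_cbox[of a b]] smooth_continuous_on smooth_box_bump)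
      (auto intro: box_bump_eq_0)
  have "(LINT x|lborel. box_bump n a b x) \<noteq> 0"
  proof
    assume "(LINT x|lborel. box_bump n a b x) = 0"
    then have "AE x in lborel. box_bump n a b x = 0"
      using integral_nonneg_eq_0_iff_AE[OF int AE_I2[OF box_bump_nonneg]] by simp
    then have "AE x in lborel. x \<notin> box a b"
      by eventually_elim (metis box_bump_pos_iff less_irrefl)
    then have "emeasure lborel (box a b) = 0"
      by (subst (asm) AE_iff_measurable[of "box a b"]) auto
    moreover have "emeasure lborel (box a b) = ennreal (\<Prod>i\<in>Basis. (b - a) \<bullet> i)"
      using assms by (subst emeasure_lborel_box) (auto intro: less_imp_le)
    moreover have "(\<Prod>i\<in>Basis. (b - a) \<bullet> i) > 0" using assms by (intro prod_pos) (auto simp: inner_diff_left)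
    ultimately show False by (metis ennreal_eq_0_iff not_le)
  qed
  moreover have "0 \<le> (LINT x|lborel. box_bump n a b x)" by (simp add: box_bump_nonneg integral_nonneg)
  ultimately show "0 < (LINT x|lborel. box_bump n a b x)" by linarith
qed

lemma smooth_shift: assumes "smooth \<phi>" shows "smooth (\<lambda>x. \<phi> (x - p))"
proof -
  have "Ck k f \<Longrightarrow> Ck k (\<lambda>x. f (x - p))" for k and f :: "'a \<Rightarrow> real"
  proof (induction k arbitrary: f)
    case 0
    then have "continuous_on UNIV f" by simp
    then have "continuous_on UNIV (\<lambda>x. f (x - p))"
      by (rule continuous_on_compose2) (simp_all add: continuous_on_diff)
    then show ?case by simp
  next
    case (Suc k)
    have "((\<lambda>x. x - p) has_derivative (\<lambda>v. v)) (at x)" for x by (auto intro!: derivative_eq_intros)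
    from has_derivative_compose[OF this Ck_has_derivative[OF Suc.prems]]
    have "((\<lambda>x. f (x - p)) has_derivative frechet_derivative f (at (x - p))) (at x)" for x .
    then show ?case by (rule Ck_SucI) (use Suc in auto)
  qed
  then show ?thesis using assms by (auto simp: smooth_def)
qed

lemma grad_shift: assumes "smooth \<phi>" shows "grad (\<lambda>x. \<phi> (x - p)) x = grad \<phi> (x - p)"
proof (rule grad_unique)
  have "((\<lambda>x. x - p) has_derivative (\<lambda>v. v)) (at x)" by (auto intro!: derivative_eq_intros)
  from has_derivative_compose[OF this smooth_has_grad[OF assms]]
  show "((\<lambda>x. \<phi> (x - p)) has_derivative (\<lambda>v. grad \<phi> (x - p) \<bullet> v)) (at x)" .
qed

text \<open>Moving a bump along the segment, the derivative of its integral against \<open>v\<close> is an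
  integral of the weak gradient against the bump.\<close>

lemma weak_gradient_bound_imp_lipschitz:
  fixes v :: "'a::euclidean_space \<Rightarrow> real"
  assumes \<Omega>: "open \<Omega>" and v: "continuous_on \<Omega> v" and g: "has_weak_gradient \<Omega> v g"
    and M: "AE x in lebesgue_on \<Omega>. norm (g x) \<le> M" "0 \<le> M"
    and seg: "closed_segment x y \<subseteq> \<Omega>"
  shows "\<bar>v x - v y\<bar> \<le> M * norm (y - x)"
proof (rule field_le_epsilon)
  fix \<epsilon> :: real assume "\<epsilon> > 0"
  define z where "z = y - x"
  have xy: "x \<in> \<Omega>" "y \<in> \<Omega>" using seg by auto
  have Lv: "locally_integrable \<Omega> v" using g by (simp add: has_weak_gradient_def)
  obtain \<rho> where \<rho>: "\<rho> > 0" "(\<Union>p\<in>closed_segment x y. cball p \<rho>) \<subseteq> \<Omega>"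
    using compact_subset_open_imp_cball_epsilon_subset[OF compact_segment \<Omega> seg] by blast
  define K where "K = (\<Union>p\<in>closed_segment x y. cball p \<rho>)"
  have K: "compact K" "K \<subseteq> \<Omega>" using compact_minkowski_sum_cball[OF compact_segment] \<rho> by (auto simp: K_def)
  have cont: "\<exists>d>0. \<forall>w. dist w p < d \<longrightarrow> dist (v w) (v p) < \<epsilon> / 2" if "p \<in> \<Omega>" for p
  proof -
    have "isCont v p" using v \<Omega> that by (simp add: continuous_on_eq_continuous_at)
    then have "\<exists>d>0. \<forall>w. w \<noteq> p \<and> dist w p < d \<longrightarrow> dist (v w) (v p) < \<epsilon> / 2"
      using \<open>\<epsilon> > 0\<close> unfolding isCont_def LIM_def by (metis half_gt_zero)
    then show ?thesis using \<open>\<epsilon> > 0\<close> by (metis dist_self half_gt_zero)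
  qed
  obtain d1 d2 where d: "d1 > 0" "\<And>w. dist w x < d1 \<Longrightarrow> dist (v w) (v x) < \<epsilon> / 2"
    "d2 > 0" "\<And>w. dist w y < d2 \<Longrightarrow> dist (v w) (v y) < \<epsilon> / 2"
    using cont[OF xy(1)] cont[OF xy(2)] by auto
  \<comment> \<open>Half of \<rho> is the room for the bump; the other half lets the parameter s
    leave [0, 1] a little, since two-sided derivatives are used at the endpoints. The bounds by d1
    and d2 make \<open>v\<close> nearly constant on the bump at either end.\<close>
  define r where "r = min (\<rho> / 2) (min (d1 / 2) (d2 / 2))"
  have r: "r > 0" "r \<le> \<rho> / 2" "r < d1" "r < d2" using \<rho> d by (auto simp: r_def)
  \<comment> \<open>The cube with half side h then fits into the ball of radius r.\<close>
  define h where "h = r / norm (One::'a)"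
  have h: "h > 0" using r by (simp add: h_def)
  define \<eta> where "\<eta> = box_bump 0 (- (h *\<^sub>R One)) (h *\<^sub>R One :: 'a)"
  have \<eta>0: "\<eta> w = 0" if "w \<notin> cball 0 r" for w
  proof -
    have "w \<notin> box (- (h *\<^sub>R One)) (h *\<^sub>R One)"
    proof
      assume w: "w \<in> box (- (h *\<^sub>R One)) (h *\<^sub>R One)"
      have "norm w \<le> norm (h *\<^sub>R One::'a)"
        using w h by (intro norm_le_componentwise) (fastforce simp: mem_box abs_le_iff)
      also have "\<dots> = r" using r(1) by (simp add: h_def)
      finally show False using that by simp
    qed
    then show ?thesis by (simp add: \<eta>_def box_bump_eq_0)
  qed
  have \<eta>nn: "\<eta> w \<ge> 0" for w by (simp add: \<eta>_def box_bump_nonneg)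
  have sm: "smooth \<eta>" by (simp add: \<eta>_def smooth_box_bump)
  have test: "\<eta> \<in> test_functions UNIV" using sm \<eta>0 by (intro testI[where K="cball 0 r"]) auto
  define c where "c = (LINT w|lborel. \<eta> w)"
  have c: "c > 0" and \<eta>int: "integrable lborel \<eta>"
    using integral_box_bump_pos[of "- (h *\<^sub>R One)" "h *\<^sub>R One::'a" 0] h by (auto simp: \<eta>_def c_def)
  have shift: "(\<lambda>w. \<eta> (w - p)) \<in> test_functions \<Omega>" if "cball p r \<subseteq> \<Omega>" for p
  proof (rule testI[OF smooth_shift[OF sm] compact_cball that])
    fix w assume "w \<notin> cball p r"
    then show "\<eta> (w - p) = 0" by (intro \<eta>0) (simp add: dist_norm norm_minus_commute)
  qed
  have cshift: "(LINT w|lebesgue_on \<Omega>. \<eta> (w - p)) = c" and ishift: "integrable (lebesgue_on \<Omega>) (\<lambda>w. \<eta> (w - p))"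
    if "cball p r \<subseteq> \<Omega>" for p
  proof -
    note s = smooth_continuous_on[OF smooth_shift[OF sm]]
    have 0: "\<eta> (w - p) = 0" if "w \<notin> cball p r" for w
      using that by (intro \<eta>0) (simp add: dist_norm norm_minus_commute)
    have "(LINT w|lebesgue_on \<Omega>. \<eta> (w - p)) = (LINT w|lborel. \<eta> (w - p))"
      by (intro integral_lebesgue_on_borel[OF \<Omega>] borel_measurable_continuous_onI s 0) (use that in blast)
    also have "\<dots> = c"
      unfolding c_def using lborel_integral_translation[of \<eta> "- p"] smooth_continuous_on[OF sm]
      by (simp add: borel_measurable_continuous_onI)
    finally show "(LINT w|lebesgue_on \<Omega>. \<eta> (w - p)) = c" .
    show "integrable (lebesgue_on \<Omega>) (\<lambda>w. \<eta> (w - p))"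
      using 0 by (intro integrable_lebesgue_on_borel[OF \<Omega>] integrable_compact_support[OF compact_cball s])
  qed
  \<comment> \<open>The value of \<open>v\<close> smeared around the moving point, not normalized:
    it is compared with \<open>c\<close> times the value of \<open>v\<close>.\<close>
  define F where "F s = (LINT w|lebesgue_on \<Omega>. v w * \<eta> (w - (x + s *\<^sub>R z)))" for s
  obtain C where C: "\<And>w. w \<in> K \<Longrightarrow> \<bar>v w\<bar> \<le> C" "C \<ge> 0"
  proof -
    have "bounded (v ` K)"
      using K v continuous_on_subset compact_continuous_image compact_imp_bounded by blast
    then obtain C where "\<And>w. w \<in> K \<Longrightarrow> \<bar>v w\<bar> \<le> C" by (auto simp: bounded_iff)
    then show ?thesis using that[of "max 0 C"] by (metis max.cobounded1 max.coboundedI2)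
  qed
  obtain B where B: "B \<ge> 0" "\<And>w. norm (grad \<eta> w) \<le> B" using test_grad_bound[OF test] by blast
  have on_seg: "x + s *\<^sub>R z \<in> closed_segment x y" if "s \<in> {0..1}" for s
    using that by (auto simp: closed_segment_def z_def algebra_simps intro!: exI[of _ s])
  \<comment> \<open>The summand 1 covers the degenerate segment with z = 0.\<close>
  define e where "e = \<rho> / (2 * (norm z + 1))"
  have e: "e > 0" using \<rho> by (simp add: e_def add_nonneg_pos)
  have ez: "e * norm z \<le> \<rho> / 2"
  proof -
    have "norm z + 1 > 0" by (simp add: add_nonneg_pos)
    moreover have "\<rho> / (2 * X) * X = \<rho> / 2" if "X > 0" for X :: real using that by simp
    ultimately have "e * (norm z + 1) = \<rho> / 2" unfolding e_def by blast
    then show ?thesis using e by (simp add: distrib_left)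
  qed
  have inK: "cball (x + s *\<^sub>R z) r \<subseteq> K" if s0: "s0 \<in> {0..1}" and s: "\<bar>s - s0\<bar> < e" for s s0
  proof
    fix w assume w: "w \<in> cball (x + s *\<^sub>R z) r"
    have "dist (x + s0 *\<^sub>R z) w \<le> dist (x + s0 *\<^sub>R z) (x + s *\<^sub>R z) + dist (x + s *\<^sub>R z) w" by (rule dist_triangle)
    also have "dist (x + s0 *\<^sub>R z) (x + s *\<^sub>R z) = \<bar>s - s0\<bar> * norm z"
      by (simp add: dist_norm scaleR_diff_left[symmetric] abs_minus_commute)
    also have "\<dots> \<le> e * norm z" using s by (intro mult_right_mono) auto
    finally have "dist (x + s0 *\<^sub>R z) w \<le> \<rho>" using ez w r by simp
    then show "w \<in> K" using on_seg[OF s0] by (auto simp: K_def)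
  qed
  have der: "(F has_real_derivative (LINT w|lebesgue_on \<Omega>. (g w \<bullet> z) * \<eta> (w - (x + s0 *\<^sub>R z)))) (at s0)" if s0: "s0 \<in> {0..1}" for s0
  proof -
    let ?p = "\<lambda>s. x + s *\<^sub>R z"
    have "(F has_real_derivative (LINT w|lebesgue_on \<Omega>. v w * - (grad \<eta> (w - ?p s0) \<bullet> z))) (at s0)"
      unfolding F_def
    proof (rule has_real_derivative_integral[OF e, where w="\<lambda>w. C * (B * norm z) * indicator K w"])
      fix s assume s: "\<bar>s - s0\<bar> < e"
      note sub = inK[OF s0 s]
      show "integrable (lebesgue_on \<Omega>) (\<lambda>w. v w * \<eta> (w - ?p s))"
        using sub K by (intro weak_gradient_integrable(1)[OF \<Omega> Lv shift]) blast
      fix w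
      have "((\<lambda>s. \<eta> ((w - x) + s *\<^sub>R (- z))) has_real_derivative grad \<eta> ((w - x) + s *\<^sub>R (- z)) \<bullet> (- z)) (at s)"
        by (rule smooth_line_derivative[OF sm])
      then have "((\<lambda>s. \<eta> (w - ?p s)) has_real_derivative - (grad \<eta> (w - ?p s) \<bullet> z)) (at s)"
        by (simp add: algebra_simps)
      then show "((\<lambda>s. v w * \<eta> (w - ?p s)) has_real_derivative v w * - (grad \<eta> (w - ?p s) \<bullet> z)) (at s)"
        by (rule DERIV_cmult)
      show "\<bar>v w * - (grad \<eta> (w - ?p s) \<bullet> z)\<bar> \<le> C * (B * norm z) * indicator K w"
      proof (cases "w \<in> K")
        case True
        have "\<bar>grad \<eta> (w - ?p s) \<bullet> z\<bar> \<le> norm (grad \<eta> (w - ?p s)) * norm z" by (rule Cauchy_Schwarz_ineq2)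
        also have "\<dots> \<le> B * norm z" using B by (intro mult_right_mono) auto
        finally have "\<bar>v w\<bar> * \<bar>grad \<eta> (w - ?p s) \<bullet> z\<bar> \<le> C * (B * norm z)"
          using C True by (intro mult_mono) auto
        then show ?thesis using True by (simp add: abs_mult)
      next
        case False
        then have nb: "w \<notin> cball (?p s) r" using sub by blast
        have "grad \<eta> (w - ?p s) = 0"
        proof -
          have "((\<lambda>w. 0) has_derivative (\<lambda>v. 0 \<bullet> v)) (at (w - ?p s))" by simp
          moreover have "open (- cball 0 r :: 'a set)" by (simp add: open_Compl)
          moreover have "w - ?p s \<in> - cball 0 r" using nb by (simp add: dist_norm norm_minus_commute)
          ultimately have "(\<eta> has_derivative (\<lambda>v. 0 \<bullet> v)) (at (w - ?p s))"
            by (rule has_derivative_transform_within_open) (metis \<eta>0 ComplD)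
          then show ?thesis by (rule grad_unique)
        qed
        then show ?thesis using False by simp
      qed
    next
      show "integrable (lebesgue_on \<Omega>) (\<lambda>w. C * (B * norm z) * indicator K w)"
        using emeasure_compact_finite[OF K(1)] borel_compact[OF K(1)]
        by (intro integrable_lebesgue_on_borel[OF \<Omega>] integrable_mult_right integrable_real_indicator) simp_all
    qed
    \<comment> \<open>Two minus signs cancel here, one from differentiating the shifted bump and one
      from the definition of a weak gradient.\<close>
    moreover have "(LINT w|lebesgue_on \<Omega>. v w * - (grad \<eta> (w - ?p s0) \<bullet> z)) = (LINT w|lebesgue_on \<Omega>. (g w \<bullet> z) * \<eta> (w - ?p s0))"
    proof -
      have "cball (?p s0) r \<subseteq> \<Omega>" using inK[OF s0, of s0] e K by simp
      from has_weak_gradient_direction(1)[OF \<Omega> g shift[OF this], of z]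
      show ?thesis by (simp add: grad_shift[OF sm])
    qed
    ultimately show ?thesis by simp
  qed
  have bd: "\<bar>LINT w|lebesgue_on \<Omega>. (g w \<bullet> z) * \<eta> (w - (x + s *\<^sub>R z))\<bar> \<le> M * norm z * c" if s: "s \<in> {0..1}" for s
  proof -
    have sub: "cball (x + s *\<^sub>R z) r \<subseteq> \<Omega>" using inK[OF s, of s] e K by simp
    let ?f = "\<lambda>w. (g w \<bullet> z) * \<eta> (w - (x + s *\<^sub>R z))"
    have i: "integrable (lebesgue_on \<Omega>) ?f" by (rule has_weak_gradient_direction(2)[OF \<Omega> g shift[OF sub]])
    have "\<bar>LINT w|lebesgue_on \<Omega>. ?f w\<bar> \<le> (LINT w|lebesgue_on \<Omega>. \<bar>?f w\<bar>)" by (rule integral_abs_bound)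
    also have "\<dots> \<le> (LINT w|lebesgue_on \<Omega>. M * norm z * \<eta> (w - (x + s *\<^sub>R z)))"
    proof (rule integral_mono_AE)
      show "AE w in lebesgue_on \<Omega>. \<bar>?f w\<bar> \<le> M * norm z * \<eta> (w - (x + s *\<^sub>R z))"
        using M(1)
      proof eventually_elim
        fix w assume "norm (g w) \<le> M"
        then have "\<bar>g w \<bullet> z\<bar> \<le> M * norm z"
          by (meson Cauchy_Schwarz_ineq2 mult_right_mono norm_ge_zero order_trans)
        then show "\<bar>?f w\<bar> \<le> M * norm z * \<eta> (w - (x + s *\<^sub>R z))"
          using \<eta>nn by (simp add: abs_mult mult_right_mono)
      qed
    qed (use i ishift[OF sub] in auto)
    also have "\<dots> = M * norm z * c" using cshift[OF sub] by simp
    finally show ?thesis .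
  qed
  have "norm (F 1 - F 0) \<le> M * norm z * c * norm (1 - 0 :: real)"
  proof (rule field_differentiable_bound[where S="{0..1}"])
    fix s :: real assume s: "s \<in> {0..1}"
    show "(F has_field_derivative (LINT w|lebesgue_on \<Omega>. (g w \<bullet> z) * \<eta> (w - (x + s *\<^sub>R z)))) (at s within {0..1})"
      using der[OF s] by (rule has_field_derivative_at_within)
    show "norm (LINT w|lebesgue_on \<Omega>. (g w \<bullet> z) * \<eta> (w - (x + s *\<^sub>R z))) \<le> M * norm z * c"
      using bd[OF s] by simp
  qed auto
  then have F10: "\<bar>F 1 - F 0\<bar> \<le> M * norm z * c" by simp
  have near: "\<bar>(LINT w|lebesgue_on \<Omega>. v w * \<eta> (w - p)) - v p * c\<bar> \<le> \<epsilon> / 2 * c"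
    if sub: "cball p r \<subseteq> \<Omega>" and cl: "\<And>w. w \<in> cball p r \<Longrightarrow> \<bar>v w - v p\<bar> \<le> \<epsilon> / 2" for p
  proof -
    have i: "integrable (lebesgue_on \<Omega>) (\<lambda>w. v w * \<eta> (w - p))" by (rule weak_gradient_integrable(1)[OF \<Omega> Lv shift[OF sub]])
    have "(LINT w|lebesgue_on \<Omega>. v w * \<eta> (w - p)) - v p * c = (LINT w|lebesgue_on \<Omega>. v w * \<eta> (w - p)) - (LINT w|lebesgue_on \<Omega>. v p * \<eta> (w - p))"
      using cshift[OF sub] by simp
    also have "\<dots> = (LINT w|lebesgue_on \<Omega>. v w * \<eta> (w - p) - v p * \<eta> (w - p))"
      using i ishift[OF sub] by (intro Bochner_Integration.integral_diff[symmetric]) auto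
    also have "\<bar>\<dots>\<bar> \<le> (LINT w|lebesgue_on \<Omega>. \<epsilon> / 2 * \<eta> (w - p))"
    proof (rule integral_abs_bound_integral)
      fix w
      show "\<bar>v w * \<eta> (w - p) - v p * \<eta> (w - p)\<bar> \<le> \<epsilon> / 2 * \<eta> (w - p)"
      proof (cases "w \<in> cball p r")
        case True
        have "\<bar>v w - v p\<bar> * \<eta> (w - p) \<le> \<epsilon> / 2 * \<eta> (w - p)"
          using cl[OF True] \<eta>nn[of "w - p"] by (rule mult_right_mono)
        then show ?thesis using \<eta>nn[of "w - p"] by (simp add: left_diff_distrib[symmetric] abs_mult)
      next
        case False
        then have "\<eta> (w - p) = 0" by (intro \<eta>0) (simp add: dist_norm norm_minus_commute)
        then show ?thesis by simp
      qed
    qed (use i ishift[OF sub] in auto)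
    also have "\<dots> = \<epsilon> / 2 * c" using cshift[OF sub] by simp
    finally show ?thesis .
  qed
  have "cball x r \<subseteq> \<Omega>" "cball y r \<subseteq> \<Omega>"
    using inK[of 0 0] inK[of 1 1] e K by (auto simp: z_def)
  moreover have "\<bar>v w - v x\<bar> \<le> \<epsilon> / 2" if "w \<in> cball x r" for w
    using d(2)[of w] that r(3) by (simp add: dist_commute dist_real_def)
  moreover have "\<bar>v w - v y\<bar> \<le> \<epsilon> / 2" if "w \<in> cball y r" for w
    using d(4)[of w] that r(4) by (simp add: dist_commute dist_real_def)
  ultimately have "\<bar>(LINT w|lebesgue_on \<Omega>. v w * \<eta> (w - x)) - v x * c\<bar> \<le> \<epsilon> / 2 * c"
    "\<bar>(LINT w|lebesgue_on \<Omega>. v w * \<eta> (w - y)) - v y * c\<bar> \<le> \<epsilon> / 2 * c"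
    by (blast intro: near)+
  then have "\<bar>F 0 - v x * c\<bar> \<le> \<epsilon> / 2 * c" "\<bar>F 1 - v y * c\<bar> \<le> \<epsilon> / 2 * c"
    by (simp_all add: F_def z_def)
  then have "\<bar>v x * c - v y * c\<bar> \<le> (M * norm z + \<epsilon>) * c"
    using F10 unfolding distrib_right by linarith
  then have "\<bar>v x - v y\<bar> * c \<le> (M * norm z + \<epsilon>) * c"
    using c by (simp add: left_diff_distrib[symmetric] abs_mult)
  then show "\<bar>v x - v y\<bar> \<le> M * norm (y - x) + \<epsilon>"
    using c by (simp add: z_def)
qed

section \<open>Mean value inequalities and Morrey's estimate\<close>

text \<open>For an exponent t in (0, 1] the concave function y powr t lies below its tangent at y =
  1.\<close>

lemma powr_le_affine:
  fixes t y :: real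
  assumes "0 < t" "t \<le> 1" "0 \<le> y" shows "y powr t \<le> t * y + (1 - t)"
proof (cases "y = 0")
  case False
  then show ?thesis using Youngs_inequality_0[of t "1 - t" y 1] assms by simp
qed (use assms in simp)

text \<open>The tangent bound is applied to f powr b divided by its mean \<open>B\<close>.
  Integrating it then makes the affine right-hand side equal to 1 on average, which replaces an
  appeal to Hoelder's inequality.\<close>

lemma power_mean:
  fixes f :: "'a \<Rightarrow> real"
  assumes M: "finite_measure M" and m: "measure M (space M) > 0" and f: "\<And>x. f x \<ge> 0" "f \<in> borel_measurable M"
    and ab: "0 < a" "a \<le> b" and int: "integrable M (\<lambda>x. f x powr b)"
  shows "integrable M (\<lambda>x. f x powr a)"
    and "(LINT x|M. f x powr a) / measure M (space M) \<le> ((LINT x|M. f x powr b) / measure M (space M)) powr (a / b)"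
proof -
  interpret finite_measure M by fact
  have t: "0 < a / b" "a / b \<le> 1" using ab by auto
  have pw: "f x powr a = (f x powr b) powr (a / b)" for x using ab by (simp add: powr_powr)
  show inta: "integrable M (\<lambda>x. f x powr a)"
  proof (rule Bochner_Integration.integrable_bound)
    show "integrable M (\<lambda>x. a / b * (f x powr b) + (1 - a / b))" using int by auto
    show "AE x in M. norm (f x powr a) \<le> norm (a / b * (f x powr b) + (1 - a / b))"
      using powr_le_affine[OF t] by (auto simp: pw intro!: AE_I2 order_trans[OF _ abs_ge_self])
  qed (use f(2) in measurable)
  let ?m = "measure M (space M)"
  define B where "B = (LINT x|M. f x powr b) / ?m"
  have B0: "B \<ge> 0" using m by (simp add: B_def integral_nonneg)
  show "(LINT x|M. f x powr a) / ?m \<le> ((LINT x|M. f x powr b) / ?m) powr (a / b)"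
  \<comment> \<open>The normalization divides by \<open>B\<close>; if it is 0, then f vanishes
    almost everywhere.\<close>
  proof (cases "B = 0")
    case True
    then have "(LINT x|M. f x powr b) = 0" using m by (simp add: B_def)
    then have "AE x in M. f x powr b = 0" using integral_nonneg_eq_0_iff_AE[OF int] by simp
    then have "AE x in M. f x powr a = 0" by eventually_elim simp
    then have "(LINT x|M. f x powr a) = 0" by (rule integral_eq_zero_AE)
    then show ?thesis by simp
  next
    case False
    then have B: "B > 0" using B0 by simp
    have le: "f x powr a \<le> B powr (a / b) * (a / b * (f x powr b / B) + (1 - a / b))" for x
    proof -
      have "f x powr a = B powr (a / b) * (f x powr b / B) powr (a / b)"
        using B ab by (simp add: pw powr_divide)
      also have "\<dots> \<le> B powr (a / b) * (a / b * (f x powr b / B) + (1 - a / b))"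
        using B by (intro mult_left_mono powr_le_affine t) auto
      finally show ?thesis .
    qed
    have "(LINT x|M. f x powr a) \<le> (LINT x|M. B powr (a / b) * (a / b * (f x powr b / B) + (1 - a / b)))"
      using int inta le by (intro integral_mono) auto
    also have "\<dots> = B powr (a / b) * (a / b * ((LINT x|M. f x powr b) / B) + (1 - a / b) * ?m)"
      using int by simp
    also have "(LINT x|M. f x powr b) / B = ?m"
    proof -
      have "(LINT x|M. f x powr b) = B * ?m" using m by (simp add: B_def)
      then show ?thesis using B by simp
    qed
    also have "B powr (a / b) * (a / b * ?m + (1 - a / b) * ?m) = B powr (a / b) * ?m"
      by (simp add: algebra_simps)
    finally show ?thesis using m by (simp add: B_def divide_le_eq)
  qed
qed

text \<open>For positive arguments this is convexity of the power function; when an argument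
  vanishes, c powr r <= c for c in [0, 1] suffices.\<close>

lemma powr_convex_combination:
  fixes r s t x y :: real
  assumes "r \<ge> 1" "s \<ge> 0" "t \<ge> 0" "s + t = 1" "x \<ge> 0" "y \<ge> 0"
  shows "(s * x + t * y) powr r \<le> s * x powr r + t * y powr r"
proof -
  have small: "(c * z) powr r \<le> c * z powr r" if "0 \<le> c" "c \<le> 1" "z \<ge> 0" for c z :: real
  proof -
    have "c powr r \<le> c powr 1" by (rule powr_mono') (use that assms(1) in auto)
    then show ?thesis using that by (simp add: powr_mult mult_right_mono)
  qed
  consider "x = 0" | "y = 0" | "x > 0" "y > 0" using assms by linarith
  then show ?thesis
  proof cases
    case 3
    then show ?thesis
      using powr_convex[OF assms(1)] assms by (simp add: convex_on_def)
  qed (use small assms in auto)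
qed

text \<open>For numbers A and B strictly above the two norms, |f| + |g| is A + B times a convex
  combination of |f| / A and |g| / B, and convexity of the power bounds the integral by (A + B) powr
  r. Strictness avoids dividing by a vanishing norm and is removed at the end.\<close>

lemma Minkowski_powr:
  fixes f g :: "'a \<Rightarrow> 'b::euclidean_space"
  assumes r: "r \<ge> 1" and meas: "f \<in> borel_measurable M" "g \<in> borel_measurable M"
    and int: "integrable M (\<lambda>x. norm (f x) powr r)" "integrable M (\<lambda>x. norm (g x) powr r)"
  shows "integrable M (\<lambda>x. norm (f x + g x) powr r)"
    and "(LINT x|M. norm (f x + g x) powr r) powr (1/r)
       \<le> (LINT x|M. norm (f x) powr r) powr (1/r) + (LINT x|M. norm (g x) powr r) powr (1/r)"
proof -
  have pt: "norm (f x + g x) powr r \<le> (A + B) powr r * (A / (A + B) * (norm (f x) powr r / A powr r) + B / (A + B) * (norm (g x) powr r / B powr r))"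
    if AB: "A > 0" "B > 0" for A B x
  proof -
    have "norm (f x + g x) powr r \<le> (norm (f x) + norm (g x)) powr r"
      using r by (intro powr_mono2 norm_triangle_ineq) auto
    also have "norm (f x) + norm (g x) = (A + B) * (A / (A + B) * (norm (f x) / A) + B / (A + B) * (norm (g x) / B))"
    proof -
      have "A / (A + B) * (norm (f x) / A) = norm (f x) / (A + B)" "B / (A + B) * (norm (g x) / B) = norm (g x) / (A + B)"
        using AB by simp_all
      then show ?thesis using AB by (simp add: add_divide_distrib[symmetric])
    qed
    also have "\<dots> powr r = (A + B) powr r * (A / (A + B) * (norm (f x) / A) + B / (A + B) * (norm (g x) / B)) powr r"
      by (rule powr_mult)
    also have "\<dots> \<le> (A + B) powr r * (A / (A + B) * (norm (f x) / A) powr r + B / (A + B) * (norm (g x) / B) powr r)"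
      using AB r by (intro mult_left_mono powr_convex_combination) (auto simp: add_divide_distrib[symmetric])
    finally show ?thesis using AB by (simp add: powr_divide)
  qed
  show ifg: "integrable M (\<lambda>x. norm (f x + g x) powr r)"
  proof (rule Bochner_Integration.integrable_bound)
    show "integrable M (\<lambda>x. (1 + 1) powr r * (1 / (1 + 1) * (norm (f x) powr r / 1 powr r) + 1 / (1 + 1) * (norm (g x) powr r / 1 powr r)))"
      using int by auto
    show "AE x in M. norm (norm (f x + g x) powr r) \<le> norm ((1 + 1) powr r * (1 / (1 + 1) * (norm (f x) powr r / 1 powr r) + 1 / (1 + 1) * (norm (g x) powr r / 1 powr r)))"
      using pt[of 1 1] by (intro AE_I2 order_trans[OF _ abs_ge_self[unfolded real_norm_def[symmetric]]]) simp
  qed (use meas in measurable)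
  let ?F = "LINT x|M. norm (f x) powr r" and ?G = "LINT x|M. norm (g x) powr r"
  have F0: "?F \<ge> 0" "?G \<ge> 0" by (auto intro: integral_nonneg)
  have main: "(LINT x|M. norm (f x + g x) powr r) powr (1/r) \<le> A + B" if AB: "A > ?F powr (1/r)" "B > ?G powr (1/r)" for A B
  proof -
    have pos: "A > 0" "B > 0" using AB by (meson powr_ge_zero le_less_trans)+
    have "(?F powr (1/r)) powr r \<le> A powr r" "(?G powr (1/r)) powr r \<le> B powr r"
      using AB r by (auto intro!: powr_mono2)
    then have FA: "?F \<le> A powr r" "?G \<le> B powr r" using F0 r by (auto simp: powr_powr)
    have "(LINT x|M. norm (f x + g x) powr r) \<le>
      (LINT x|M. (A + B) powr r * (A / (A + B) * (norm (f x) powr r / A powr r) + B / (A + B) * (norm (g x) powr r / B powr r)))"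
      using ifg int pt[OF pos] by (intro integral_mono) auto
    also have "\<dots> = (A + B) powr r * (A / (A + B) * (?F / A powr r) + B / (A + B) * (?G / B powr r))"
      using int by simp
    also have "\<dots> \<le> (A + B) powr r * (A / (A + B) * 1 + B / (A + B) * 1)"
      using FA pos by (intro mult_left_mono add_mono) auto
    also have "A / (A + B) * 1 + B / (A + B) * 1 = 1" using pos by (simp add: add_divide_distrib[symmetric])
    finally have "(LINT x|M. norm (f x + g x) powr r) powr (1/r) \<le> ((A + B) powr r) powr (1/r)"
      using r by (intro powr_mono2) (auto intro: integral_nonneg)
    also have "\<dots> = A + B" using pos r by (simp add: powr_powr)
    finally show ?thesis .
  qed
  show "(LINT x|M. norm (f x + g x) powr r) powr (1/r) \<le> ?F powr (1/r) + ?G powr (1/r)"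
  proof (rule field_le_epsilon)
    fix e :: real assume "e > 0"
    then show "(LINT x|M. norm (f x + g x) powr r) powr (1/r) \<le> ?F powr (1/r) + ?G powr (1/r) + e"
      using main[of "?F powr (1/r) + e / 2" "?G powr (1/r) + e / 2"] by simp
  qed
qed

text \<open>The derivative in \<open>t\<close> of the mean of \<open>\<phi> (w + t *\<^sub>R (z - w))\<close> over \<open>z \<in> B\<close> is at most
  \<open>D / sqrt t\<close> times the normalized \<open>L\<^sup>2\<^sup>N\<close> norm of the gradient, because the dilation by \<open>t\<close>
  costs a factor \<open>t powr (- N)\<close> before taking the root.\<close>

lemma mean_value_dilation_bound:
  fixes \<phi> :: "'a::euclidean_space \<Rightarrow> real"
  assumes \<phi>: "\<phi> \<in> test_functions \<Omega>" and B: "compact B" "measure lborel B > 0"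
    and D: "\<And>z. z \<in> B \<Longrightarrow> norm (z - w) \<le> D" "D \<ge> 0"
  defines "m \<equiv> 2 * real DIM('a)"
  shows "\<bar>\<phi> w - (LINT z|restrict_space lborel B. \<phi> z) / measure lborel B\<bar>
    \<le> 2 * D * ((LINT z|lborel. norm (grad \<phi> z) powr m) / measure lborel B) powr (1/m)"
proof -
  note sm = test_smooth[OF \<phi>]
  let ?M = "restrict_space lborel B"
  have Bm [measurable]: "B \<in> sets borel" using B by (simp add: borel_compact)
  have fin: "emeasure lborel B < \<infinity>" using emeasure_compact_finite[OF B(1)] by simp
  have M: "finite_measure ?M" using fin by (intro finite_measureI) (simp add: emeasure_restrict_space)
  interpret finite_measure ?M by (rule M)
  have mM: "measure ?M (space ?M) = measure lborel B" by (simp add: measure_restrict_space)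
  define \<beta> where "\<beta> = measure lborel B"
  have \<beta>: "\<beta> > 0" using B by (simp add: \<beta>_def)
  have "DIM('a) \<ge> 1" by (simp add: Suc_leI)
  then have m: "m \<ge> 1" unfolding m_def by linarith
  obtain G where G: "G \<ge> 0" "\<And>x. norm (grad \<phi> x) \<le> G" using test_grad_bound[OF \<phi>] by blast
  obtain P where P: "P \<ge> 0" "\<And>x. \<bar>\<phi> x\<bar> \<le> P" using test_bound[OF \<phi>] by blast
  define I where "I = (LINT z|lborel. norm (grad \<phi> z) powr m)"
  have [measurable]: "grad \<phi> \<in> borel_measurable borel" "\<phi> \<in> borel_measurable borel"
    using continuous_grad[OF sm] smooth_continuous_on[OF sm] by (auto intro: borel_measurable_continuous_onI)
  have [measurable]: "(\<lambda>z. w + t *\<^sub>R (z - w)) \<in> borel_measurable borel" for t by measurable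
  have Iint: "integrable lborel (\<lambda>z. norm (grad \<phi> z) powr m)"
  proof -
    obtain K where K: "compact K" "\<And>x. x \<notin> K \<Longrightarrow> grad \<phi> x = 0" using test_support[OF \<phi>] by blast
    show ?thesis
      using K m by (intro integrable_compact_support[OF K(1)] continuous_on_powr' continuous_on_norm continuous_grad sm) auto
  qed
  have I0: "I \<ge> 0" by (simp add: I_def integral_nonneg)
  \<comment> \<open>Up to the factor \<beta>, this is the mean of \<phi> over \<open>B\<close>
    shrunk towards \<open>w\<close> by the factor t. Thus \<open>H 0\<close> is \<phi> w times
    \<beta>, and \<open>H 1\<close> is the integral of \<phi> over \<open>B\<close>.\<close>
  define H where "H t = (LINT z|?M. \<phi> (w + t *\<^sub>R (z - w)))" for t
  define H' where "H' t = (LINT z|?M. grad \<phi> (w + t *\<^sub>R (z - w)) \<bullet> (z - w))" for t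
  have bdz: "AE z in ?M. norm (z - w) \<le> D" by (rule AE_I2) (use D in \<open>auto simp: space_restrict_space\<close>)
  have Hder: "(H has_real_derivative H' t) (at t)" for t
  proof -
    have eq: "(LINT z|?M. f (z::'a)) = (LINT z|lborel. indicator B z * f z)" for f :: "'a \<Rightarrow> real"
      by (subst integral_restrict_space) auto
    have "((\<lambda>t. LINT z|lborel. indicator B z * \<phi> (w + t *\<^sub>R (z - w))) has_real_derivative
        (LINT z|lborel. indicator B z * (grad \<phi> (w + t *\<^sub>R (z - w)) \<bullet> (z - w)))) (at t)"
    proof (rule has_real_derivative_integral[OF zero_less_one, where w="\<lambda>z. G * D * indicator B z"])
      fix s
      have "integrable lborel (\<lambda>z. P * indicator B z)" using fin by (intro integrable_mult_right integrable_real_indicator) auto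
      then show "integrable lborel (\<lambda>z. indicator B z * \<phi> (w + s *\<^sub>R (z - w)))"
        by (rule Bochner_Integration.integrable_bound) (use P in \<open>auto simp: indicator_def\<close>)
      fix z
      show "((\<lambda>s. indicator B z * \<phi> (w + s *\<^sub>R (z - w))) has_real_derivative indicator B z * (grad \<phi> (w + s *\<^sub>R (z - w)) \<bullet> (z - w))) (at s)"
        by (intro DERIV_cmult smooth_line_derivative sm)
      show "\<bar>indicator B z * (grad \<phi> (w + s *\<^sub>R (z - w)) \<bullet> (z - w))\<bar> \<le> G * D * indicator B z"
      proof (cases "z \<in> B")
        case True
        have "\<bar>grad \<phi> (w + s *\<^sub>R (z - w)) \<bullet> (z - w)\<bar> \<le> norm (grad \<phi> (w + s *\<^sub>R (z - w))) * norm (z - w)"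
          by (rule Cauchy_Schwarz_ineq2)
        also have "\<dots> \<le> G * D" using G D True by (intro mult_mono) auto
        finally show ?thesis using True by simp
      qed simp
    next
      show "integrable lborel (\<lambda>z. G * D * indicator B z)" using fin by (intro integrable_mult_right integrable_real_indicator) auto
    qed
    then show ?thesis unfolding H_def [abs_def] H'_def eq .
  qed
  define k where "k = D * (I / \<beta>) powr (1/m) * \<beta>"
  have H'le: "\<bar>H' t\<bar> \<le> k / sqrt t" if t: "t > 0" for t
  proof -
    let ?g = "\<lambda>z. norm (grad \<phi> (w + t *\<^sub>R (z - w)))"
    have bg: "?g z powr m \<le> G powr m" for z using G m by (intro powr_mono2) auto
    have gm: "?g \<in> borel_measurable ?M" by (intro measurable_restrict_space1) measurable
    have ig: "integrable ?M (\<lambda>z. ?g z powr m)"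
      using bg gm by (intro integrable_const_bound[where B="G powr m"]) auto
    have "(\<integral>\<^sup>+z. ennreal (?g z powr m) \<partial>?M) \<le> (\<integral>\<^sup>+z. ennreal (?g z powr m) \<partial>lborel)"
      by (subst nn_integral_restrict_space) (auto intro!: nn_integral_mono simp: indicator_def)
    \<comment> \<open>The integral has been enlarged to the whole space, so the change of variables
      gives the full energy, at the cost of the Jacobian factor t powr (- N).\<close>
    also have "\<dots> = ennreal (1 / t ^ DIM('a)) * (\<integral>\<^sup>+z. ennreal (norm (grad \<phi> z) powr m) \<partial>lborel)"
    proof -
      have "(\<integral>\<^sup>+z. ennreal (norm (grad \<phi> z) powr m) \<partial>lborel) = ennreal (t ^ DIM('a)) * (\<integral>\<^sup>+z. ennreal (norm (grad \<phi> ((w - t *\<^sub>R w) + t *\<^sub>R z)) powr m) \<partial>lborel)"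
        using t by (subst nn_integral_affine[of _ t "w - t *\<^sub>R w"]) auto
      also have "(\<lambda>z. (w - t *\<^sub>R w) + t *\<^sub>R z) = (\<lambda>z. w + t *\<^sub>R (z - w))" by (simp add: algebra_simps)
      finally show ?thesis using t
        by (simp add: mult.assoc[symmetric] ennreal_mult[symmetric] algebra_simps)
    qed
    also have "\<dots> = ennreal (1 / t ^ DIM('a) * I)"
      using nn_integral_eq_integral[OF Iint] ennreal_mult[of "1 / t ^ DIM('a)" I] t I0 by (simp add: I_def)
    finally have "ennreal (LINT z|?M. ?g z powr m) \<le> ennreal (I / t ^ DIM('a))"
      using nn_integral_eq_integral[OF ig] by simp
    then have Ig: "(LINT z|?M. ?g z powr m) \<le> I / t ^ DIM('a)" using I0 t by (simp add: ennreal_le_iff)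
    have "\<bar>H' t\<bar> \<le> (LINT z|?M. D * ?g z powr 1)"
      unfolding H'_def
    proof (rule order_trans[OF integral_abs_bound], rule integral_mono_AE)
      have bb: "AE z in ?M. \<bar>grad \<phi> (w + t *\<^sub>R (z - w)) \<bullet> (z - w)\<bar> \<le> D * ?g z powr 1"
        using bdz
      proof eventually_elim
        fix z assume "norm (z - w) \<le> D"
        then have "?g z * norm (z - w) \<le> ?g z * D" by (intro mult_left_mono) auto
        with Cauchy_Schwarz_ineq2[of "grad \<phi> (w + t *\<^sub>R (z - w))" "z - w"]
        show "\<bar>grad \<phi> (w + t *\<^sub>R (z - w)) \<bullet> (z - w)\<bar> \<le> D * ?g z powr 1" by (simp add: mult.commute)
      qed
      then show "AE z in ?M. \<bar>grad \<phi> (w + t *\<^sub>R (z - w)) \<bullet> (z - w)\<bar> \<le> D * ?g z powr 1" .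
      show i1: "integrable ?M (\<lambda>z. D * ?g z powr 1)"
        using G D gm by (intro integrable_const_bound[where B="D * G"]) (auto intro!: mult_left_mono)
      show "integrable ?M (\<lambda>z. \<bar>grad \<phi> (w + t *\<^sub>R (z - w)) \<bullet> (z - w)\<bar>)"
      proof (rule Bochner_Integration.integrable_bound[OF i1])
        show "(\<lambda>z. \<bar>grad \<phi> (w + t *\<^sub>R (z - w)) \<bullet> (z - w)\<bar>) \<in> borel_measurable ?M"
          by (intro measurable_restrict_space1) measurable
      qed (use bb in \<open>auto elim: eventually_mono\<close>)
    qed
    also have "\<dots> = D * \<beta> * ((LINT z|?M. ?g z powr 1) / \<beta>)" using \<beta> by simp
    also have "\<dots> \<le> D * \<beta> * (((LINT z|?M. ?g z powr m) / \<beta>) powr (1/m))"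
      using power_mean(2)[OF M _ _ _ _ m ig, unfolded mM \<beta>_def[symmetric]] \<beta> D gm
      by (intro mult_left_mono) auto
    also have "\<dots> \<le> D * \<beta> * ((I / t ^ DIM('a) / \<beta>) powr (1/m))"
      using Ig \<beta> D m by (intro mult_left_mono powr_mono2 divide_right_mono) (auto intro: integral_nonneg)
    \<comment> \<open>As m = 2 N, the root of t^N is exactly sqrt t.\<close>
    also have "(I / t ^ DIM('a) / \<beta>) powr (1/m) = (I / \<beta>) powr (1/m) / sqrt t"
    proof -
      have "I / t ^ DIM('a) / \<beta> = (I / \<beta>) / t ^ DIM('a)" by simp
      also have "\<dots> powr (1/m) = (I / \<beta>) powr (1/m) / (t ^ DIM('a)) powr (1/m)"
        by (rule powr_divide)
      also have "(t ^ DIM('a)) powr (1/m) = t powr (1/2)"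
        using t by (simp add: powr_realpow[symmetric] powr_powr m_def)
      finally show ?thesis using t by (simp add: powr_half_sqrt)
    qed
    finally show ?thesis by (simp add: k_def mult_ac)
  qed
  \<comment> \<open>The function 2 k sqrt t has derivative k / sqrt t, so subtracting plus or minus
    H from it leaves something nondecreasing. Differentiability is used only on the open interval,
    since the square root is singular at 0.\<close>
  have cmp: "c * (H 1 - H 0) \<le> 2 * k" if c: "c = 1 \<or> c = -1" for c
  proof -
    have "2 * k * sqrt 0 - c * H 0 \<le> 2 * k * sqrt 1 - c * H 1"
    proof (rule DERIV_nonneg_imp_increasing_open[where f="\<lambda>t. 2 * k * sqrt t - c * H t"])
      fix t :: real assume t: "0 < t" "t < 1"
      have "c * H' t \<le> k / sqrt t" using H'le[OF t(1)] c by auto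
      moreover have "2 * k * (r / 2) = k * r" for r :: real by algebra
      moreover have "k / sqrt t = k * inverse (sqrt t)" by (rule divide_inverse)
      ultimately have "0 \<le> 2 * k * (inverse (sqrt t) / 2) - c * H' t" by (simp only: diff_ge_0_iff_ge)
      moreover have "((\<lambda>t. 2 * k * sqrt t - c * H t) has_real_derivative 2 * k * (inverse (sqrt t) / 2) - c * H' t) (at t)"
        using t by (intro DERIV_diff DERIV_cmult DERIV_real_sqrt Hder)
      ultimately show "\<exists>y. ((\<lambda>t. 2 * k * sqrt t - c * H t) has_real_derivative y) (at t) \<and> 0 \<le> y" by blast
    next
      have "continuous_on {0..1} H" using Hder DERIV_isCont continuous_at_imp_continuous_on by blast
      then show "continuous_on {0..1} (\<lambda>t. 2 * k * sqrt t - c * H t)" by (intro continuous_intros)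
    qed simp
    then show ?thesis by (simp add: algebra_simps)
  qed
  have "\<bar>H 1 - H 0\<bar> \<le> 2 * k" using cmp[of 1] cmp[of "-1"] by (simp add: abs_le_iff)
  moreover have "H 0 = \<phi> w * \<beta>" using mM by (simp add: H_def \<beta>_def space_restrict_space)
  moreover have "H 1 = (LINT z|?M. \<phi> z)" by (simp add: H_def)
  ultimately have "\<bar>\<phi> w * \<beta> - (LINT z|?M. \<phi> z)\<bar> \<le> 2 * k" by (simp add: abs_minus_commute)
  then have "\<bar>\<phi> w * \<beta> - (LINT z|?M. \<phi> z)\<bar> / \<beta> \<le> 2 * k / \<beta>" using \<beta> by (intro divide_right_mono) auto
  moreover have "\<bar>\<phi> w * \<beta> - (LINT z|?M. \<phi> z)\<bar> / \<beta> = \<bar>\<phi> w - (LINT z|?M. \<phi> z) / \<beta>\<bar>"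
    unfolding abs_div_pos[OF \<beta>] using \<beta> by (simp add: diff_divide_distrib)
  ultimately show ?thesis using \<beta> by (simp add: k_def I_def \<beta>_def mult_ac)
qed

text \<open>Both values are compared with the mean over the ball around x of radius r = dist x y.
  Its points are within r of x and within 2 r of y, which gives 2 + 4 = 6. The volume \<kappa> r^N
  contributes 1 / sqrt r after the root, leaving r / sqrt r = sqrt r.\<close>

theorem Morrey_test_functions:
  obtains C where "C \<ge> 0" "\<And>\<Omega> (\<phi> :: 'a::euclidean_space \<Rightarrow> real) x y. \<phi> \<in> test_functions \<Omega> \<Longrightarrow>
    \<bar>\<phi> x - \<phi> y\<bar> \<le> C * sqrt (dist x y) * (LINT z|lborel. norm (grad \<phi> z) powr (2 * real DIM('a))) powr (1 / (2 * real DIM('a)))"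
proof -
  define m where "m = 2 * real DIM('a)"
  have m: "m > 0" by (simp add: m_def)
  define \<kappa> where "\<kappa> = unit_ball_vol (real DIM('a))"
  have \<kappa>: "\<kappa> > 0" by (simp add: \<kappa>_def)
  have "\<bar>\<phi> x - \<phi> y\<bar> \<le> 6 / \<kappa> powr (1/m) * sqrt (dist x y) * (LINT z|lborel. norm (grad \<phi> z) powr m) powr (1/m)"
    if \<phi>: "\<phi> \<in> test_functions \<Omega>" for \<Omega> and \<phi> :: "'a \<Rightarrow> real" and x y
  proof (cases "x = y")
    case False
    define r where "r = dist x y"
    have r: "r > 0" using False by (simp add: r_def)
    define I where "I = (LINT z|lborel. norm (grad \<phi> z) powr m)"
    have I0: "I \<ge> 0" by (simp add: I_def integral_nonneg)
    let ?B = "cball x r"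
    have mB: "measure lborel ?B = \<kappa> * r ^ DIM('a)"
      using r by (simp add: content_cball \<kappa>_def)
    have mBp: "measure lborel ?B > 0" unfolding mB using \<kappa> r by simp
    let ?avg = "(LINT z|restrict_space lborel ?B. \<phi> z) / measure lborel ?B"
    have 1: "\<bar>\<phi> x - ?avg\<bar> \<le> 2 * r * (I / measure lborel ?B) powr (1/m)"
      unfolding I_def m_def
      by (rule mean_value_dilation_bound[OF \<phi> compact_cball mBp]) (use r in \<open>auto simp: dist_norm norm_minus_commute\<close>)
    have 2: "\<bar>\<phi> y - ?avg\<bar> \<le> 2 * (2 * r) * (I / measure lborel ?B) powr (1/m)"
      unfolding I_def m_def
    proof (rule mean_value_dilation_bound[OF \<phi> compact_cball mBp])
      fix z assume "z \<in> ?B"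
      then show "norm (z - y) \<le> 2 * r" using dist_triangle[of z y x] by (simp add: r_def dist_norm norm_minus_commute)
    qed (use r in auto)
    have "(I / measure lborel ?B) powr (1/m) = I powr (1/m) / (\<kappa> powr (1/m) * sqrt r)"
    proof -
      have "(r ^ DIM('a)) powr (1/m) = sqrt r"
        using r by (simp add: powr_realpow[symmetric] powr_powr m_def powr_half_sqrt)
      then show ?thesis unfolding mB using I0 \<kappa> r by (simp add: powr_divide powr_mult)
    qed
    moreover have "\<bar>\<phi> x - \<phi> y\<bar> \<le> 6 * r * (I / measure lborel ?B) powr (1/m)" using 1 2 by linarith
    ultimately have "\<bar>\<phi> x - \<phi> y\<bar> \<le> 6 * r * (I powr (1/m) / (\<kappa> powr (1/m) * sqrt r))" by simp
    also have "\<dots> = 6 / \<kappa> powr (1/m) * (r / sqrt r) * I powr (1/m)" by simp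
    also have "r / sqrt r = sqrt r" using r by (simp add: real_div_sqrt)
    finally show ?thesis by (simp add: r_def I_def)
  qed simp
  then show ?thesis using that[of "6 / \<kappa> powr (1/m)"] by (simp add: m_def)
qed

section \<open>Lebesgue norms on bounded open sets\<close>

lemma Lnorm_ereal: "Lnorm \<Omega> (ereal r) f = (LINT x|lebesgue_on \<Omega>. norm (f x) powr r) powr (1 / r)"
  by (simp add: Lnorm_def)

lemma Lspace_ereal: "f \<in> Lspace \<Omega> (ereal r) \<longleftrightarrow>
    f \<in> borel_measurable (lebesgue_on \<Omega>) \<and> integrable (lebesgue_on \<Omega>) (\<lambda>x. norm (f x) powr r)"
  by (simp add: Lspace_def)

lemma Lnorm_ereal_nonneg: "0 \<le> Lnorm \<Omega> (ereal r) f"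
  by (simp add: Lnorm_ereal)

lemma Lnorm_ereal_powr: "r > 0 \<Longrightarrow> Lnorm \<Omega> (ereal r) f powr r = (LINT x|lebesgue_on \<Omega>. norm (f x) powr r)"
  by (simp add: Lnorm_ereal powr_powr integral_nonneg)

lemma Lnorm_scaleR: "r > 0 \<Longrightarrow> Lnorm \<Omega> (ereal r) (\<lambda>x. c *\<^sub>R f x) = \<bar>c\<bar> * Lnorm \<Omega> (ereal r) f"
  by (simp add: Lnorm_ereal powr_mult powr_powr)

lemma Lspace_scaleR: "f \<in> Lspace \<Omega> (ereal r) \<Longrightarrow> (\<lambda>x. c *\<^sub>R f x) \<in> Lspace \<Omega> (ereal r)"
  by (auto simp: Lspace_ereal powr_mult)

lemma Lnorm_cong_AE:
  assumes "f \<in> borel_measurable (lebesgue_on \<Omega>)" "g \<in> borel_measurable (lebesgue_on \<Omega>)" "AE x in lebesgue_on \<Omega>. f x = g x"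
  shows "Lnorm \<Omega> s f = Lnorm \<Omega> s g"
proof -
  have "esssup (lebesgue_on \<Omega>) (\<lambda>x. ereal (norm (f x))) = esssup (lebesgue_on \<Omega>) (\<lambda>x. ereal (norm (g x)))"
    using assms by (intro esssup_AE_cong) (auto elim: eventually_mono)
  moreover have "(LINT x|lebesgue_on \<Omega>. norm (f x) powr r) = (LINT x|lebesgue_on \<Omega>. norm (g x) powr r)" for r
    using assms by (intro integral_cong_AE) (auto elim: eventually_mono)
  ultimately show ?thesis by (simp add: Lnorm_def)
qed

lemma Lspace_cong_AE:
  assumes "f \<in> borel_measurable (lebesgue_on \<Omega>)" "g \<in> Lspace \<Omega> s" "AE x in lebesgue_on \<Omega>. f x = g x"
  shows "f \<in> Lspace \<Omega> s"
proof -
  have g: "g \<in> borel_measurable (lebesgue_on \<Omega>)" using assms(2) by (simp add: Lspace_def)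
  have "esssup (lebesgue_on \<Omega>) (\<lambda>x. ereal (norm (f x))) = esssup (lebesgue_on \<Omega>) (\<lambda>x. ereal (norm (g x)))"
    using assms g by (intro esssup_AE_cong) (auto elim: eventually_mono)
  moreover have "integrable (lebesgue_on \<Omega>) (\<lambda>x. norm (f x) powr r) \<longleftrightarrow> integrable (lebesgue_on \<Omega>) (\<lambda>x. norm (g x) powr r)" for r
    using assms g by (intro integrable_cong_AE) (auto elim: eventually_mono)
  ultimately show ?thesis using assms by (auto simp: Lspace_def)
qed

lemma Lnorm_triangle:
  assumes "r \<ge> 1" "f \<in> Lspace \<Omega> (ereal r)" "g \<in> Lspace \<Omega> (ereal r)"
  shows "(\<lambda>x. f x + g x) \<in> Lspace \<Omega> (ereal r)"
    "Lnorm \<Omega> (ereal r) (\<lambda>x. f x + g x) \<le> Lnorm \<Omega> (ereal r) f + Lnorm \<Omega> (ereal r) g"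
  using Minkowski_powr[OF assms(1), of f "lebesgue_on \<Omega>" g] assms(2,3)
  by (auto simp: Lspace_ereal Lnorm_ereal)

lemma Lspace_diff:
  assumes "r \<ge> 1" "f \<in> Lspace \<Omega> (ereal r)" "g \<in> Lspace \<Omega> (ereal r)"
  shows "(\<lambda>x. f x - g x) \<in> Lspace \<Omega> (ereal r)"
  using Lnorm_triangle(1)[OF assms(1,2) Lspace_scaleR[OF assms(3), of "-1"]] by simp

lemma Lnorm_diff_triangle:
  assumes "r \<ge> 1" "f \<in> Lspace \<Omega> (ereal r)" "g \<in> Lspace \<Omega> (ereal r)"
  shows "\<bar>Lnorm \<Omega> (ereal r) f - Lnorm \<Omega> (ereal r) g\<bar> \<le> Lnorm \<Omega> (ereal r) (\<lambda>x. f x - g x)"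
proof -
  have d: "(\<lambda>x. f x - g x) \<in> Lspace \<Omega> (ereal r)" by (rule Lspace_diff[OF assms])
  have "Lnorm \<Omega> (ereal r) f \<le> Lnorm \<Omega> (ereal r) g + Lnorm \<Omega> (ereal r) (\<lambda>x. f x - g x)"
    using Lnorm_triangle(2)[OF assms(1,3) d] by simp
  moreover have "Lnorm \<Omega> (ereal r) g \<le> Lnorm \<Omega> (ereal r) f + Lnorm \<Omega> (ereal r) (\<lambda>x. f x - g x)"
    using Lnorm_triangle(2)[OF assms(1,2) Lspace_scaleR[OF d, of "-1"]] assms(1)
      Lnorm_scaleR[of r \<Omega> "-1" "\<lambda>x. f x - g x"] by simp
  ultimately show ?thesis by linarith
qed

text \<open>Countably many closed boxes exhaust the open set, and integrability on each box includes
  measurability there. It supplies the measurability of weak gradients, which are only required to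
  be locally integrable.\<close>

lemma locally_integrable_borel_measurable:
  fixes f :: "'a::euclidean_space \<Rightarrow> 'b::euclidean_space"
  assumes "open \<Omega>" "locally_integrable \<Omega> f" shows "f \<in> borel_measurable (lebesgue_on \<Omega>)"
proof -
  obtain D where D: "countable D" "D \<subseteq> Pow \<Omega>" "\<And>X. X \<in> D \<Longrightarrow> \<exists>a b. X = cbox a b" "\<Union>D = \<Omega>"
    using open_countable_Union_open_cbox[OF assms(1)] by blast
  have DL: "X \<in> sets lebesgue" "X \<subseteq> \<Omega>" "compact X" if "X \<in> D" for X
    using D(2) D(3)[OF that] that by auto
  have \<Omega>: "\<Omega> \<in> sets lebesgue" using assms(1) by auto
  show ?thesis
  proof (rule measurable_piecewise_restrict[OF D(1)])
    fix X assume X: "X \<in> D"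
    show "X \<inter> space (lebesgue_on \<Omega>) \<in> sets (lebesgue_on \<Omega>)"
      using DL[OF X] \<Omega> by (auto simp: sets_restrict_space_iff space_restrict_space)
    have "restrict_space (lebesgue_on \<Omega>) X = lebesgue_on X"
      using DL[OF X] \<Omega> by (subst restrict_restrict_space) (auto simp: Int_absorb1)
    moreover have "f \<in> borel_measurable (lebesgue_on X)"
      using assms(2) DL[OF X] by (subst borel_measurable_restrict_space_iff) (auto simp: locally_integrable_def set_integrable_def)
    ultimately show "f \<in> borel_measurable (restrict_space (lebesgue_on \<Omega>) X)" by simp
  qed (use D(4) in \<open>auto simp: space_restrict_space\<close>)
qed

lemma has_weak_gradient_weak_gradient: "has_weak_gradient \<Omega> u g \<Longrightarrow> has_weak_gradient \<Omega> u (weak_gradient \<Omega> u)"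
  unfolding weak_gradient_def by (rule someI[of "has_weak_gradient \<Omega> u"])

lemma weak_gradient_measurable:
  "open \<Omega> \<Longrightarrow> has_weak_gradient \<Omega> u g \<Longrightarrow> g \<in> borel_measurable (lebesgue_on \<Omega>)"
  by (intro locally_integrable_borel_measurable) (auto simp: has_weak_gradient_def)

lemma weak_gradient_AE:
  "open \<Omega> \<Longrightarrow> has_weak_gradient \<Omega> u g \<Longrightarrow> AE x in lebesgue_on \<Omega>. weak_gradient \<Omega> u x = g x"
  by (rule has_weak_gradient_unique[OF _ has_weak_gradient_weak_gradient])

lemma Lnorm_weak_gradient:
  assumes "open \<Omega>" "has_weak_gradient \<Omega> u g"
  shows "Lnorm \<Omega> s (weak_gradient \<Omega> u) = Lnorm \<Omega> s g"
  using assms weak_gradient_measurable[OF assms(1) has_weak_gradient_weak_gradient[OF assms(2)]]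
  by (intro Lnorm_cong_AE weak_gradient_AE) (auto intro: weak_gradient_measurable)

lemma Lspace_weak_gradient:
  assumes "open \<Omega>" "has_weak_gradient \<Omega> u g" "g \<in> Lspace \<Omega> s"
  shows "weak_gradient \<Omega> u \<in> Lspace \<Omega> s"
  using weak_gradient_measurable[OF assms(1) has_weak_gradient_weak_gradient[OF assms(2)]] assms(3)
    weak_gradient_AE[OF assms(1,2)]
  by (rule Lspace_cong_AE)

lemma continuous_on_borel_measurable_lebesgue_on:
  fixes f :: "'a::euclidean_space \<Rightarrow> 'b::euclidean_space"
  shows "open \<Omega> \<Longrightarrow> continuous_on \<Omega> f \<Longrightarrow> f \<in> borel_measurable (lebesgue_on \<Omega>)"
  by (intro locally_integrable_borel_measurable locally_integrable_continuous)

section \<open>Norms on a bounded open set of finite positive measure\<close>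

locale bounded_open =
  fixes \<Omega> :: "'a::euclidean_space set"
  assumes open_\<Omega>: "open \<Omega>" and bounded_\<Omega>: "bounded \<Omega>" and nonempty_\<Omega>: "\<Omega> \<noteq> {}"
begin

abbreviation "M \<equiv> lebesgue_on \<Omega>"

definition "V = measure M (space M)"

lemma sets_\<Omega> [simp]: "\<Omega> \<in> sets lebesgue" using open_\<Omega> by auto

lemma finite_measure_M: "finite_measure M"
proof (rule finite_measureI)
  have "emeasure lebesgue \<Omega> < \<infinity>"
    using bounded_\<Omega> open_\<Omega> emeasure_bounded_finite[of \<Omega>] by simp
  then show "emeasure M (space M) \<noteq> \<infinity>" by (simp add: emeasure_restrict_space space_restrict_space)
qed

sublocale finite_measure M by (rule finite_measure_M)

lemma emeasure_M_pos: "emeasure M (space M) \<noteq> 0"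
proof -
  obtain x where "x \<in> \<Omega>" using nonempty_\<Omega> by blast
  then obtain e where e: "e > 0" "ball x e \<subseteq> \<Omega>" using open_\<Omega> open_contains_ball by blast
  have "\<not> negligible \<Omega>" using open_\<Omega> nonempty_\<Omega> open_not_negligible by blast
  then show ?thesis by (simp add: emeasure_restrict_space space_restrict_space negligible_iff_emeasure0)
qed

lemma V_pos: "V > 0"
  using emeasure_M_pos by (simp add: V_def emeasure_eq_measure zero_less_measure_iff)

lemma Lspace_mono:
  assumes "0 < a" "a \<le> b" "f \<in> Lspace \<Omega> (ereal b)" shows "f \<in> Lspace \<Omega> (ereal a)"
  using power_mean(1)[OF finite_measure_M, of "\<lambda>x. norm (f x)" a b] assms V_pos
  by (auto simp: Lspace_ereal V_def)

text \<open>Dividing by V powr (1 / r) turns the norm into that of a probability measure, which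
  increases with the exponent. As the exponent tends to infinity the normalizing factor tends to
  1.\<close>

lemma Lnorm_mono:
  assumes ab: "0 < a" "a \<le> b" and f: "f \<in> Lspace \<Omega> (ereal b)"
  shows "Lnorm \<Omega> (ereal a) f / V powr (1 / a) \<le> Lnorm \<Omega> (ereal b) f / V powr (1 / b)"
proof -
  let ?A = "LINT x|M. norm (f x) powr a" and ?B = "LINT x|M. norm (f x) powr b"
  have "?A / V \<le> (?B / V) powr (a / b)"
    using power_mean(2)[OF finite_measure_M, of "\<lambda>x. norm (f x)" a b] ab f V_pos
    by (auto simp: Lspace_ereal V_def)
  then have "(?A / V) powr (1 / a) \<le> ((?B / V) powr (a / b)) powr (1 / a)"
    using ab V_pos by (intro powr_mono2) (auto intro!: divide_nonneg_pos integral_nonneg)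
  then show ?thesis
    using ab V_pos by (simp add: powr_powr Lnorm_ereal powr_divide integral_nonneg)
qed

lemma Lnorm_mono':
  assumes "0 < a" "a \<le> b" "f \<in> Lspace \<Omega> (ereal b)"
  shows "Lnorm \<Omega> (ereal a) f \<le> Lnorm \<Omega> (ereal b) f * V powr (1 / a - 1 / b)"
proof -
  have "X \<le> Y * (A / B)" if "X / A \<le> Y / B" "A > 0" "B > 0" for X Y A B :: real
    using that by (simp add: field_simps)
  then show ?thesis unfolding powr_diff using Lnorm_mono[OF assms] V_pos by simp
qed

lemma test_Lspace:
  assumes "\<phi> \<in> test_functions \<Omega>" "r > 0"
  shows "\<phi> \<in> Lspace \<Omega> (ereal r)" "grad \<phi> \<in> Lspace \<Omega> (ereal r)"
proof -
  note sm = test_smooth[OF assms(1)]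
  obtain B where B: "\<And>x. \<bar>\<phi> x\<bar> \<le> B" using test_bound[OF assms(1)] by blast
  obtain G where G: "\<And>x. norm (grad \<phi> x) \<le> G" using test_grad_bound[OF assms(1)] by blast
  have m: "\<phi> \<in> borel_measurable M" "grad \<phi> \<in> borel_measurable M"
    using open_\<Omega> sm by (auto intro!: continuous_on_borel_measurable_lebesgue_on smooth_continuous_on continuous_grad)
  have "integrable M (\<lambda>x. norm (\<phi> x) powr r)"
    using B m assms(2) by (intro integrable_const_bound[where B="B powr r"]) (auto intro!: powr_mono2)
  moreover have "integrable M (\<lambda>x. norm (grad \<phi> x) powr r)"
    using G m assms(2) by (intro integrable_const_bound[where B="G powr r"]) (auto intro!: powr_mono2)
  ultimately show "\<phi> \<in> Lspace \<Omega> (ereal r)" "grad \<phi> \<in> Lspace \<Omega> (ereal r)" using m by (auto simp: Lspace_ereal)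
qed

lemma Lnorm_grad_test:
  assumes "\<phi> \<in> test_functions \<Omega>" "r > 0"
  shows "Lnorm \<Omega> (ereal r) (grad \<phi>) = (LINT x|lborel. norm (grad \<phi> x) powr r) powr (1 / r)"
proof -
  note sm = test_smooth[OF assms(1)]
  obtain K where K: "K \<subseteq> \<Omega>" "\<And>x. x \<notin> K \<Longrightarrow> grad \<phi> x = 0" using test_support[OF assms(1)] by blast
  have "(\<lambda>x. norm (grad \<phi> x) powr r) \<in> borel_measurable borel"
    using borel_measurable_continuous_onI[OF continuous_grad[OF sm]] by measurable
  then show ?thesis
    unfolding Lnorm_ereal using K by (subst integral_lebesgue_on_borel[OF open_\<Omega>]) auto
qed

text \<open>One constant serves all exponents s: passing from 2 N to s costs V powr (1 / (2 N) - 1 /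
  s), and this power lies in [0, 1], so the factor is at most max 1 V. The second bound compares x
  with a point outside the domain, where \<phi> is zero.\<close>

lemma Morrey:
  "\<exists>C>0. \<forall>s \<phi> x y. 2 * real DIM('a) \<le> s \<longrightarrow> \<phi> \<in> test_functions \<Omega> \<longrightarrow>
    \<bar>\<phi> x - \<phi> y\<bar> \<le> C * sqrt (dist x y) * Lnorm \<Omega> (ereal s) (grad \<phi>) \<and>
    \<bar>\<phi> x\<bar> \<le> C * Lnorm \<Omega> (ereal s) (grad \<phi>)"
proof -
  obtain C0 where C0: "C0 \<ge> 0" "\<And>\<Omega> (\<phi> :: 'a \<Rightarrow> real) x y. \<phi> \<in> test_functions \<Omega> \<Longrightarrow>
    \<bar>\<phi> x - \<phi> y\<bar> \<le> C0 * sqrt (dist x y) * (LINT z|lborel. norm (grad \<phi> z) powr (2 * real DIM('a))) powr (1 / (2 * real DIM('a)))"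
    using Morrey_test_functions by blast
  obtain R where R: "R > 0" "\<And>x. x \<in> \<Omega> \<Longrightarrow> norm x \<le> R" using bounded_\<Omega> by (meson bounded_pos)
  let ?m = "2 * real DIM('a)"
  have m: "?m > 0" by simp
  define D where "D = C0 * max 1 V"
  have D: "D \<ge> 0" using C0 by (simp add: D_def)
  have 1: "\<bar>\<phi> x - \<phi> y\<bar> \<le> D * sqrt (dist x y) * Lnorm \<Omega> (ereal s) (grad \<phi>)" if s: "?m \<le> s" and \<phi>: "\<phi> \<in> test_functions \<Omega>" for s \<phi> x y
  proof -
    have s0: "s > 0" using s m by linarith
    have "Lnorm \<Omega> (ereal ?m) (grad \<phi>) \<le> Lnorm \<Omega> (ereal s) (grad \<phi>) * V powr (1 / ?m - 1 / s)"
      using s m s0 \<phi> by (intro Lnorm_mono' test_Lspace) auto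
    also have "\<dots> \<le> Lnorm \<Omega> (ereal s) (grad \<phi>) * max 1 V"
    proof (intro mult_left_mono Lnorm_ereal_nonneg)
      have "DIM('a) \<ge> 1" by (simp add: Suc_leI)
      then have "?m \<ge> 1" by linarith
      then have "1 / ?m \<le> 1" by simp
      moreover have "1 / s \<le> 1 / ?m" by (rule frac_le) (use s m in auto)
      moreover have "0 \<le> 1 / s" using s0 by simp
      ultimately have e: "0 \<le> 1 / ?m - 1 / s" "1 / ?m - 1 / s \<le> 1" by linarith+
      have "V powr (1 / ?m - 1 / s) \<le> max 1 V powr (1 / ?m - 1 / s)" using V_pos e by (intro powr_mono2) auto
      also have "\<dots> \<le> max 1 V powr 1" using e by (intro powr_mono) auto
      finally show "V powr (1 / ?m - 1 / s) \<le> max 1 V" by simp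
    qed
    finally have L: "Lnorm \<Omega> (ereal ?m) (grad \<phi>) \<le> Lnorm \<Omega> (ereal s) (grad \<phi>) * max 1 V" .
    have "\<bar>\<phi> x - \<phi> y\<bar> \<le> C0 * sqrt (dist x y) * Lnorm \<Omega> (ereal ?m) (grad \<phi>)"
      using C0(2)[OF \<phi>] by (simp add: Lnorm_grad_test[OF \<phi> m])
    also have "\<dots> \<le> C0 * sqrt (dist x y) * (Lnorm \<Omega> (ereal s) (grad \<phi>) * max 1 V)"
      using C0 L by (intro mult_left_mono) auto
    finally show ?thesis by (simp add: D_def mult_ac)
  qed
  define E where "E = D * sqrt (2 * R + 1)"
  have 2: "\<bar>\<phi> x\<bar> \<le> E * Lnorm \<Omega> (ereal s) (grad \<phi>)" if s: "?m \<le> s" and \<phi>: "\<phi> \<in> test_functions \<Omega>" for s \<phi> x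
  proof (cases "x \<in> \<Omega>")
    case True
    \<comment> \<open>Any vector of norm R + 1 lies outside the domain, at distance at most 2 R + 1
      from its points.\<close>
    obtain b :: 'a where b: "b \<in> Basis" using nonempty_Basis by blast
    define y where "y = (R + 1) *\<^sub>R b"
    have ny: "norm y = R + 1" using b R by (simp add: y_def)
    then have "y \<notin> \<Omega>" using R(2)[of y] by auto
    then have y0: "\<phi> y = 0" using test_support[OF \<phi>] by blast
    have "dist x y \<le> norm x + norm y" by (simp add: dist_norm norm_triangle_ineq4)
    then have "dist x y \<le> 2 * R + 1" using R(2)[OF True] ny by simp
    then have sq: "sqrt (dist x y) \<le> sqrt (2 * R + 1)" by simp
    have "\<bar>\<phi> x - \<phi> y\<bar> \<le> D * sqrt (dist x y) * Lnorm \<Omega> (ereal s) (grad \<phi>)" by (rule 1[OF s \<phi>])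
    also have "\<dots> \<le> E * Lnorm \<Omega> (ereal s) (grad \<phi>)"
      unfolding E_def using sq D by (intro mult_right_mono mult_left_mono Lnorm_ereal_nonneg)
    finally show ?thesis using y0 by simp
  next
    case False
    then have "\<phi> x = 0" using test_support[OF \<phi>] by blast
    moreover have "E \<ge> 0" using D R by (simp add: E_def)
    ultimately show ?thesis by (simp add: Lnorm_ereal_nonneg)
  qed
  define C where "C = max 1 (max D E)"
  show ?thesis
  proof (intro exI[of _ C] conjI allI impI)
    show "C > 0" by (simp add: C_def)
    fix s \<phi> x y assume s: "?m \<le> s" and \<phi>: "\<phi> \<in> test_functions \<Omega>"
    show "\<bar>\<phi> x - \<phi> y\<bar> \<le> C * sqrt (dist x y) * Lnorm \<Omega> (ereal s) (grad \<phi>)"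
      by (rule order_trans[OF 1[OF s \<phi>]], intro mult_right_mono Lnorm_ereal_nonneg) (auto simp: C_def)
    show "\<bar>\<phi> x\<bar> \<le> C * Lnorm \<Omega> (ereal s) (grad \<phi>)"
      by (rule order_trans[OF 2[OF s \<phi>]], intro mult_right_mono Lnorm_ereal_nonneg) (auto simp: C_def)
  qed
qed

section \<open>Approximation by test functions\<close>


lemma Linf_bounds:
  fixes f :: "'a \<Rightarrow> 'b::euclidean_space"
  assumes f: "f \<in> borel_measurable M" and K: "AE x in M. norm (f x) \<le> K"
  shows "f \<in> Lspace \<Omega> \<infinity>" "0 \<le> Lnorm \<Omega> \<infinity> f" "Lnorm \<Omega> \<infinity> f \<le> K" "AE x in M. norm (f x) \<le> Lnorm \<Omega> \<infinity> f"
proof -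
  define e where "e = esssup M (\<lambda>x. ereal (norm (f x)))"
  have m: "(\<lambda>x. ereal (norm (f x))) \<in> borel_measurable M" using f by measurable
  have eK: "e \<le> ereal K" unfolding e_def using m K by (intro esssup_I) (auto elim: eventually_mono)
  have AEe: "AE x in M. ereal (norm (f x)) \<le> e" unfolding e_def by (rule esssup_AE)
  \<comment> \<open>Positivity of the measure matters: for a null measure every bound holds almost
    everywhere, even a negative one.\<close>
  have e0: "0 \<le> e"
  proof (rule ccontr)
    assume "\<not> 0 \<le> e"
    have "AE x in M. False"
      using AEe
    proof eventually_elim
      fix x assume "ereal (norm (f x)) \<le> e"
      moreover have "0 \<le> ereal (norm (f x))" by simp
      ultimately show False using \<open>\<not> 0 \<le> e\<close> order_trans by blast
    qed
    then have "ae_filter M = bot" by (simp add: trivial_limit_def)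
    then show False using emeasure_M_pos by (simp add: ae_filter_eq_bot_iff)
  qed
  have fin: "\<bar>e\<bar> \<noteq> \<infinity>" using e0 eK by (cases e) auto
  have L: "Lnorm \<Omega> \<infinity> f = real_of_ereal e" by (simp add: Lnorm_def e_def)
  show "f \<in> Lspace \<Omega> \<infinity>" using f fin by (auto simp: Lspace_def e_def[symmetric])
  show "0 \<le> Lnorm \<Omega> \<infinity> f" using e0 by (simp add: L real_of_ereal_pos)
  show "Lnorm \<Omega> \<infinity> f \<le> K" using fin eK by (cases e) (auto simp: L)
  have "ereal (real_of_ereal e) = e" using fin by (simp add: ereal_real)
  then show "AE x in M. norm (f x) \<le> Lnorm \<Omega> \<infinity> f"
    unfolding L using AEe by (metis (mono_tags, lifting) ereal_less_eq(3) eventually_mono)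
qed

lemma Lspace_inf_AE_bounded:
  assumes "f \<in> Lspace \<Omega> \<infinity>" obtains K where "AE x in M. norm (f x) \<le> K"
proof -
  define e where "e = esssup M (\<lambda>x. ereal (norm (f x)))"
  have "e < \<infinity>" using assms by (simp add: Lspace_def e_def)
  moreover have "AE x in M. ereal (norm (f x)) \<le> e" unfolding e_def by (rule esssup_AE)
  ultimately have "AE x in M. norm (f x) \<le> real_of_ereal e"
    by (cases e) (auto elim!: eventually_mono)
  then show ?thesis using that by blast
qed

text \<open>The set where the bound fails is open and null, hence empty.\<close>

lemma AE_le_imp_le:
  fixes f :: "'a \<Rightarrow> real"
  assumes c: "continuous_on \<Omega> f" and "AE x in M. f x \<le> K" and x: "x \<in> \<Omega>" shows "f x \<le> K"
proof (rule ccontr)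
  assume n: "\<not> f x \<le> K"
  let ?S = "\<Omega> \<inter> f -` {K<..}"
  have op: "open ?S" using c open_\<Omega> by (intro continuous_open_preimage) auto
  have "AE x in lebesgue. x \<in> \<Omega> \<longrightarrow> f x \<le> K"
    using assms(2) by (subst (asm) AE_restrict_space_iff) auto
  then have "AE x in lebesgue. x \<notin> ?S" by eventually_elim auto
  then have "?S \<in> null_sets lebesgue" using op by (subst (asm) AE_iff_null_sets[symmetric]) auto
  then have "negligible ?S" by (simp add: negligible_iff_null_sets)
  moreover have "?S \<noteq> {}" using x n by auto
  ultimately show False using op open_not_negligible by blast
qed

lemma continuous_bounded:
  fixes u :: "'a \<Rightarrow> real"
  assumes "continuous_on (closure \<Omega>) u" obtains K where "\<And>x. x \<in> closure \<Omega> \<Longrightarrow> \<bar>u x\<bar> \<le> K"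
proof -
  have "compact (closure \<Omega>)" using bounded_\<Omega> by simp
  then have "bounded (u ` closure \<Omega>)" using assms compact_continuous_image compact_imp_bounded by blast
  then show ?thesis using that by (auto simp: bounded_iff)
qed

lemma continuous_Linf:
  fixes u :: "'a \<Rightarrow> real"
  assumes u: "continuous_on (closure \<Omega>) u"
  shows "u \<in> Lspace \<Omega> \<infinity>" "0 \<le> Lnorm \<Omega> \<infinity> u" "\<And>x. x \<in> closure \<Omega> \<Longrightarrow> \<bar>u x\<bar> \<le> Lnorm \<Omega> \<infinity> u"
    "\<And>K. (\<And>x. x \<in> \<Omega> \<Longrightarrow> \<bar>u x\<bar> \<le> K) \<Longrightarrow> Lnorm \<Omega> \<infinity> u \<le> K"
proof -
  obtain K where K: "\<And>x. x \<in> closure \<Omega> \<Longrightarrow> \<bar>u x\<bar> \<le> K" using continuous_bounded[OF u] by blast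
  have c: "continuous_on \<Omega> u" using u closure_subset continuous_on_subset by blast
  have m: "u \<in> borel_measurable M" using c open_\<Omega> by (intro continuous_on_borel_measurable_lebesgue_on)
  have A: "AE x in M. norm (u x) \<le> K" if "\<And>x. x \<in> \<Omega> \<Longrightarrow> \<bar>u x\<bar> \<le> K" for K
    by (rule AE_I2) (use that in \<open>auto simp: space_restrict_space\<close>)
  note B = Linf_bounds[OF m A]
  have Ksub: "\<And>x. x \<in> \<Omega> \<Longrightarrow> \<bar>u x\<bar> \<le> K" using K closure_subset by blast
  show "u \<in> Lspace \<Omega> \<infinity>" "0 \<le> Lnorm \<Omega> \<infinity> u" using B[OF Ksub] by auto
  show "\<And>K. (\<And>x. x \<in> \<Omega> \<Longrightarrow> \<bar>u x\<bar> \<le> K) \<Longrightarrow> Lnorm \<Omega> \<infinity> u \<le> K" by (rule B(3))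
  have in\<Omega>: "\<bar>u x\<bar> \<le> Lnorm \<Omega> \<infinity> u" if "x \<in> \<Omega>" for x
    using B(4)[OF Ksub] c that by (intro AE_le_imp_le[of "\<lambda>x. \<bar>u x\<bar>"] continuous_intros) auto
  show "\<bar>u x\<bar> \<le> Lnorm \<Omega> \<infinity> u" if "x \<in> closure \<Omega>" for x
    by (rule continuous_le_on_closure[of \<Omega> "\<lambda>x. \<bar>u x\<bar>" x, OF continuous_on_rabs[OF u] that in\<Omega>])
qed

lemma Lnorm_uniform_bound:
  fixes f :: "'a \<Rightarrow> real"
  assumes "r > 0" "f \<in> borel_measurable M" "e \<ge> 0" "\<And>x. x \<in> \<Omega> \<Longrightarrow> \<bar>f x\<bar> \<le> e"
  shows "f \<in> Lspace \<Omega> (ereal r)" "Lnorm \<Omega> (ereal r) f \<le> e * V powr (1 / r)"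
proof -
  have AE: "AE x in M. norm (norm (f x) powr r) \<le> e powr r"
    by (rule AE_I2) (use assms in \<open>auto simp: space_restrict_space intro!: powr_mono2\<close>)
  have int: "integrable M (\<lambda>x. norm (f x) powr r)"
    using AE assms(2) by (intro integrable_const_bound[where B="e powr r"]) auto
  then show "f \<in> Lspace \<Omega> (ereal r)" using assms by (simp add: Lspace_ereal)
  have "(LINT x|M. norm (f x) powr r) \<le> (LINT x|M. e powr r)"
    using int AE by (intro integral_mono_AE) auto
  also have "\<dots> = e powr r * V" by (simp add: V_def mult.commute)
  finally have "(LINT x|M. norm (f x) powr r) powr (1 / r) \<le> (e powr r * V) powr (1 / r)"
    using assms by (intro powr_mono2) (auto intro: integral_nonneg)
  also have "\<dots> = e * V powr (1 / r)" using assms by (simp add: powr_mult powr_powr)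
  finally show "Lnorm \<Omega> (ereal r) f \<le> e * V powr (1 / r)" by (simp add: Lnorm_ereal)
qed

lemma Lnorm_eq_0_imp_AE:
  fixes f :: "'a \<Rightarrow> 'b::euclidean_space"
  assumes "r > 0" "f \<in> Lspace \<Omega> (ereal r)" "Lnorm \<Omega> (ereal r) f = 0"
  shows "AE x in M. f x = 0"
proof -
  have "(LINT x|M. norm (f x) powr r) = 0" using assms Lnorm_ereal_powr[of r \<Omega> f] by simp
  then have "AE x in M. norm (f x) powr r = 0"
    using assms(2) by (subst (asm) integral_nonneg_eq_0_iff_AE) (auto simp: Lspace_ereal)
  then show ?thesis by eventually_elim simp
qed

section \<open>The closure of the test functions\<close>

lemma W01_has_weak_gradient:
  assumes "u \<in> W01 \<Omega> s"
  shows "u \<in> Lspace \<Omega> s" "weak_gradient \<Omega> u \<in> Lspace \<Omega> s" "has_weak_gradient \<Omega> u (weak_gradient \<Omega> u)"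
proof -
  obtain g where g: "g \<in> Lspace \<Omega> s" "has_weak_gradient \<Omega> u g" and u: "u \<in> Lspace \<Omega> s"
    using assms by (auto simp: W01_def W1_def)
  show "u \<in> Lspace \<Omega> s" by (rule u)
  show "weak_gradient \<Omega> u \<in> Lspace \<Omega> s" using Lspace_weak_gradient[OF open_\<Omega> g(2,1)] .
  show "has_weak_gradient \<Omega> u (weak_gradient \<Omega> u)" using has_weak_gradient_weak_gradient[OF g(2)] .
qed

lemma Lnorm_weak_gradient_test_diff:
  assumes "\<phi> \<in> test_functions \<Omega>" "has_weak_gradient \<Omega> u (weak_gradient \<Omega> u)"
  shows "Lnorm \<Omega> s (weak_gradient \<Omega> (\<lambda>x. \<phi> x - u x)) = Lnorm \<Omega> s (\<lambda>x. grad \<phi> x - weak_gradient \<Omega> u x)"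
  by (rule Lnorm_weak_gradient[OF open_\<Omega> has_weak_gradient_diff[OF open_\<Omega> has_weak_gradient_grad[OF open_\<Omega> test_smooth[OF assms(1)]] assms(2)]])

lemma sum_nonneg_tendsto_0:
  fixes a b :: "nat \<Rightarrow> real"
  assumes "(\<lambda>n. a n + b n) \<longlonglongrightarrow> 0" "\<And>n. a n \<ge> 0" "\<And>n. b n \<ge> 0"
  shows "a \<longlonglongrightarrow> 0" "b \<longlonglongrightarrow> 0"
  by (rule tendsto_sandwich[OF _ _ tendsto_const assms(1)]; use assms in simp)+

text \<open>Morrey's bound applied to differences makes the approximating test functions uniformly
  Cauchy on the whole space. Their limit v is continuous, vanishes off the domain and agrees with u
  almost everywhere, hence on the closure; this upgrades Sobolev convergence to uniform convergence
  and yields the zero boundary values.\<close>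

lemma W01_approximation:
  assumes s: "2 * real DIM('a) \<le> s" and u: "u \<in> W01 \<Omega> (ereal s)" and cu: "continuous_on (closure \<Omega>) u"
  obtains \<phi> where "\<And>n. \<phi> n \<in> test_functions \<Omega>" "uniform_limit (closure \<Omega>) \<phi> u sequentially"
    "\<And>r. 1 \<le> r \<Longrightarrow> r \<le> s \<Longrightarrow> (\<lambda>n. Lnorm \<Omega> (ereal r) (grad (\<phi> n))) \<longlonglongrightarrow> Lnorm \<Omega> (ereal r) (weak_gradient \<Omega> u)"
    "\<And>x. x \<in> frontier \<Omega> \<Longrightarrow> u x = 0"
proof -
  let ?g = "weak_gradient \<Omega> u"
  have "DIM('a) \<ge> 1" by (simp add: Suc_leI)
  then have s1: "s \<ge> 1" using s by linarith
  note w = W01_has_weak_gradient[OF u]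
  obtain \<phi> where \<phi>: "\<And>n. \<phi> n \<in> test_functions \<Omega>" "(\<lambda>n. W1_norm \<Omega> (ereal s) (\<lambda>x. \<phi> n x - u x)) \<longlonglongrightarrow> 0"
    using u by (auto simp: W01_def)
  have "(\<lambda>n. Lnorm \<Omega> (ereal s) (\<lambda>x. \<phi> n x - u x) + Lnorm \<Omega> (ereal s) (\<lambda>x. grad (\<phi> n) x - ?g x)) \<longlonglongrightarrow> 0"
    using \<phi>(2) by (simp add: W1_norm_def Lnorm_weak_gradient_test_diff[OF \<phi>(1) w(3)])
  note lims = sum_nonneg_tendsto_0[OF this Lnorm_ereal_nonneg Lnorm_ereal_nonneg]
  have gd: "(\<lambda>x. grad (\<phi> n) x - ?g x) \<in> Lspace \<Omega> (ereal s)" for n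
    using test_Lspace(2)[OF \<phi>(1)] s1 w(2) by (intro Lspace_diff) auto
  have rlim: "(\<lambda>n. Lnorm \<Omega> (ereal r) (grad (\<phi> n))) \<longlonglongrightarrow> Lnorm \<Omega> (ereal r) ?g" if r: "1 \<le> r" "r \<le> s" for r
  proof -
    have "(\<lambda>n. Lnorm \<Omega> (ereal s) (\<lambda>x. grad (\<phi> n) x - ?g x) * V powr (1 / r - 1 / s)) \<longlonglongrightarrow> 0 * V powr (1 / r - 1 / s)"
      by (intro tendsto_mult lims tendsto_const)
    then have z: "(\<lambda>n. Lnorm \<Omega> (ereal s) (\<lambda>x. grad (\<phi> n) x - ?g x) * V powr (1 / r - 1 / s)) \<longlonglongrightarrow> 0" by simp
    have "norm (Lnorm \<Omega> (ereal r) (grad (\<phi> n)) - Lnorm \<Omega> (ereal r) ?g) \<le> Lnorm \<Omega> (ereal s) (\<lambda>x. grad (\<phi> n) x - ?g x) * V powr (1 / r - 1 / s)" for n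
    proof -
      have "\<bar>Lnorm \<Omega> (ereal r) (grad (\<phi> n)) - Lnorm \<Omega> (ereal r) ?g\<bar> \<le> Lnorm \<Omega> (ereal r) (\<lambda>x. grad (\<phi> n) x - ?g x)"
        using r test_Lspace(2)[OF \<phi>(1)] Lspace_mono[OF _ r(2) w(2)] by (intro Lnorm_diff_triangle) auto
      also have "\<dots> \<le> Lnorm \<Omega> (ereal s) (\<lambda>x. grad (\<phi> n) x - ?g x) * V powr (1 / r - 1 / s)"
        using r gd by (intro Lnorm_mono') auto
      finally show ?thesis by simp
    qed
    then have "(\<lambda>n. Lnorm \<Omega> (ereal r) (grad (\<phi> n)) - Lnorm \<Omega> (ereal r) ?g) \<longlonglongrightarrow> 0"
      by (intro Lim_null_comparison[OF _ z] always_eventually) blast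
    then show ?thesis by (simp add: LIM_zero_iff)
  qed
  obtain C where C0: "C > 0" and C: "\<And>\<phi> x. \<phi> \<in> test_functions \<Omega> \<Longrightarrow> \<bar>\<phi> x\<bar> \<le> C * Lnorm \<Omega> (ereal s) (grad \<phi>)"
    using Morrey s by (metis (no_types))
  have diff: "\<bar>\<phi> m x - \<phi> n x\<bar> \<le> C * (Lnorm \<Omega> (ereal s) (\<lambda>x. grad (\<phi> m) x - ?g x) + Lnorm \<Omega> (ereal s) (\<lambda>x. grad (\<phi> n) x - ?g x))" for m n x
  proof -
    have "\<bar>\<phi> m x - \<phi> n x\<bar> \<le> C * Lnorm \<Omega> (ereal s) (grad (\<lambda>x. \<phi> m x - \<phi> n x))"
      by (rule C[OF test_diff[OF \<phi>(1) \<phi>(1)]])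
    also have "grad (\<lambda>x. \<phi> m x - \<phi> n x) = (\<lambda>x. (grad (\<phi> m) x - ?g x) + (-1) *\<^sub>R (grad (\<phi> n) x - ?g x))"
      by (simp add: fun_eq_iff grad_diff test_smooth[OF \<phi>(1)])
    also have "Lnorm \<Omega> (ereal s) \<dots> \<le> Lnorm \<Omega> (ereal s) (\<lambda>x. grad (\<phi> m) x - ?g x) + Lnorm \<Omega> (ereal s) (\<lambda>x. (-1) *\<^sub>R (grad (\<phi> n) x - ?g x))"
      by (rule Lnorm_triangle(2)[OF s1 gd Lspace_scaleR[OF gd]])
    also have "Lnorm \<Omega> (ereal s) (\<lambda>x. (-1) *\<^sub>R (grad (\<phi> n) x - ?g x)) = Lnorm \<Omega> (ereal s) (\<lambda>x. grad (\<phi> n) x - ?g x)"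
      using s1 by (subst Lnorm_scaleR) auto
    finally show ?thesis using C0 by (simp add: mult_left_mono)
  qed
  have "uniformly_Cauchy_on UNIV \<phi>"
  proof (rule uniformly_Cauchy_onI)
    fix e :: real assume e: "e > 0"
    then have "e / (2 * C) > 0" using C0 by simp
    then have "\<forall>\<^sub>F n in sequentially. Lnorm \<Omega> (ereal s) (\<lambda>x. grad (\<phi> n) x - ?g x) < e / (2 * C)"
      using order_tendstoD(2)[OF lims(2)] by blast
    then obtain N where N: "\<And>n. n \<ge> N \<Longrightarrow> Lnorm \<Omega> (ereal s) (\<lambda>x. grad (\<phi> n) x - ?g x) < e / (2 * C)"
      by (auto simp: eventually_sequentially)
    have "dist (\<phi> m x) (\<phi> n x) < e" if "m \<ge> N" "n \<ge> N" for m n x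
    proof -
      have "C * (Lnorm \<Omega> (ereal s) (\<lambda>x. grad (\<phi> m) x - ?g x) + Lnorm \<Omega> (ereal s) (\<lambda>x. grad (\<phi> n) x - ?g x)) < C * (e / (2 * C) + e / (2 * C))"
        using N that C0 by (intro mult_strict_left_mono add_strict_mono) auto
      also have "\<dots> = e" using C0 by simp
      finally show ?thesis using diff[of m x n] by (simp add: dist_real_def)
    qed
    then show "\<exists>N. \<forall>x\<in>UNIV. \<forall>m\<ge>N. \<forall>n\<ge>N. dist (\<phi> m x) (\<phi> n x) < e" by blast
  qed
  then have "uniformly_convergent_on UNIV \<phi>" by (rule Cauchy_uniformly_convergent)
  then obtain v where v: "uniform_limit UNIV \<phi> v sequentially" by (auto simp: uniformly_convergent_on_def)
  have cv: "continuous_on UNIV v"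
    by (rule uniform_limit_theorem[OF always_eventually[OF allI[OF smooth_continuous_on[OF test_smooth[OF \<phi>(1)]]]] v]) simp
  have vlim: "(\<lambda>n. \<phi> n x) \<longlonglongrightarrow> v x" for x using tendsto_uniform_limitI[OF v] by simp
  have v0: "v x = 0" if "x \<notin> \<Omega>" for x
  proof -
    have "\<phi> n x = 0" for n using test_support[OF \<phi>(1), of n] that by blast
    then show ?thesis using vlim[of x] LIMSEQ_unique[OF _ tendsto_const] by simp
  qed
  have c\<Omega>: "continuous_on \<Omega> u" using cu closure_subset continuous_on_subset by blast
  have dv: "(\<lambda>x. \<phi> n x - v x) \<in> borel_measurable M" for n
    using open_\<Omega> by (intro continuous_on_borel_measurable_lebesgue_on continuous_on_diff
        smooth_continuous_on[OF test_smooth[OF \<phi>(1)]] continuous_on_subset[OF cv]) auto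
  have sup_bound: "\<forall>\<^sub>F n in sequentially. \<forall>x. \<bar>\<phi> n x - v x\<bar> \<le> e" if "e > 0" for e
    using uniform_limitD[OF v that] by eventually_elim (auto simp: dist_real_def intro: less_imp_le)
  have "Lnorm \<Omega> (ereal s) (\<lambda>x. v x - u x) \<le> e" and vu: "(\<lambda>x. v x - u x) \<in> Lspace \<Omega> (ereal s)" if e: "e > 0" for e
  proof -
    have "V powr (1 / s) > 0" using V_pos by simp
    \<comment> \<open>A uniform error of this size costs at most e / 2 in the norm of exponent s;
      the remaining e / 2 is for the distance of the test function to \<open>u\<close>.\<close>
    then have e2: "e / (2 * V powr (1 / s)) > 0" using e by simp
    have "\<forall>\<^sub>F n in sequentially. Lnorm \<Omega> (ereal s) (\<lambda>x. \<phi> n x - u x) < e / 2"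
      by (rule order_tendstoD(2)[OF lims(1)]) (use e in simp)
    with sup_bound[OF e2]
    obtain n where n: "\<And>x. \<bar>\<phi> n x - v x\<bar> \<le> e / (2 * V powr (1 / s))" "Lnorm \<Omega> (ereal s) (\<lambda>x. \<phi> n x - u x) < e / 2"
      by (metis (mono_tags, lifting) eventually_conj eventually_happens trivial_limit_sequentially)
    have s0: "s > 0" using s1 by simp
    note U = Lnorm_uniform_bound[OF s0 dv less_imp_le[OF e2] n(1)]
    have U2: "(\<lambda>x. (-1) *\<^sub>R (\<phi> n x - v x)) \<in> Lspace \<Omega> (ereal s)" by (rule Lspace_scaleR[OF U(1)])
    have P: "(\<lambda>x. \<phi> n x - u x) \<in> Lspace \<Omega> (ereal s)" using test_Lspace(1)[OF \<phi>(1) s0] w(1) s1 by (intro Lspace_diff)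
    have eq: "(\<lambda>x. v x - u x) = (\<lambda>x. (-1) *\<^sub>R (\<phi> n x - v x) + (\<phi> n x - u x))" by (simp add: fun_eq_iff)
    show "(\<lambda>x. v x - u x) \<in> Lspace \<Omega> (ereal s)" unfolding eq by (rule Lnorm_triangle(1)[OF s1 U2 P])
    have "Lnorm \<Omega> (ereal s) (\<lambda>x. v x - u x) \<le> Lnorm \<Omega> (ereal s) (\<lambda>x. (-1) *\<^sub>R (\<phi> n x - v x)) + Lnorm \<Omega> (ereal s) (\<lambda>x. \<phi> n x - u x)"
      unfolding eq by (rule Lnorm_triangle(2)[OF s1 U2 P])
    also have "Lnorm \<Omega> (ereal s) (\<lambda>x. (-1) *\<^sub>R (\<phi> n x - v x)) = Lnorm \<Omega> (ereal s) (\<lambda>x. \<phi> n x - v x)"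
      using s0 by (subst Lnorm_scaleR) auto
    also have "\<dots> \<le> e / (2 * V powr (1 / s)) * V powr (1 / s)" by (rule U(2))
    also have "\<dots> = e / 2" using V_pos by simp
    finally show "Lnorm \<Omega> (ereal s) (\<lambda>x. v x - u x) \<le> e" using n(2) by simp
  qed
  then have "Lnorm \<Omega> (ereal s) (\<lambda>x. v x - u x) \<le> 0" by (meson field_le_epsilon add_0 dense_ge)
  then have "Lnorm \<Omega> (ereal s) (\<lambda>x. v x - u x) = 0" by (intro antisym Lnorm_ereal_nonneg)
  then have AE0: "AE x in M. v x - u x = 0" using s1 vu[OF zero_less_one] by (intro Lnorm_eq_0_imp_AE[where r=s]) auto
  have "\<bar>v x - u x\<bar> \<le> 0" if "x \<in> \<Omega>" for x
    by (rule AE_le_imp_le[OF _ _ that])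
       (use AE0 c\<Omega> continuous_on_subset[OF cv] in \<open>auto intro!: continuous_intros elim: eventually_mono\<close>)
  then have "v x - u x = 0" if "x \<in> \<Omega>" for x using that by simp
  moreover have "continuous_on (closure \<Omega>) (\<lambda>x. v x - u x)" using cu continuous_on_subset[OF cv] by (intro continuous_intros) auto
  ultimately have eq: "v x = u x" if "x \<in> closure \<Omega>" for x
    using continuous_constant_on_closure[of \<Omega> "\<lambda>x. v x - u x" 0 x] that by simp
  show ?thesis
  proof (rule that[of \<phi>])
    have "uniform_limit (closure \<Omega>) \<phi> v sequentially" by (rule uniform_limit_on_subset[OF v]) simp
    then show "uniform_limit (closure \<Omega>) \<phi> u sequentially"
      by (rule uniform_limit_cong'[THEN iffD1, rotated -1]) (auto simp: eq)
    show "u x = 0" if "x \<in> frontier \<Omega>" for x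
      using that v0[of x] eq[of x] open_\<Omega> by (auto simp: frontier_def interior_open)
  qed (use \<phi>(1) rlim in auto)
qed

end

section \<open>Weak gradients of uniform limits\<close>

text \<open>As in the Riesz-Fischer theorem, a subsequence has increments of norm at most 2^(-j).
  The sum of the norms of the increments is then integrable, hence finite almost everywhere, and
  together with the first term it is the dominating function \<open>w\<close>.\<close>

lemma L1_Cauchy_imp_AE_convergent_subseq:
  fixes g :: "nat \<Rightarrow> 'a \<Rightarrow> 'b::euclidean_space"
  assumes int: "\<And>n. integrable M (g n)"
    and cauchy: "\<And>e. e > 0 \<Longrightarrow> \<exists>N. \<forall>n\<ge>N. \<forall>m\<ge>n. (LINT x|M. norm (g m x - g n x)) < e"
  shows "\<exists>r f w. strict_mono r \<and> f \<in> borel_measurable M \<and> integrable M w \<and>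
    (AE x in M. (\<lambda>j. g (r j) x) \<longlonglongrightarrow> f x) \<and> (\<forall>j. AE x in M. norm (g (r j) x) \<le> w x)"
proof -
  have "\<exists>r. \<forall>j. (\<forall>m\<ge>r j. (LINT x|M. norm (g m x - g (r j) x)) < (1/2) ^ j) \<and> r j < r (Suc j)"
  proof (rule dependent_nat_choice)
    obtain N where "\<forall>n\<ge>N. \<forall>m\<ge>n. (LINT x|M. norm (g m x - g n x)) < (1/2) ^ 0"
      using cauchy[of "(1/2) ^ 0"] by auto
    then show "\<exists>k. \<forall>m\<ge>k. (LINT x|M. norm (g m x - g k x)) < (1/2) ^ 0" by blast
    fix k j :: nat
    have "(1/2 :: real) ^ Suc j > 0" by simp
    from cauchy[OF this]
    obtain N where N: "\<forall>n\<ge>N. \<forall>m\<ge>n. (LINT x|M. norm (g m x - g n x)) < (1/2) ^ Suc j" by blast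
    have "\<forall>m\<ge>max N (Suc k). (LINT x|M. norm (g m x - g (max N (Suc k)) x)) < (1/2) ^ Suc j" using N by simp
    moreover have "k < max N (Suc k)" by simp
    ultimately show "\<exists>y. (\<forall>m\<ge>y. (LINT x|M. norm (g m x - g y x)) < (1/2) ^ Suc j) \<and> k < y" by blast
  qed
  then obtain r where r: "\<And>j m. m \<ge> r j \<Longrightarrow> (LINT x|M. norm (g m x - g (r j) x)) < (1/2) ^ j" "\<And>j. r j < r (Suc j)"
    by blast
  have mono: "strict_mono r" using r(2) by (simp add: strict_mono_Suc_iff)
  define h where "h j x = g (r (Suc j)) x - g (r j) x" for j x
  have hint: "integrable M (h j)" for j unfolding h_def [abs_def] using int by auto
  have hn: "(LINT x|M. norm (h j x)) \<le> (1/2) ^ j" for j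
    using r(1)[of j "r (Suc j)"] r(2)[of j] by (simp add: h_def)
  have sm: "summable (\<lambda>j. LINT x|M. norm (h j x))"
    by (rule summable_comparison_test'[of "\<lambda>j. (1/2) ^ j" 0]) (use hn in \<open>auto simp: summable_geometric abs_of_nonneg integral_nonneg\<close>)
  have AEs: "AE x in M. summable (\<lambda>j. norm (h j x))"
  proof -
    have "(\<integral>\<^sup>+x. (\<Sum>j. ennreal (norm (h j x))) \<partial>M) = (\<Sum>j. \<integral>\<^sup>+x. ennreal (norm (h j x)) \<partial>M)"
      using hint by (intro nn_integral_suminf) auto
    also have "\<dots> = (\<Sum>j. ennreal (LINT x|M. norm (h j x)))"
      using hint by (simp add: nn_integral_eq_integral)
    also have "\<dots> = ennreal (\<Sum>j. LINT x|M. norm (h j x))"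
      using sm by (intro suminf_ennreal2) (auto intro: integral_nonneg)
    finally have "(\<integral>\<^sup>+x. (\<Sum>j. ennreal (norm (h j x))) \<partial>M) \<noteq> \<infinity>" by simp
    then have "AE x in M. (\<Sum>j. ennreal (norm (h j x))) \<noteq> \<infinity>"
      using hint by (intro nn_integral_PInf_AE) auto
    then show ?thesis by eventually_elim (intro summable_suminf_not_top, auto)
  qed
  define w where "w x = norm (g (r 0) x) + (\<Sum>j. norm (h j x))" for x
  have wint: "integrable M w"
    unfolding w_def [abs_def] using int hint AEs sm
    by (intro Bochner_Integration.integrable_add integrable_norm integrable_suminf) auto
  have tel: "g (r n) x = g (r 0) x + (\<Sum>j<n. h j x)" for n x
    by (induction n) (auto simp: h_def)
  define f where "f x = lim (\<lambda>j. g (r j) x)" for x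
  have gm: "g n \<in> borel_measurable M" for n using int by auto
  have "f \<in> borel_measurable M"
    unfolding f_def [abs_def] by (intro borel_measurable_lim_metric gm)
  moreover have "AE x in M. (\<lambda>j. g (r j) x) \<longlonglongrightarrow> f x"
    using AEs
  proof eventually_elim
    fix x assume "summable (\<lambda>j. norm (h j x))"
    then have "summable (\<lambda>j. h j x)" by (rule summable_norm_cancel)
    then have "convergent (\<lambda>n. \<Sum>j<n. h j x)" by (simp add: summable_iff_convergent)
    then have "convergent (\<lambda>n. g (r 0) x + (\<Sum>j<n. h j x))" by (intro convergent_add convergent_const)
    then have "convergent (\<lambda>j. g (r j) x)" unfolding tel[symmetric] .
    then show "(\<lambda>j. g (r j) x) \<longlonglongrightarrow> f x" by (simp add: f_def convergent_LIMSEQ_iff)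
  qed
  moreover have "AE x in M. norm (g (r n) x) \<le> w x" for n
    using AEs
  proof eventually_elim
    fix x assume s: "summable (\<lambda>j. norm (h j x))"
    have "norm (g (r n) x) \<le> norm (g (r 0) x) + norm (\<Sum>j<n. h j x)" unfolding tel[of n] by (rule norm_triangle_ineq)
    also have "norm (\<Sum>j<n. h j x) \<le> (\<Sum>j<n. norm (h j x))" by (rule norm_sum)
    also have "\<dots> \<le> (\<Sum>j. norm (h j x))" using s by (intro sum_le_suminf) auto
    finally show "norm (g (r n) x) \<le> w x" by (simp add: w_def)
  qed
  ultimately show ?thesis using mono wint by blast
qed

context bounded_open begin

text \<open>Weak compactness is replaced by the parallelogram law: test functions of almost minimal
  Dirichlet energy in a shrinking sequence of convex sets have gradients that are Cauchy in \<open>L\<^sup>2\<close>.\<close>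

lemma weak_gradient_of_uniform_limit:
  fixes u :: "'a \<Rightarrow> real"
  assumes cu: "continuous_on (closure \<Omega>) u" and G: "G \<ge> 0"
    and appr: "\<And>n. \<exists>\<psi>\<in>test_functions \<Omega>. (\<forall>x\<in>closure \<Omega>. \<bar>\<psi> x - u x\<bar> \<le> 1 / real (Suc n)) \<and>
      (\<forall>m\<in>{2..n+2}. (LINT x|M. norm (grad \<psi> x) powr real m) \<le> V * G powr real m)"
  shows "\<exists>f. has_weak_gradient \<Omega> u f \<and> (AE x in M. norm (f x) \<le> G)"
proof -
  \<comment> \<open>These sets shrink as n grows and are stable under midpoints. The moment bounds
    start at exponent 2, so that the energy \<open>E\<close> is controlled in all of them, and the
    last one moves off to infinity with n.\<close>
  define S where "S n = {\<psi> \<in> test_functions \<Omega>. (\<forall>x\<in>closure \<Omega>. \<bar>\<psi> x - u x\<bar> \<le> 1 / real (Suc n)) \<and>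
      (\<forall>m\<in>{2..n+2}. (LINT x|M. norm (grad \<psi> x) powr real m) \<le> V * G powr real m)}" for n
  define E where "E \<psi> = (LINT x|M. norm (grad \<psi> x) powr 2)" for \<psi> :: "'a \<Rightarrow> real"
  have ne: "S n \<noteq> {}" for n using appr[of n] by (auto simp: S_def)
  have test: "\<psi> \<in> test_functions \<Omega>" if "\<psi> \<in> S n" for \<psi> n using that by (simp add: S_def)
  have anti: "S m \<subseteq> S n" if "n \<le> m" for n m
  proof -
    have "1 / real (Suc m) \<le> 1 / real (Suc n)" using that by (simp add: frac_le)
    then show ?thesis using that unfolding S_def by fastforce
  qed
  have intg: "integrable M (\<lambda>x. norm (grad \<psi> x) powr r)" if "\<psi> \<in> test_functions \<Omega>" "r > 0" for \<psi> r
    using test_Lspace(2)[OF that] by (simp add: Lspace_ereal)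
  have EB: "0 \<le> E \<psi>" "E \<psi> \<le> V * G powr 2" if "\<psi> \<in> S n" for \<psi> n
  proof -
    show "0 \<le> E \<psi>" by (simp add: E_def integral_nonneg)
    have "\<forall>m\<in>{2..n+2}. (LINT x|M. norm (grad \<psi> x) powr real m) \<le> V * G powr real m"
      using that by (simp add: S_def)
    from bspec[OF this, of 2] show "E \<psi> \<le> V * G powr 2" by (simp add: E_def)
  qed
  define mid where "mid \<psi> \<xi> x = (1/2) * (\<psi> x + \<xi> x)" for \<psi> \<xi> :: "'a \<Rightarrow> real" and x
  have mid_test: "mid \<psi> \<xi> \<in> test_functions \<Omega>" if "\<psi> \<in> test_functions \<Omega>" "\<xi> \<in> test_functions \<Omega>" for \<psi> \<xi>
    unfolding mid_def [abs_def] using that by (intro test_cmult test_add)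
  have mid_grad: "grad (mid \<psi> \<xi>) x = (1/2) *\<^sub>R (grad \<psi> x + grad \<xi> x)" if "\<psi> \<in> test_functions \<Omega>" "\<xi> \<in> test_functions \<Omega>" for \<psi> \<xi> x
    unfolding mid_def [abs_def] grad_cmult[OF smooth_add[OF that[THEN test_smooth]]] grad_add[OF that[THEN test_smooth]] ..
  have mid_S: "mid \<psi> \<xi> \<in> S n" if "\<psi> \<in> S n" "\<xi> \<in> S n" for \<psi> \<xi> n
  proof -
    note t = test[OF that(1)] test[OF that(2)]
    have "\<bar>mid \<psi> \<xi> x - u x\<bar> \<le> 1 / real (Suc n)" if "x \<in> closure \<Omega>" for x
    proof -
      have "\<bar>\<psi> x - u x\<bar> \<le> 1 / real (Suc n)" "\<bar>\<xi> x - u x\<bar> \<le> 1 / real (Suc n)"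
        using \<open>\<psi> \<in> S n\<close> \<open>\<xi> \<in> S n\<close> that by (auto simp: S_def)
      moreover have "\<bar>1/2 * (a + b) - c\<bar> \<le> e" if "\<bar>a - c\<bar> \<le> e" "\<bar>b - c\<bar> \<le> e" for a b c e :: real
        using that unfolding abs_le_iff by (auto simp: field_simps)
      ultimately show ?thesis unfolding mid_def by blast
    qed
    moreover have "(LINT x|M. norm (grad (mid \<psi> \<xi>) x) powr real m) \<le> V * G powr real m" if m: "m \<in> {2..n+2}" for m
    proof -
      have m1: "real m \<ge> 1" "real m > 0" using m by auto
      have "norm (grad (mid \<psi> \<xi>) x) powr real m \<le> 1/2 * norm (grad \<psi> x) powr real m + 1/2 * norm (grad \<xi> x) powr real m" for x
      proof -
        have "norm (grad (mid \<psi> \<xi>) x) \<le> 1/2 * norm (grad \<psi> x) + 1/2 * norm (grad \<xi> x)"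
          using norm_triangle_ineq[of "grad \<psi> x" "grad \<xi> x"] by (simp add: mid_grad[OF t])
        then have "norm (grad (mid \<psi> \<xi>) x) powr real m \<le> (1/2 * norm (grad \<psi> x) + 1/2 * norm (grad \<xi> x)) powr real m"
          using m1 by (intro powr_mono2) auto
        also have "\<dots> \<le> 1/2 * norm (grad \<psi> x) powr real m + 1/2 * norm (grad \<xi> x) powr real m"
          using m1 by (intro powr_convex_combination) auto
        finally show ?thesis .
      qed
      then have "(LINT x|M. norm (grad (mid \<psi> \<xi>) x) powr real m) \<le> (LINT x|M. 1/2 * norm (grad \<psi> x) powr real m + 1/2 * norm (grad \<xi> x) powr real m)"
        using intg[OF mid_test[OF t] m1(2)] intg[OF t(1) m1(2)] intg[OF t(2) m1(2)] by (intro integral_mono) auto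
      also have "\<dots> = 1/2 * (LINT x|M. norm (grad \<psi> x) powr real m) + 1/2 * (LINT x|M. norm (grad \<xi> x) powr real m)"
        using intg[OF t(1) m1(2)] intg[OF t(2) m1(2)] by simp
      also have "\<dots> \<le> V * G powr real m"
      proof -
        have "(LINT x|M. norm (grad \<psi> x) powr real m) \<le> V * G powr real m" "(LINT x|M. norm (grad \<xi> x) powr real m) \<le> V * G powr real m"
          using \<open>\<psi> \<in> S n\<close> \<open>\<xi> \<in> S n\<close> m by (auto simp: S_def)
        then show ?thesis by linarith
      qed
      finally show ?thesis .
    qed
    ultimately show ?thesis using mid_test[OF t] by (simp add: S_def)
  qed
  have par: "(LINT x|M. norm (grad \<psi> x - grad \<xi> x) powr 2) = 2 * (E \<psi> + E \<xi>) - 4 * E (mid \<psi> \<xi>)"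
    if t: "\<psi> \<in> test_functions \<Omega>" "\<xi> \<in> test_functions \<Omega>" for \<psi> \<xi>
  proof -
    have "norm (grad \<psi> x - grad \<xi> x) powr 2 = 2 * (norm (grad \<psi> x) powr 2 + norm (grad \<xi> x) powr 2) - 4 * norm (grad (mid \<psi> \<xi>) x) powr 2" for x
      unfolding mid_grad[OF t] powr_numeral[OF norm_ge_zero]
      by (simp add: power2_norm_eq_inner inner_add_left inner_add_right inner_diff_left inner_diff_right inner_commute algebra_simps)
    then show ?thesis
      using intg[OF t(1), of 2] intg[OF t(2), of 2] intg[OF mid_test[OF t], of 2] by (simp add: E_def)
  qed
  \<comment> \<open>Minimal energies over shrinking sets increase, and the second moment bounds
    them, so they converge.\<close>
  define d where "d n = Inf (E ` S n)" for n
  have bb: "bdd_below (E ` S n)" for n using EB(1) by (intro bdd_belowI[of _ 0]) auto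
  have dle: "d n \<le> E \<psi>" if "\<psi> \<in> S n" for \<psi> n unfolding d_def using that bb by (intro cInf_lower) auto
  have dmono: "d n \<le> d m" if "n \<le> m" for n m
    unfolding d_def using ne anti[OF that] bb by (intro cInf_superset_mono) auto
  have dB: "d n \<le> V * G powr 2" for n
  proof -
    obtain \<psi> where "\<psi> \<in> S n" using ne by blast
    then show ?thesis using dle EB(2) order_trans by blast
  qed
  obtain l where l: "d \<longlonglongrightarrow> l" "\<And>n. d n \<le> l"
    using incseq_convergent[of d "V * G powr 2"] dmono dB by (auto simp: incseq_def)
  have "\<exists>\<psi>\<in>S n. E \<psi> < d n + 1 / real (Suc n)" for n
  proof -
    have "Inf (E ` S n) < d n + 1 / real (Suc n)" by (simp add: d_def)
    then show ?thesis using ne[of n] bb[of n] by (subst (asm) cInf_less_iff) auto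
  qed
  then obtain \<psi> where \<psi>: "\<And>n. \<psi> n \<in> S n" "\<And>n. E (\<psi> n) < d n + 1 / real (Suc n)" by metis
  note t\<psi> = test[OF \<psi>(1)]
  \<comment> \<open>For m >= n the midpoint of two almost minimizers still lies in
    \<open>S n\<close> and so has energy at least \<open>d n\<close>; the parallelogram identity
    then bounds the squared distance of the gradients by this quantity.\<close>
  define \<epsilon> where "\<epsilon> n = 4 * (l - d n) + 4 * (1 / real (Suc n))" for n
  have "\<epsilon> \<longlonglongrightarrow> 4 * (l - l) + 4 * 0"
    unfolding \<epsilon>_def [abs_def] using LIMSEQ_inverse_real_of_nat l(1)
    by (intro tendsto_add tendsto_mult tendsto_diff tendsto_const) (auto simp: inverse_eq_divide)
  then have \<epsilon>0: "\<epsilon> \<longlonglongrightarrow> 0" by simp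
  have L2: "(LINT x|M. norm (grad (\<psi> m) x - grad (\<psi> n) x) powr 2) \<le> \<epsilon> n" if "n \<le> m" for n m
  proof -
    have "\<psi> m \<in> S n" using anti[OF that] \<psi>(1) by blast
    then have "d n \<le> E (mid (\<psi> m) (\<psi> n))" using mid_S[OF _ \<psi>(1)] dle by blast
    moreover have "1 / real (Suc m) \<le> 1 / real (Suc n)" using that by (simp add: frac_le)
    moreover have "2 * (a + b) - 4 * c \<le> 4 * (l - dn) + 4 * e"
      if "dn \<le> c" "e' \<le> e" "a < dm + e'" "b < dn + e" "dm \<le> l" "dn \<le> l" for a b c dn dm e e' :: real
      using that by (simp add: algebra_simps)
    ultimately show ?thesis
      unfolding par[OF t\<psi> t\<psi>] \<epsilon>_def using \<psi>(2)[of m] \<psi>(2)[of n] l(2)[of m] l(2)[of n] by blast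
  qed
  have gint: "integrable M (grad (\<psi> n))" for n
    using test_Lspace(2)[OF t\<psi> zero_less_one] by (auto simp: Lspace_ereal intro: integrable_norm_cancel)
  have "\<exists>r f w. strict_mono r \<and> f \<in> borel_measurable M \<and> integrable M w \<and>
    (AE x in M. (\<lambda>j. grad (\<psi> (r j)) x) \<longlonglongrightarrow> f x) \<and> (\<forall>j. AE x in M. norm (grad (\<psi> (r j)) x) \<le> w x)"
  proof (rule L1_Cauchy_imp_AE_convergent_subseq[OF gint])
    fix e :: real assume e: "e > 0"
    have "(\<lambda>n. sqrt (\<epsilon> n / V) * V) \<longlonglongrightarrow> sqrt (0 / V) * V" using \<epsilon>0 V_pos by (intro tendsto_intros) auto
    then have "\<forall>\<^sub>F n in sequentially. sqrt (\<epsilon> n / V) * V < e" using e by (intro order_tendstoD) auto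
    then obtain N where N: "\<And>n. n \<ge> N \<Longrightarrow> sqrt (\<epsilon> n / V) * V < e" by (auto simp: eventually_sequentially)
    have "(LINT x|M. norm (grad (\<psi> m) x - grad (\<psi> n) x)) < e" if "n \<ge> N" "m \<ge> n" for m n
    proof -
      let ?h = "\<lambda>x. norm (grad (\<psi> m) x - grad (\<psi> n) x)"
      have hL: "(\<lambda>x. grad (\<psi> m) x - grad (\<psi> n) x) \<in> Lspace \<Omega> (ereal 2)"
        using test_Lspace(2)[OF t\<psi>, of 2] by (intro Lspace_diff) auto
      have "(LINT x|M. ?h x powr 1) / V \<le> ((LINT x|M. ?h x powr 2) / V) powr (1 / 2)"
        unfolding V_def using hL V_pos by (intro power_mean(2)[OF finite_measure_M]) (auto simp: Lspace_ereal V_def)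
      also have "\<dots> \<le> (\<epsilon> n / V) powr (1 / 2)"
        using L2[OF that(2)] V_pos by (intro powr_mono2 divide_right_mono) (auto intro!: divide_nonneg_pos integral_nonneg)
      also have "\<dots> \<le> sqrt (\<epsilon> n / V)"
      proof -
        have "0 \<le> (LINT x|M. ?h x powr 2)" by (simp add: Bochner_Integration.integral_nonneg)
        then have "0 \<le> \<epsilon> n" using L2[OF that(2)] by (rule order_trans)
        then have "0 \<le> \<epsilon> n / V" using V_pos by (intro divide_nonneg_pos) auto
        then show ?thesis by (simp add: powr_half_sqrt)
      qed
      finally have "(LINT x|M. ?h x) \<le> sqrt (\<epsilon> n / V) * V" using V_pos by (simp add: divide_le_eq)
      then show ?thesis using N[OF that(1)] by linarith
    qed
    then show "\<exists>N. \<forall>n\<ge>N. \<forall>m\<ge>n. (LINT x|M. norm (grad (\<psi> m) x - grad (\<psi> n) x)) < e" by blast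
  qed
  then obtain r f w where r: "strict_mono r" and fm: "f \<in> borel_measurable M" and w: "integrable M w"
    and lim: "AE x in M. (\<lambda>j. grad (\<psi> (r j)) x) \<longlonglongrightarrow> f x" and dom: "\<And>j. AE x in M. norm (grad (\<psi> (r j)) x) \<le> w x"
    by blast
  have rge: "r j \<ge> j" for j using r by (simp add: seq_suble)
  have gm: "grad (\<psi> n) \<in> borel_measurable M" for n by (rule borel_measurable_integrable[OF gint])
  have unif: "\<bar>\<psi> (r j) x - u x\<bar> \<le> 1 / real (Suc j)" if "x \<in> closure \<Omega>" for j x
  proof -
    have "\<psi> (r j) \<in> S j" using anti[OF rge] \<psi>(1) by blast
    then show ?thesis using that by (simp add: S_def)
  qed
  \<comment> \<open>Fatou's lemma: the moment of order m is bounded for all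
    \<open>\<psi> (r j)\<close> with j >= m, since these lie in \<open>S m\<close>.\<close>
  have fmom: "(\<integral>\<^sup>+x. ennreal (norm (f x) powr real m) \<partial>M) \<le> ennreal (V * G powr real m)" if m: "m \<ge> 2" for m
  proof -
    have "AE x in M. (\<lambda>j. ennreal (norm (grad (\<psi> (r j)) x) powr real m)) \<longlonglongrightarrow> ennreal (norm (f x) powr real m)"
      using lim
    proof eventually_elim
      fix x assume "(\<lambda>j. grad (\<psi> (r j)) x) \<longlonglongrightarrow> f x"
      then show "(\<lambda>j. ennreal (norm (grad (\<psi> (r j)) x) powr real m)) \<longlonglongrightarrow> ennreal (norm (f x) powr real m)"
        using m by (intro tendsto_ennrealI tendsto_powr' tendsto_norm tendsto_const) auto
    qed
    then have "AE x in M. ennreal (norm (f x) powr real m) = liminf (\<lambda>j. ennreal (norm (grad (\<psi> (r j)) x) powr real m))"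
      by eventually_elim (rule lim_imp_Liminf[symmetric, OF trivial_limit_sequentially])
    then have "(\<integral>\<^sup>+x. ennreal (norm (f x) powr real m) \<partial>M) = (\<integral>\<^sup>+x. liminf (\<lambda>j. ennreal (norm (grad (\<psi> (r j)) x) powr real m)) \<partial>M)"
      by (rule nn_integral_cong_AE)
    also have "\<dots> \<le> liminf (\<lambda>j. \<integral>\<^sup>+x. ennreal (norm (grad (\<psi> (r j)) x) powr real m) \<partial>M)"
      using gm by (intro nn_integral_liminf) auto
    also have "\<dots> \<le> ennreal (V * G powr real m)"
    proof (rule Liminf_le)
      show "\<forall>\<^sub>F j in sequentially. (\<integral>\<^sup>+x. ennreal (norm (grad (\<psi> (r j)) x) powr real m) \<partial>M) \<le> ennreal (V * G powr real m)"
        using eventually_ge_at_top[of m]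
      proof eventually_elim
        fix j assume "m \<le> j"
        then have "\<psi> (r j) \<in> S m" using anti[of m "r j"] rge[of j] \<psi>(1) by auto
        then have "(LINT x|M. norm (grad (\<psi> (r j)) x) powr real m) \<le> V * G powr real m"
          using m by (simp add: S_def)
        then show "(\<integral>\<^sup>+x. ennreal (norm (grad (\<psi> (r j)) x) powr real m) \<partial>M) \<le> ennreal (V * G powr real m)"
          using intg[OF t\<psi>, of "real m"] m by (subst nn_integral_eq_integral) (auto intro: ennreal_leI)
      qed
    qed simp
    finally show ?thesis .
  qed
  have AEG: "AE x in M. norm (f x) \<le> G"
  proof -
    \<comment> \<open>By Chebyshev's inequality with the moment of order m, the set where |f| >= G'
      has measure at most V (G / G')^m, which tends to 0.\<close>
    have AEG': "AE x in M. norm (f x) < G'" if G': "G' > G" for G'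
    proof -
      let ?A = "{x \<in> space M. G' \<le> norm (f x)}"
      have A: "?A \<in> sets M" using fm by measurable
      have G'0: "G' > 0" using G' G by linarith
      have mA: "measure M ?A \<le> V * (G / G') ^ m" if m: "m \<ge> 2" for m
      proof -
        have "ennreal (G' powr real m) * emeasure M ?A = (\<integral>\<^sup>+x. ennreal (G' powr real m) * indicator ?A x \<partial>M)"
          using A by (simp add: nn_integral_cmult_indicator)
        also have "\<dots> \<le> (\<integral>\<^sup>+x. ennreal (norm (f x) powr real m) \<partial>M)"
          using G'0 by (intro nn_integral_mono) (auto simp: indicator_def intro!: ennreal_leI powr_mono2)
        also have "\<dots> \<le> ennreal (V * G powr real m)" by (rule fmom[OF m])
        finally have "ennreal (G' powr real m * measure M ?A) \<le> ennreal (V * G powr real m)"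
          by (simp add: emeasure_eq_measure ennreal_mult)
        then have "G' powr real m * measure M ?A \<le> V * G powr real m" using V_pos by simp
        moreover have "G' powr real m = G' ^ m" using G'0 by (simp add: powr_realpow)
        moreover have "G powr real m = G ^ m" using G m by (cases "G = 0") (auto simp: powr_realpow)
        ultimately show ?thesis using G'0 by (simp add: power_divide field_simps)
      qed
      have "(\<lambda>m. V * (G / G') ^ m) \<longlonglongrightarrow> V * 0"
        using G G' G'0 by (intro tendsto_mult tendsto_const LIMSEQ_power_zero) (auto simp: abs_of_nonneg)
      then have "measure M ?A \<le> V * 0"
        by (rule LIMSEQ_le_const) (use mA in blast)
      then have "emeasure M ?A = 0" by (simp add: emeasure_eq_measure measure_le_0_iff)
      then have "AE x in M. x \<notin> ?A" using A by (intro AE_not_in) auto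
      then show ?thesis using AE_space[of M] by eventually_elim auto
    qed
    have "AE x in M. \<forall>k::nat. norm (f x) < G + 1 / real (Suc k)"
      unfolding AE_all_countable by (intro allI AEG') simp
    then show ?thesis
    proof eventually_elim
      fix x assume a: "\<forall>k::nat. norm (f x) < G + 1 / real (Suc k)"
      have "(\<lambda>k. G + 1 / real (Suc k)) \<longlonglongrightarrow> G + 0"
        using LIMSEQ_inverse_real_of_nat by (intro tendsto_add tendsto_const) (simp add: inverse_eq_divide)
      then show "norm (f x) \<le> G" using a by (intro LIMSEQ_le_const[of _ G]) (auto intro: less_imp_le)
    qed
  qed
  have fint: "integrable M f" by (rule integrable_const_bound[OF AEG fm])
  have cu\<Omega>: "continuous_on \<Omega> u" using cu closure_subset continuous_on_subset by blast
  have "has_weak_gradient \<Omega> u f"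
    unfolding has_weak_gradient_def
  proof (intro conjI ballI)
    show Lu: "locally_integrable \<Omega> u" using cu\<Omega> by (rule locally_integrable_continuous)
    show Lf: "locally_integrable \<Omega> f"
      unfolding locally_integrable_def
    proof (intro allI impI)
      fix K assume K: "compact K \<and> K \<subseteq> \<Omega>"
      have "set_integrable lebesgue \<Omega> f" using fint by (simp add: set_integrable_def integrable_restrict_space)
      then show "set_integrable lebesgue K f" by (rule set_integrable_subset) (use K borel_compact[of K] in \<open>auto intro: sets_completionI_sets\<close>)
    qed
    fix \<phi> :: "'a \<Rightarrow> real" and b :: 'a assume \<phi>: "\<phi> \<in> test_functions \<Omega>" and b: "b \<in> Basis"
    note sm = test_smooth[OF \<phi>]
    obtain B where B: "B \<ge> 0" "\<And>x. \<bar>\<phi> x\<bar> \<le> B" using test_bound[OF \<phi>] by blast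
    obtain D where D: "D \<ge> 0" "\<And>x. norm (grad \<phi> x) \<le> D" using test_grad_bound[OF \<phi>] by blast
    obtain U where U: "\<And>x. x \<in> closure \<Omega> \<Longrightarrow> \<bar>u x\<bar> \<le> U" using continuous_bounded[OF cu] by blast
    have Db: "\<bar>frechet_derivative \<phi> (at x) b\<bar> \<le> D" for x
    proof -
      have "\<bar>grad \<phi> x \<bullet> b\<bar> \<le> norm (grad \<phi> x) * norm b" by (rule Cauchy_Schwarz_ineq2)
      then show ?thesis using D(2)[of x] b by (simp add: frechet_eq_grad[OF sm])
    qed
    have \<phi>m: "\<phi> \<in> borel_measurable M" "(\<lambda>x. frechet_derivative \<phi> (at x) b) \<in> borel_measurable M"
      using open_\<Omega> sm by (auto intro!: continuous_on_borel_measurable_lebesgue_on smooth_continuous_on smooth_frechet_derivative)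
    have um: "u \<in> borel_measurable M" using open_\<Omega> cu\<Omega> by (rule continuous_on_borel_measurable_lebesgue_on)
    have \<psi>m: "\<psi> n \<in> borel_measurable M" for n
      using open_\<Omega> by (intro continuous_on_borel_measurable_lebesgue_on smooth_continuous_on test_smooth[OF t\<psi>])
    \<comment> \<open>Both sides of the classical identity converge by dominated convergence: the
      left one under a constant bound from uniform convergence, the right one under a multiple of
      \<open>w\<close>.\<close>
    have eq: "(LINT x|M. \<psi> (r j) x * frechet_derivative \<phi> (at x) b) = - (LINT x|M. (grad (\<psi> (r j)) x \<bullet> b) * \<phi> x)" for j
      using has_weak_gradient_grad[OF open_\<Omega> test_smooth[OF t\<psi>]] \<phi> b unfolding has_weak_gradient_def by blast
    have lim1: "(\<lambda>j. LINT x|M. \<psi> (r j) x * frechet_derivative \<phi> (at x) b) \<longlonglongrightarrow> (LINT x|M. u x * frechet_derivative \<phi> (at x) b)"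
    proof (rule integral_dominated_convergence[where w="\<lambda>x. (U + 1) * D"])
      show "AE x in M. (\<lambda>j. \<psi> (r j) x * frechet_derivative \<phi> (at x) b) \<longlonglongrightarrow> u x * frechet_derivative \<phi> (at x) b"
      proof (rule AE_I2)
        fix x assume "x \<in> space M"
        then have x: "x \<in> closure \<Omega>" using closure_subset by (auto simp: space_restrict_space)
        have "(\<lambda>j. 1 / real (Suc j)) \<longlonglongrightarrow> 0" using LIMSEQ_inverse_real_of_nat by (simp add: inverse_eq_divide)
        then have "(\<lambda>j. \<psi> (r j) x - u x) \<longlonglongrightarrow> 0"
          by (rule Lim_null_comparison[rotated]) (use unif[OF x] in \<open>auto intro!: always_eventually\<close>)
        then have "(\<lambda>j. \<psi> (r j) x) \<longlonglongrightarrow> u x" by (simp add: LIM_zero_iff)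
        then show "(\<lambda>j. \<psi> (r j) x * frechet_derivative \<phi> (at x) b) \<longlonglongrightarrow> u x * frechet_derivative \<phi> (at x) b"
          by (intro tendsto_mult tendsto_const)
      qed
      show "AE x in M. norm (\<psi> (r j) x * frechet_derivative \<phi> (at x) b) \<le> (U + 1) * D" for j
      proof (rule AE_I2)
        fix x assume "x \<in> space M"
        then have x: "x \<in> closure \<Omega>" using closure_subset by (auto simp: space_restrict_space)
        have "1 / real (Suc j) \<le> 1" by simp
        then have "\<bar>\<psi> (r j) x\<bar> \<le> U + 1" using unif[OF x, of j] U[OF x] by linarith
        then show "norm (\<psi> (r j) x * frechet_derivative \<phi> (at x) b) \<le> (U + 1) * D"
          using Db[of x] U[OF x] by (auto simp: abs_mult intro!: mult_mono)
      qed
    qed (use \<phi>m um \<psi>m in auto)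
    have lim2: "(\<lambda>j. LINT x|M. (grad (\<psi> (r j)) x \<bullet> b) * \<phi> x) \<longlonglongrightarrow> (LINT x|M. (f x \<bullet> b) * \<phi> x)"
    proof (rule integral_dominated_convergence[where w="\<lambda>x. w x * B"])
      show "AE x in M. (\<lambda>j. (grad (\<psi> (r j)) x \<bullet> b) * \<phi> x) \<longlonglongrightarrow> (f x \<bullet> b) * \<phi> x"
        using lim by eventually_elim (intro tendsto_mult tendsto_inner tendsto_const)
      show "AE x in M. norm ((grad (\<psi> (r j)) x \<bullet> b) * \<phi> x) \<le> w x * B" for j
        using dom[of j]
      proof eventually_elim
        fix x assume wx: "norm (grad (\<psi> (r j)) x) \<le> w x"
        have "\<bar>grad (\<psi> (r j)) x \<bullet> b\<bar> \<le> norm (grad (\<psi> (r j)) x) * norm b" by (rule Cauchy_Schwarz_ineq2)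
        then have "\<bar>grad (\<psi> (r j)) x \<bullet> b\<bar> \<le> w x" using wx b by simp
        then show "norm ((grad (\<psi> (r j)) x \<bullet> b) * \<phi> x) \<le> w x * B"
          using B(2)[of x] by (auto simp: abs_mult intro!: mult_mono)
      qed
    qed (use \<phi>m fm gm w in auto)
    show "(LINT x|M. u x * frechet_derivative \<phi> (at x) b) = - (LINT x|M. (f x \<bullet> b) * \<phi> x)"
      by (rule LIMSEQ_unique[OF lim1]) (unfold eq, rule tendsto_minus[OF lim2])
  qed
  then show ?thesis using AEG by blast
qed

end

section \<open>The constant \<open>Lambda_inf\<close>\<close>

lemma has_weak_gradient_cmult:
  assumes "has_weak_gradient \<Omega> u g"
  shows "has_weak_gradient \<Omega> (\<lambda>x. c * u x) (\<lambda>x. c *\<^sub>R g x)"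
proof -
  have L: "locally_integrable \<Omega> u" "locally_integrable \<Omega> g" using assms by (auto simp: has_weak_gradient_def)
  have "locally_integrable \<Omega> (\<lambda>x. c * u x)"
    using L(1) unfolding locally_integrable_def by auto
  moreover have "locally_integrable \<Omega> (\<lambda>x. c *\<^sub>R g x)"
    unfolding locally_integrable_def set_integrable_def
  proof (intro allI impI)
    fix K assume "compact K \<and> K \<subseteq> \<Omega>"
    then have "integrable lebesgue (\<lambda>x. indicator K x *\<^sub>R g x)"
      using L(2) by (simp add: locally_integrable_def set_integrable_def)
    then have "integrable lebesgue (\<lambda>x. c *\<^sub>R (indicator K x *\<^sub>R g x))" by (rule integrable_scaleR_right)
    then show "integrable lebesgue (\<lambda>x. indicator K x *\<^sub>R (c *\<^sub>R g x))" by (simp add: mult.commute)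
  qed
  moreover have "(LINT x|lebesgue_on \<Omega>. c * u x * frechet_derivative \<phi> (at x) b) = - (LINT x|lebesgue_on \<Omega>. ((c *\<^sub>R g x) \<bullet> b) * \<phi> x)"
    if "\<phi> \<in> test_functions \<Omega>" "b \<in> Basis" for \<phi> b
  proof -
    have "(LINT x|lebesgue_on \<Omega>. u x * frechet_derivative \<phi> (at x) b) = - (LINT x|lebesgue_on \<Omega>. (g x \<bullet> b) * \<phi> x)"
      using assms that by (auto simp: has_weak_gradient_def)
    then show ?thesis by (simp add: mult.assoc)
  qed
  ultimately show ?thesis by (auto simp: has_weak_gradient_def)
qed

text \<open>The radius \<rho> halfway between m and R leaves room for a closed ball inside the
  domain. The apex of the smoothed cone has height (\<rho> - d) exp (- d / (\<rho> - d)), which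
  tends to \<rho> > m as d tends to 0.\<close>

lemma exists_test_function_grad_le_1:
  assumes "ball x0 R \<subseteq> \<Omega>" "0 < m" "m < R"
  shows "\<exists>v\<in>test_functions \<Omega>. (\<forall>x. norm (grad v x) \<le> 1) \<and> m < v x0"
proof -
  define \<rho> where "\<rho> = (m + R) / 2"
  have \<rho>: "m < \<rho>" "\<rho> < R" using assms by (auto simp: \<rho>_def)
  have "((\<lambda>d. (\<rho> - d) * exp (- (d / (\<rho> - d)))) \<longlongrightarrow> (\<rho> - 0) * exp (- (0 / (\<rho> - 0)))) (at_right 0)"
    using \<rho> assms by (intro tendsto_intros) auto
  then have "\<forall>\<^sub>F d in at_right 0. m < (\<rho> - d) * exp (- (d / (\<rho> - d)))"
    using \<rho> by (intro order_tendstoD) auto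
  moreover have "\<forall>\<^sub>F d in at_right 0. 0 < d \<and> d < \<rho>"
    using \<rho> assms by (auto simp: eventually_at_right_field)
  ultimately obtain d where d: "m < (\<rho> - d) * exp (- (d / (\<rho> - d)))" "0 < d" "d < \<rho>"
    by (metis (mono_tags, lifting) eventually_conj eventually_happens trivial_limit_at_right_real)
  have "cone d \<rho> x0 x0 = (\<rho> - d) * exp (- (d / (\<rho> - d)))"
    using d by (simp add: cone_altdef smooth_pos_part_def flat_def)
  moreover have "cball x0 \<rho> \<subseteq> \<Omega>" using assms \<rho> by (auto simp: subset_iff)
  moreover have "norm (grad (cone d \<rho> x0) x) \<le> 1" for x
    by (rule norm_grad_le[OF smooth_cone[OF d(2)]]) (use cone_derivative_bound[OF d(2)] in simp)
  ultimately show ?thesis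
    using cone_test[OF d(2)] d(1) by (intro bexI[of _ "cone d \<rho> x0"]) auto
qed

context bounded_open begin

section \<open>Test functions and multiples in the function spaces\<close>

lemma test_C0: assumes "\<phi> \<in> test_functions \<Omega>" shows "\<phi> \<in> C0 \<Omega>"
proof -
  have "\<phi> x = 0" if "x \<in> frontier \<Omega>" for x
  proof -
    have "x \<notin> \<Omega>" using that open_\<Omega> by (auto simp: frontier_def interior_open)
    then show ?thesis using test_support[OF assms] by blast
  qed
  then show ?thesis using smooth_continuous_on[OF test_smooth[OF assms]] by (simp add: C0_def)
qed

lemma test_has_weak_gradient: "\<phi> \<in> test_functions \<Omega> \<Longrightarrow> has_weak_gradient \<Omega> \<phi> (grad \<phi>)"
  by (rule has_weak_gradient_grad[OF open_\<Omega> test_smooth])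

lemma test_W1_inf:
  assumes "\<phi> \<in> test_functions \<Omega>" shows "\<phi> \<in> W1 \<Omega> \<infinity>"
proof -
  obtain G where "\<And>x. norm (grad \<phi> x) \<le> G" using test_grad_bound[OF assms] by blast
  moreover have "grad \<phi> \<in> borel_measurable M"
    using weak_gradient_measurable[OF open_\<Omega> test_has_weak_gradient[OF assms]] .
  ultimately have "grad \<phi> \<in> Lspace \<Omega> \<infinity>" by (intro Linf_bounds(1)) auto
  moreover have "\<phi> \<in> Lspace \<Omega> \<infinity>"
    by (intro continuous_Linf(1) smooth_continuous_on test_smooth[OF assms])
  ultimately show ?thesis using test_has_weak_gradient[OF assms] by (auto simp: W1_def)
qed

lemma test_Xpq:
  assumes "\<phi> \<in> test_functions \<Omega>" "max p q > 0" shows "\<phi> \<in> Xpq \<Omega> p q"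
proof -
  define s where "s = max p q"
  have s: "s > 0" using assms(2) by (simp add: s_def)
  let ?s = "ereal s"
  have "\<phi> \<in> W1 \<Omega> ?s"
    using test_Lspace[OF assms(1) s] test_has_weak_gradient[OF assms(1)] by (auto simp: W1_def)
  moreover have "W1_norm \<Omega> ?s (\<lambda>x. \<phi> x - \<phi> x) = 0"
  proof -
    have "Lnorm \<Omega> ?s (weak_gradient \<Omega> (\<lambda>x. \<phi> x - \<phi> x)) = Lnorm \<Omega> ?s (\<lambda>x. grad \<phi> x - grad \<phi> x)"
      by (intro Lnorm_weak_gradient has_weak_gradient_diff test_has_weak_gradient open_\<Omega> assms(1))
    then show ?thesis by (simp add: W1_norm_def Lnorm_ereal)
  qed
  ultimately have "\<phi> \<in> W01 \<Omega> ?s"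
    unfolding W01_def using assms(1) by (intro CollectI conjI exI[of _ "\<lambda>n. \<phi>"]) auto
  then show ?thesis using smooth_continuous_on[OF test_smooth[OF assms(1)]] by (simp add: Xpq_def flip: s_def)
qed

lemma Lnorm_inf_cmult:
  fixes u :: "'a \<Rightarrow> real"
  assumes u: "continuous_on (closure \<Omega>) u" shows "Lnorm \<Omega> \<infinity> (\<lambda>x. c * u x) = \<bar>c\<bar> * Lnorm \<Omega> \<infinity> u"
proof -
  have le: "Lnorm \<Omega> \<infinity> (\<lambda>x. c * u x) \<le> \<bar>c\<bar> * Lnorm \<Omega> \<infinity> u" if u: "continuous_on (closure \<Omega>) u" for c u
  proof (rule continuous_Linf(4))
    show "continuous_on (closure \<Omega>) (\<lambda>x. c * u x)" using u by (intro continuous_intros)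
    fix x assume "x \<in> \<Omega>"
    then have "\<bar>u x\<bar> \<le> Lnorm \<Omega> \<infinity> u" using continuous_Linf(3)[OF u] closure_subset by blast
    then show "\<bar>c * u x\<bar> \<le> \<bar>c\<bar> * Lnorm \<Omega> \<infinity> u" by (simp add: abs_mult mult_left_mono)
  qed
  show ?thesis
  proof (cases "c = 0")
    case True
    have "continuous_on (closure \<Omega>) (\<lambda>x. c * u x)" using u by (intro continuous_intros)
    then show ?thesis using le[OF u, of c] continuous_Linf(2)[of "\<lambda>x. c * u x"] True by simp
  next
    case False
    have "continuous_on (closure \<Omega>) (\<lambda>x. c * u x)" using u by (intro continuous_intros)
    from le[OF this, of "inverse c"] False
    have "Lnorm \<Omega> \<infinity> u \<le> \<bar>inverse c\<bar> * Lnorm \<Omega> \<infinity> (\<lambda>x. c * u x)" by (simp add: mult.assoc[symmetric])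
    then have "\<bar>c\<bar> * Lnorm \<Omega> \<infinity> u \<le> Lnorm \<Omega> \<infinity> (\<lambda>x. c * u x)" using False by (simp add: field_simps)
    then show ?thesis using le[OF u, of c] by linarith
  qed
qed

lemma Xpq_cmult:
  assumes u: "u \<in> Xpq \<Omega> p q" and s: "max p q > 0"
  shows "(\<lambda>x. c * u x) \<in> Xpq \<Omega> p q"
    and "r > 0 \<Longrightarrow> Lnorm \<Omega> (ereal r) (weak_gradient \<Omega> (\<lambda>x. c * u x)) = \<bar>c\<bar> * Lnorm \<Omega> (ereal r) (weak_gradient \<Omega> u)"
    and "Lnorm \<Omega> \<infinity> (\<lambda>x. c * u x) = \<bar>c\<bar> * Lnorm \<Omega> \<infinity> u"
proof -
  let ?s = "ereal (max p q)"
  have W: "u \<in> W01 \<Omega> ?s" and cu: "continuous_on (closure \<Omega>) u" using u by (auto simp: Xpq_def)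
  note w = W01_has_weak_gradient[OF W]
  note wc = has_weak_gradient_cmult[OF w(3), of c]
  show "Lnorm \<Omega> (ereal r) (weak_gradient \<Omega> (\<lambda>x. c * u x)) = \<bar>c\<bar> * Lnorm \<Omega> (ereal r) (weak_gradient \<Omega> u)" if "r > 0"
    unfolding Lnorm_weak_gradient[OF open_\<Omega> wc] by (rule Lnorm_scaleR[OF that])
  show "Lnorm \<Omega> \<infinity> (\<lambda>x. c * u x) = \<bar>c\<bar> * Lnorm \<Omega> \<infinity> u" by (rule Lnorm_inf_cmult[OF cu])
  have "(\<lambda>x. c * u x) \<in> W1 \<Omega> ?s"
    using Lspace_scaleR[OF w(1), of c] Lspace_scaleR[OF w(2), of c] wc by (auto simp: W1_def)
  moreover obtain \<phi> where \<phi>: "\<And>n. \<phi> n \<in> test_functions \<Omega>" "(\<lambda>n. W1_norm \<Omega> ?s (\<lambda>x. \<phi> n x - u x)) \<longlonglongrightarrow> 0"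
    using W by (auto simp: W01_def)
  have "W1_norm \<Omega> ?s (\<lambda>x. c * \<phi> n x - c * u x) = \<bar>c\<bar> * W1_norm \<Omega> ?s (\<lambda>x. \<phi> n x - u x)" for n
  proof -
    have d: "has_weak_gradient \<Omega> (\<lambda>x. \<phi> n x - u x) (\<lambda>x. grad (\<phi> n) x - weak_gradient \<Omega> u x)"
      by (rule has_weak_gradient_diff[OF open_\<Omega> test_has_weak_gradient[OF \<phi>(1)] w(3)])
    have "Lnorm \<Omega> ?s (weak_gradient \<Omega> (\<lambda>x. c * (\<phi> n x - u x))) = \<bar>c\<bar> * Lnorm \<Omega> ?s (weak_gradient \<Omega> (\<lambda>x. \<phi> n x - u x))"
      unfolding Lnorm_weak_gradient[OF open_\<Omega> has_weak_gradient_cmult[OF d]] Lnorm_weak_gradient[OF open_\<Omega> d]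
      by (rule Lnorm_scaleR[OF s])
    moreover have "Lnorm \<Omega> ?s (\<lambda>x. c * (\<phi> n x - u x)) = \<bar>c\<bar> * Lnorm \<Omega> ?s (\<lambda>x. \<phi> n x - u x)"
      using Lnorm_scaleR[OF s, of \<Omega> c "\<lambda>x. \<phi> n x - u x"] by simp
    ultimately show ?thesis by (simp add: W1_norm_def right_diff_distrib distrib_left)
  qed
  then have "(\<lambda>n. W1_norm \<Omega> ?s (\<lambda>x. c * \<phi> n x - c * u x)) \<longlonglongrightarrow> 0"
    using tendsto_mult_right_zero[OF \<phi>(2), of "\<bar>c\<bar>"] by simp
  ultimately have "(\<lambda>x. c * u x) \<in> W01 \<Omega> ?s"
    unfolding W01_def using test_cmult[OF \<phi>(1)] by (intro CollectI conjI exI[of _ "\<lambda>n x. c * \<phi> n x"]) auto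
  moreover have "continuous_on (closure \<Omega>) (\<lambda>x. c * u x)" using cu by (intro continuous_intros)
  ultimately show "(\<lambda>x. c * u x) \<in> Xpq \<Omega> p q" by (simp add: Xpq_def)
qed

lemma W1_inf_weak_gradient:
  assumes "u \<in> W1 \<Omega> \<infinity>"
  shows "has_weak_gradient \<Omega> u (weak_gradient \<Omega> u)" "0 \<le> Lnorm \<Omega> \<infinity> (weak_gradient \<Omega> u)"
    "AE x in M. norm (weak_gradient \<Omega> u x) \<le> Lnorm \<Omega> \<infinity> (weak_gradient \<Omega> u)"
proof -
  obtain g where g: "g \<in> Lspace \<Omega> \<infinity>" "has_weak_gradient \<Omega> u g" using assms by (auto simp: W1_def)
  show h: "has_weak_gradient \<Omega> u (weak_gradient \<Omega> u)" using has_weak_gradient_weak_gradient[OF g(2)] .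
  obtain K where "AE x in M. norm (weak_gradient \<Omega> u x) \<le> K"
    using Lspace_inf_AE_bounded[OF Lspace_weak_gradient[OF open_\<Omega> g(2,1)]] by blast
  from Linf_bounds(2,4)[OF weak_gradient_measurable[OF open_\<Omega> h] this]
  show "0 \<le> Lnorm \<Omega> \<infinity> (weak_gradient \<Omega> u)" "AE x in M. norm (weak_gradient \<Omega> u x) \<le> Lnorm \<Omega> \<infinity> (weak_gradient \<Omega> u)"
    by auto
qed

section \<open>Distance to the complement and the constant \<open>Lambda_inf\<close>\<close>

lemma complement_nonempty: "- \<Omega> \<noteq> {}"
  using bounded_\<Omega> not_bounded_UNIV by (metis Compl_UNIV_eq double_complement)

lemma W1_inf_C0_bound:
  assumes u: "u \<in> W1 \<Omega> \<infinity>" "u \<in> C0 \<Omega>" and x: "x \<in> \<Omega>"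
  shows "\<bar>u x\<bar> \<le> Lnorm \<Omega> \<infinity> (weak_gradient \<Omega> u) * infdist x (- \<Omega>)"
proof -
  note w = W1_inf_weak_gradient[OF u(1)]
  let ?L = "Lnorm \<Omega> \<infinity> (weak_gradient \<Omega> u)"
  have cl: "closed (- \<Omega>)" using open_\<Omega> by (simp add: closed_Compl)
  obtain y where y: "y \<in> - \<Omega>" "infdist x (- \<Omega>) = dist x y"
    using infdist_attains_inf[OF cl complement_nonempty] by blast
  define d where "d = dist x y"
  have d: "d > 0" using x y by (auto simp: d_def)
  have ball: "ball x d \<subseteq> \<Omega>"
  proof
    fix w assume w: "w \<in> ball x d"
    show "w \<in> \<Omega>"
    proof (rule ccontr)
      assume "w \<notin> \<Omega>"
      then have "infdist x (- \<Omega>) \<le> dist x w" by (intro infdist_le) auto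
      then show False using w y by (simp add: d_def)
    qed
  qed
  have yb: "y \<in> closure (ball x d)" using d by (simp add: d_def)
  have yc: "y \<in> closure \<Omega>" using yb closure_mono[OF ball] by blast
  have cu: "continuous_on (closure \<Omega>) u" using u by (simp add: C0_def)
  have "y \<in> frontier \<Omega>" using yc y(1) open_\<Omega> by (simp add: frontier_def interior_open)
  then have uy: "u y = 0" using u by (simp add: C0_def)
  \<comment> \<open>The segment up to \<open>y\<close> leaves the open set at its endpoint, so the
    Lipschitz bound is used for \<open>w\<close> in the open ball only and extended to
    \<open>y\<close> by continuity.\<close>
  have "\<bar>u x - u w\<bar> \<le> ?L * d" if "w \<in> ball x d" for w
  proof -
    have "closed_segment x w \<subseteq> ball x d" using that d by (intro closed_segment_subset) auto
    then have "\<bar>u x - u w\<bar> \<le> ?L * norm (w - x)"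
      using ball closure_subset by (intro weak_gradient_bound_imp_lipschitz[OF open_\<Omega> continuous_on_subset[OF cu] w(1) w(3) w(2)]) auto
    also have "\<dots> \<le> ?L * d" using that w(2) by (intro mult_left_mono) (auto simp: dist_norm norm_minus_commute)
    finally show ?thesis .
  qed
  moreover have "continuous_on (closure (ball x d)) (\<lambda>w. \<bar>u x - u w\<bar>)"
    by (intro continuous_intros continuous_on_subset[OF cu] closure_mono ball)
  ultimately have "\<bar>u x - u y\<bar> \<le> ?L * d"
    using continuous_le_on_closure[of "ball x d" "\<lambda>w. \<bar>u x - u w\<bar>" y "?L * d"] yb by blast
  then show ?thesis using uy y(2) by (simp add: d_def)
qed

text \<open>R is the inradius, attained at \<open>x0\<close> because the distance to the complement
  is continuous on the compact closure. The distance bound gives 1 / R as a lower bound of the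
  quotients, so the infimum is over a set bounded below and is a genuine lower bound.\<close>

lemma Lambda_inf_properties:
  obtains R x0 where "R > 0" "x0 \<in> \<Omega>" "ball x0 R \<subseteq> \<Omega>" "1 / R \<le> Lambda_inf \<Omega>"
    "\<forall>u. u \<in> W1 \<Omega> \<infinity> \<longrightarrow> u \<in> C0 \<Omega> \<longrightarrow> Lambda_inf \<Omega> * Lnorm \<Omega> \<infinity> u \<le> Lnorm \<Omega> \<infinity> (weak_gradient \<Omega> u)"
proof -
  have comp: "compact (closure \<Omega>)" using bounded_\<Omega> by simp
  have cl: "closed (- \<Omega>)" using open_\<Omega> by (simp add: closed_Compl)
  have "closure \<Omega> \<noteq> {}" using nonempty_\<Omega> by simp
  then have "\<exists>x\<in>closure \<Omega>. \<forall>y\<in>closure \<Omega>. infdist y (- \<Omega>) \<le> infdist x (- \<Omega>)"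
    by (intro continuous_attains_sup[OF comp] continuous_intros)
  then obtain x0 where x0: "x0 \<in> closure \<Omega>" "\<And>x. x \<in> closure \<Omega> \<Longrightarrow> infdist x (- \<Omega>) \<le> infdist x0 (- \<Omega>)"
    by blast
  define R where "R = infdist x0 (- \<Omega>)"
  obtain z where z: "z \<in> \<Omega>" using nonempty_\<Omega> by blast
  have "infdist z (- \<Omega>) \<noteq> 0" using in_closed_iff_infdist_zero[OF cl complement_nonempty, of z] z by simp
  then have "infdist z (- \<Omega>) > 0" using infdist_nonneg[of z "- \<Omega>"] by linarith
  then have R: "R > 0" using x0(2)[of z] z closure_subset by (fastforce simp: R_def)
  have x0\<Omega>: "x0 \<in> \<Omega>" using R in_closed_iff_infdist_zero[OF cl complement_nonempty, of x0] by (auto simp: R_def)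
  have ball: "ball x0 R \<subseteq> \<Omega>"
  proof
    fix w assume w: "w \<in> ball x0 R"
    show "w \<in> \<Omega>"
    proof (rule ccontr)
      assume "w \<notin> \<Omega>"
      then have "infdist x0 (- \<Omega>) \<le> dist x0 w" by (intro infdist_le) auto
      then show False using w by (simp add: R_def)
    qed
  qed
  let ?S = "{Lnorm \<Omega> \<infinity> (weak_gradient \<Omega> u) / Lnorm \<Omega> \<infinity> u | u. u \<in> W1 \<Omega> \<infinity> \<inter> C0 \<Omega> \<and> (\<exists>x\<in>\<Omega>. u x \<noteq> 0)}"
  have pos: "Lnorm \<Omega> \<infinity> u > 0" if uC: "u \<in> C0 \<Omega>" and ne: "\<exists>x\<in>\<Omega>. u x \<noteq> 0" for u
  proof -
    obtain x where x: "x \<in> \<Omega>" "u x \<noteq> 0" using ne by blast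
    then have "\<bar>u x\<bar> \<le> Lnorm \<Omega> \<infinity> u" using uC closure_subset by (intro continuous_Linf(3)) (auto simp: C0_def)
    then show ?thesis using x by linarith
  qed
  have lower: "1 / R \<le> r" if rS: "r \<in> ?S" for r
  proof -
    obtain u where u: "u \<in> W1 \<Omega> \<infinity>" "u \<in> C0 \<Omega>" "\<exists>x\<in>\<Omega>. u x \<noteq> 0" "r = Lnorm \<Omega> \<infinity> (weak_gradient \<Omega> u) / Lnorm \<Omega> \<infinity> u"
      using rS by blast
    have "Lnorm \<Omega> \<infinity> u \<le> Lnorm \<Omega> \<infinity> (weak_gradient \<Omega> u) * R"
    proof (rule continuous_Linf(4))
      show "continuous_on (closure \<Omega>) u" using u by (simp add: C0_def)
      fix x assume x: "x \<in> \<Omega>"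
      have "\<bar>u x\<bar> \<le> Lnorm \<Omega> \<infinity> (weak_gradient \<Omega> u) * infdist x (- \<Omega>)" by (rule W1_inf_C0_bound[OF u(1,2) x])
      also have "\<dots> \<le> Lnorm \<Omega> \<infinity> (weak_gradient \<Omega> u) * R"
        unfolding R_def using x closure_subset by (intro mult_left_mono x0(2) W1_inf_weak_gradient(2)[OF u(1)]) auto
      finally show "\<bar>u x\<bar> \<le> Lnorm \<Omega> \<infinity> (weak_gradient \<Omega> u) * R" .
    qed
    then show ?thesis using R pos[OF u(2,3)] by (simp add: u(4) field_simps)
  qed
  \<comment> \<open>The set of quotients must also be nonempty for its infimum to be meaningful; any
    height between 0 and R would do.\<close>
  obtain v where v: "v \<in> test_functions \<Omega>" "v x0 > R / 2"
    using exists_test_function_grad_le_1[OF ball, of "R / 2"] R by auto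
  have "Lnorm \<Omega> \<infinity> (weak_gradient \<Omega> v) / Lnorm \<Omega> \<infinity> v \<in> ?S"
  proof (intro CollectI exI[of _ v] conjI IntI refl)
    show "\<exists>x\<in>\<Omega>. v x \<noteq> 0" using v(2) R x0\<Omega> by (intro bexI[of _ x0]) auto
  qed (use test_W1_inf[OF v(1)] test_C0[OF v(1)] in auto)
  then have "?S \<noteq> {}" by blast
  then have 1: "1 / R \<le> Lambda_inf \<Omega>" unfolding Lambda_inf_def by (intro cInf_greatest lower)
  have bdd: "bdd_below ?S" by (rule bdd_belowI[of _ "1 / R"]) (rule lower)
  have 2: "Lambda_inf \<Omega> * Lnorm \<Omega> \<infinity> u \<le> Lnorm \<Omega> \<infinity> (weak_gradient \<Omega> u)" if u: "u \<in> W1 \<Omega> \<infinity>" "u \<in> C0 \<Omega>" for u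
  proof (cases "\<exists>x\<in>\<Omega>. u x \<noteq> 0")
    case True
    then have "Lambda_inf \<Omega> \<le> Lnorm \<Omega> \<infinity> (weak_gradient \<Omega> u) / Lnorm \<Omega> \<infinity> u"
      unfolding Lambda_inf_def using u by (intro cInf_lower bdd) blast
    then show ?thesis using pos[OF u(2) True] by (simp add: field_simps)
  next
    case False
    then have "Lnorm \<Omega> \<infinity> u \<le> 0" using u by (intro continuous_Linf(4)) (auto simp: C0_def)
    then have "Lnorm \<Omega> \<infinity> u = 0" using continuous_Linf(2)[of u] u by (simp add: C0_def)
    then show ?thesis using W1_inf_weak_gradient(2)[OF u(1)] by simp
  qed
  show ?thesis using that[OF R x0\<Omega> ball 1] 2 by blast
qed

section \<open>Estimates for least energy solutions\<close>


text \<open>The estimate for test functions passes to the limit at exponent q, whether or not q is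
  the larger exponent, because the approximation converges in all gradient norms up to max p q. The
  constant depends neither on p nor on q.\<close>

lemma Xpq_Morrey:
  "\<exists>C>0. \<forall>p q u. 2 * real DIM('a) \<le> p \<longrightarrow> 2 * real DIM('a) \<le> q \<longrightarrow> u \<in> Xpq \<Omega> p q \<longrightarrow>
    (\<forall>x\<in>closure \<Omega>. \<forall>y\<in>closure \<Omega>.
      \<bar>u x - u y\<bar> \<le> C * sqrt (dist x y) * Lnorm \<Omega> (ereal q) (weak_gradient \<Omega> u) \<and>
      \<bar>u x\<bar> \<le> C * Lnorm \<Omega> (ereal q) (weak_gradient \<Omega> u))"
proof -
  obtain C where C: "C > 0" "\<forall>s \<phi> x y. 2 * real DIM('a) \<le> s \<longrightarrow> \<phi> \<in> test_functions \<Omega> \<longrightarrow>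
    \<bar>\<phi> x - \<phi> y\<bar> \<le> C * sqrt (dist x y) * Lnorm \<Omega> (ereal s) (grad \<phi>) \<and>
    \<bar>\<phi> x\<bar> \<le> C * Lnorm \<Omega> (ereal s) (grad \<phi>)"
    using Morrey by blast
  have "DIM('a) \<ge> 1" by (simp add: Suc_leI)
  then have N1: "2 * real DIM('a) \<ge> 1" by linarith
  have "\<bar>u x - u y\<bar> \<le> C * sqrt (dist x y) * Lnorm \<Omega> (ereal q) (weak_gradient \<Omega> u) \<and> \<bar>u x\<bar> \<le> C * Lnorm \<Omega> (ereal q) (weak_gradient \<Omega> u)"
    if pq: "2 * real DIM('a) \<le> p" "2 * real DIM('a) \<le> q" and u: "u \<in> Xpq \<Omega> p q" and x: "x \<in> closure \<Omega>" and y: "y \<in> closure \<Omega>"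
    for p q u x y
  proof -
    have s: "2 * real DIM('a) \<le> max p q" using pq by simp
    have W: "u \<in> W01 \<Omega> (ereal (max p q))" "continuous_on (closure \<Omega>) u" using u unfolding Xpq_def by blast+
    obtain \<phi> where \<phi>: "\<And>n. \<phi> n \<in> test_functions \<Omega>" and ul: "uniform_limit (closure \<Omega>) \<phi> u sequentially"
      and lr: "\<And>r. 1 \<le> r \<Longrightarrow> r \<le> max p q \<Longrightarrow> (\<lambda>n. Lnorm \<Omega> (ereal r) (grad (\<phi> n))) \<longlonglongrightarrow> Lnorm \<Omega> (ereal r) (weak_gradient \<Omega> u)"
      by (rule W01_approximation[OF s W]) (rule that)
    have lq: "(\<lambda>n. Lnorm \<Omega> (ereal q) (grad (\<phi> n))) \<longlonglongrightarrow> Lnorm \<Omega> (ereal q) (weak_gradient \<Omega> u)"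
      using N1 pq by (intro lr) auto
    have lx: "(\<lambda>n. \<phi> n x) \<longlonglongrightarrow> u x" "(\<lambda>n. \<phi> n y) \<longlonglongrightarrow> u y"
      using tendsto_uniform_limitI[OF ul] x y by blast+
    have "(\<lambda>n. \<bar>\<phi> n x - \<phi> n y\<bar>) \<longlonglongrightarrow> \<bar>u x - u y\<bar>" by (intro tendsto_rabs tendsto_diff lx)
    then have "\<bar>u x - u y\<bar> \<le> C * sqrt (dist x y) * Lnorm \<Omega> (ereal q) (weak_gradient \<Omega> u)"
      by (rule LIMSEQ_le[OF _ tendsto_mult_left[OF lq]]) (use C pq \<phi> in blast)
    moreover have "(\<lambda>n. \<bar>\<phi> n x\<bar>) \<longlonglongrightarrow> \<bar>u x\<bar>" by (intro tendsto_rabs lx)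
    then have "\<bar>u x\<bar> \<le> C * Lnorm \<Omega> (ereal q) (weak_gradient \<Omega> u)"
      by (rule LIMSEQ_le[OF _ tendsto_mult_left[OF lq]]) (use C pq \<phi> in blast)
    ultimately show ?thesis by blast
  qed
  then show ?thesis using C(1) by blast
qed

lemma Xpq_C0:
  assumes "2 * real DIM('a) \<le> p" "u \<in> Xpq \<Omega> p q" shows "u \<in> C0 \<Omega>"
proof -
  have s: "2 * real DIM('a) \<le> max p q" using assms by simp
  have W: "u \<in> W01 \<Omega> (ereal (max p q))" and c: "continuous_on (closure \<Omega>) u" using assms(2) unfolding Xpq_def by blast+
  have "u x = 0" if "x \<in> frontier \<Omega>" for x
    by (rule W01_approximation[OF s W c]) (use that in blast)
  then show ?thesis using c by (simp add: C0_def)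
qed

lemma Lnorm_grad_bound_1:
  assumes v: "v \<in> test_functions \<Omega>" "\<forall>x. norm (grad v x) \<le> 1" and r: "r > 0"
  shows "Lnorm \<Omega> (ereal r) (weak_gradient \<Omega> v) powr r \<le> V"
proof -
  have "Lnorm \<Omega> (ereal r) (weak_gradient \<Omega> v) powr r = (LINT x|M. norm (grad v x) powr r)"
    unfolding Lnorm_weak_gradient[OF open_\<Omega> test_has_weak_gradient[OF v(1)]] by (rule Lnorm_ereal_powr[OF r])
  also have "\<dots> \<le> (LINT x|M. 1)"
    using test_Lspace(2)[OF v(1) r] v(2) r
    by (intro integral_mono) (auto simp: Lspace_ereal intro: powr_le1)
  finally show ?thesis by (simp add: V_def)
qed

end

text \<open>With B the q-energy of a function and D the excess of its sup-norm term over its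
  p-energy, t is the factor that scales it onto the Nehari set. The product t times B powr (1 / q)
  is the gradient norm of the scaled function in exponent q.\<close>

lemma powr_balance:
  fixes p q B D :: real
  assumes ne: "p \<noteq> q" and B: "B > 0" and D: "D > 0" and t_def: "t = (B / D) powr (1 / (p - q))"
  shows "t > 0" "t powr p * D = t powr q * B" "(t * B powr (1 / q)) powr (p - q) = B powr (1 + (p - q) / q) / D"
proof -
  show t: "t > 0" using B D by (simp add: t_def)
  have pq: "t powr (p - q) = B / D" using ne B D by (simp add: t_def powr_powr)
  have "t powr p = t powr q * t powr (p - q)" by (simp add: powr_add[symmetric])
  then show "t powr p * D = t powr q * B" using D by (simp only: pq) simp
  show "(t * B powr (1 / q)) powr (p - q) = B powr (1 + (p - q) / q) / D"
    using B by (simp add: powr_mult pq powr_powr powr_add)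
qed

context bounded_open begin

text \<open>In both cases \<open>b = Lnorm \<Omega> q (weak_gradient \<Omega> u)\<close> is compared with its value at the
  multiple of \<open>v\<close> lying on the Nehari set; for \<open>p < q\<close> the minimizer lies on this set because
  the energy is stationary along the ray through it.\<close>

lemma least_energy_estimates:
  assumes sol: "least_energy_solution \<Omega> p q lam u" and lam: "lam > 0"
    and pq: "2 * real DIM('a) \<le> p" "2 * real DIM('a) \<le> q"
    and v: "v \<in> test_functions \<Omega>" "\<forall>x. norm (grad v x) \<le> 1" and x0: "x0 \<in> \<Omega>" "0 < m" "m \<le> v x0"
    and large: "V < lam * m powr p"
  defines "b \<equiv> Lnorm \<Omega> (ereal q) (weak_gradient \<Omega> u)"
  shows "b > 0" "b powr q \<le> lam * Lnorm \<Omega> \<infinity> u powr p"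
    "b powr (p - q) * (lam * m powr p - V) \<le> V powr (p / q)" "u \<in> Xpq \<Omega> p q"
proof -
  have "DIM('a) \<ge> 1" by (simp add: Suc_leI)
  then have pq0: "p > 0" "q > 0" using pq by linarith+
  define Mx where "Mx = Lnorm \<Omega> \<infinity> u"
  define A where "A = Lnorm \<Omega> (ereal p) (weak_gradient \<Omega> u) powr p"
  define B where "B = b powr q"
  have AB: "A \<ge> 0" "B \<ge> 0" "b \<ge> 0" by (auto simp: A_def B_def b_def Lnorm_ereal_nonneg)
  define Av where "Av = Lnorm \<Omega> (ereal p) (weak_gradient \<Omega> v) powr p"
  define Bv where "Bv = Lnorm \<Omega> (ereal q) (weak_gradient \<Omega> v) powr q"
  define Mv where "Mv = Lnorm \<Omega> \<infinity> v"
  obtain C where C: "C > 0" "\<forall>p q u. 2 * real DIM('a) \<le> p \<longrightarrow> 2 * real DIM('a) \<le> q \<longrightarrow> u \<in> Xpq \<Omega> p q \<longrightarrow>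
    (\<forall>x\<in>closure \<Omega>. \<forall>y\<in>closure \<Omega>.
      \<bar>u x - u y\<bar> \<le> C * sqrt (dist x y) * Lnorm \<Omega> (ereal q) (weak_gradient \<Omega> u) \<and>
      \<bar>u x\<bar> \<le> C * Lnorm \<Omega> (ereal q) (weak_gradient \<Omega> u))"
    using Xpq_Morrey by blast
  have maxpos: "max p q > 0" using pq0 by simp
  have vX: "v \<in> Xpq \<Omega> p q" by (rule test_Xpq[OF v(1) maxpos])
  have uX: "u \<in> Xpq \<Omega> p q" using sol by (auto simp: least_energy_solution_def Nehari_def)
  then show "u \<in> Xpq \<Omega> p q" .
  have cu: "continuous_on (closure \<Omega>) u" using uX by (simp add: Xpq_def)
  have Mx0: "Mx \<ge> 0" unfolding Mx_def by (rule continuous_Linf(2)[OF cu])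
  have MxC: "Mx \<le> C * b"
    unfolding Mx_def b_def using C(2) pq uX closure_subset by (intro continuous_Linf(4)[OF cu]) blast
  have x0c: "x0 \<in> closure \<Omega>" using x0(1) closure_subset by blast
  have mMv: "m \<le> Mv"
    using continuous_Linf(3)[OF smooth_continuous_on[OF test_smooth[OF v(1)]] x0c] x0 by (simp add: Mv_def)
  have AvV: "Av \<le> V" "Bv \<le> V" unfolding Av_def Bv_def by (rule Lnorm_grad_bound_1[OF v pq0(1)], rule Lnorm_grad_bound_1[OF v pq0(2)])
  \<comment> \<open>By Morrey's bound a function with positive value at \<open>x0\<close> cannot
    have zero gradient norm.\<close>
  have Bv: "Bv > 0"
  proof -
    have "\<bar>v x0\<bar> \<le> C * Lnorm \<Omega> (ereal q) (weak_gradient \<Omega> v)" using C(2) pq vX x0c by blast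
    then have "0 < C * Lnorm \<Omega> (ereal q) (weak_gradient \<Omega> v)" using x0 by linarith
    then have "0 < Lnorm \<Omega> (ereal q) (weak_gradient \<Omega> v)" using C(1) by (simp add: zero_less_mult_iff)
    then show ?thesis by (simp add: Bv_def)
  qed
  \<comment> \<open>The multiple s v satisfies the Nehari identity exactly when s powr q times Bv
    equals s powr p times D; so D must be positive, which \<open>large\<close> ensures.\<close>
  define D where "D = lam * Mv powr p - Av"
  have Dge: "lam * m powr p - V \<le> D"
  proof -
    have "m powr p \<le> Mv powr p" using mMv x0 pq0 by (intro powr_mono2) auto
    then have "lam * m powr p \<le> lam * Mv powr p" using lam by (intro mult_left_mono) auto
    then show ?thesis using AvV by (simp add: D_def)
  qed
  then have D: "D > 0" using large by linarith
  have ne: "p \<noteq> q" using sol by (auto simp: least_energy_solution_def)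
  define t where "t = (Bv / D) powr (1 / (p - q))"
  note t = powr_balance[OF ne Bv D t_def]
  define \<beta> where "\<beta> = t * Bv powr (1 / q)"
  have \<beta>: "\<beta> > 0" using t Bv by (simp add: \<beta>_def)
  have \<beta>q: "\<beta> powr q = t powr q * Bv" using t(1) Bv pq0 by (simp add: \<beta>_def powr_mult powr_powr)
  have \<beta>pq: "\<beta> powr (p - q) * D = Bv powr (p / q)"
  proof -
    have "1 + (p - q) / q = p / q" using pq0 by (simp add: field_simps)
    then show ?thesis using t(3) D by (simp add: \<beta>_def)
  qed
  let ?w = "\<lambda>x. t * v x"
  have w: "?w \<in> Xpq \<Omega> p q"
    "Lnorm \<Omega> (ereal p) (weak_gradient \<Omega> ?w) powr p = t powr p * Av"
    "Lnorm \<Omega> (ereal q) (weak_gradient \<Omega> ?w) powr q = \<beta> powr q"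
    "Lnorm \<Omega> \<infinity> ?w powr p = t powr p * Mv powr p"
    using Xpq_cmult[OF vX maxpos, of t] Xpq_cmult(2)[OF vX maxpos pq0(1), of t] Xpq_cmult(2)[OF vX maxpos pq0(2), of t] t(1)
    by (simp_all add: powr_mult Av_def Bv_def Mv_def \<beta>q)
  have wN: "t powr p * Av + \<beta> powr q = lam * (t powr p * Mv powr p)"
    using t(2) unfolding \<beta>q D_def by (simp add: algebra_simps)
  \<comment> \<open>On the Nehari set the energy depends only on the gradient norm of exponent q, so
    comparing energies compares these norms.\<close>
  have Jw: "J \<Omega> p q lam ?w = (1 / q - 1 / p) * \<beta> powr q"
  proof -
    have "J \<Omega> p q lam ?w = 1 / p * (t powr p * Av - lam * (t powr p * Mv powr p)) + 1 / q * \<beta> powr q"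
      unfolding J_def w(2-4) by (simp add: algebra_simps diff_divide_distrib)
    also have "t powr p * Av - lam * (t powr p * Mv powr p) = - (\<beta> powr q)" using wN by linarith
    finally show ?thesis by (simp add: algebra_simps)
  qed
  have Ju: "J \<Omega> p q lam u = 1 / p * (A - lam * Mx powr p) + 1 / q * B"
    unfolding J_def A_def B_def b_def Mx_def by (simp add: algebra_simps diff_divide_distrib)
  have "A + B = lam * Mx powr p \<and> Mx > 0 \<and> b powr (p - q) \<le> \<beta> powr (p - q)"
  proof (cases "p < q")
    case True
    then have min: "J \<Omega> p q lam u \<le> J \<Omega> p q lam z" if "z \<in> Xpq \<Omega> p q" for z
      using sol that by (auto simp: least_energy_solution_def)
    have neg: "1 / q - 1 / p < 0" using True pq0 by (simp add: field_simps)
    \<comment> \<open>Negative energy excludes that the minimizer vanishes identically.\<close>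
    have "J \<Omega> p q lam u < 0"
      using min[OF w(1)] mult_neg_pos[OF neg, of "\<beta> powr q"] \<beta> unfolding Jw by simp
    moreover have "0 \<le> 1 / p * A + 1 / q * B" using AB pq0 by (intro add_nonneg_nonneg mult_nonneg_nonneg) auto
    ultimately have "Mx \<noteq> 0" using pq0 unfolding Ju by (intro notI) simp
    then have Mx: "Mx > 0" using Mx0 by simp
    \<comment> \<open>The derivative of the energy of s u at s = 1, left unsimplified as the
      differentiation rules produce it. The minimum over the whole space makes it vanish, which is
      the Nehari identity.\<close>
    have "(1 / p * (p * 1 powr (p - 1)) * (A - lam * Mx powr p) + 1 / q * (q * 1 powr (q - 1)) * B) = 0"
    proof (rule DERIV_local_min)
      show "((\<lambda>s. 1 / p * s powr p * (A - lam * Mx powr p) + 1 / q * s powr q * B) has_real_derivative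
        (1 / p * (p * 1 powr (p - 1)) * (A - lam * Mx powr p) + 1 / q * (q * 1 powr (q - 1)) * B)) (at 1)"
        by (intro DERIV_add DERIV_cmult DERIV_cmult_right has_real_derivative_powr) auto
      show "(0::real) < 1" by simp
      show "\<forall>s. \<bar>1 - s\<bar> < 1 \<longrightarrow> 1 / p * 1 powr p * (A - lam * Mx powr p) + 1 / q * 1 powr q * B
          \<le> 1 / p * s powr p * (A - lam * Mx powr p) + 1 / q * s powr q * B"
      proof (intro allI impI)
        fix s :: real assume "\<bar>1 - s\<bar> < 1"
        then have s: "s > 0" by linarith
        let ?z = "\<lambda>x. s * u x"
        have z: "?z \<in> Xpq \<Omega> p q"
          "Lnorm \<Omega> (ereal p) (weak_gradient \<Omega> ?z) powr p = s powr p * A"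
          "Lnorm \<Omega> (ereal q) (weak_gradient \<Omega> ?z) powr q = s powr q * B"
          "Lnorm \<Omega> \<infinity> ?z powr p = s powr p * Mx powr p"
          using Xpq_cmult[OF uX maxpos, of s] Xpq_cmult(2)[OF uX maxpos pq0(1), of s] Xpq_cmult(2)[OF uX maxpos pq0(2), of s] s
          by (simp_all add: powr_mult A_def B_def b_def Mx_def)
        have "J \<Omega> p q lam ?z = 1 / p * s powr p * (A - lam * Mx powr p) + 1 / q * s powr q * B"
          unfolding J_def z(2-4) by (simp add: algebra_simps diff_divide_distrib)
        then show "1 / p * 1 powr p * (A - lam * Mx powr p) + 1 / q * 1 powr q * B
          \<le> 1 / p * s powr p * (A - lam * Mx powr p) + 1 / q * s powr q * B"
          using min[OF z(1)] unfolding Ju by simp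
      qed
    qed
    then have id: "A + B = lam * Mx powr p" using pq0 by simp
    have "J \<Omega> p q lam u = (1 / q - 1 / p) * B"
    proof -
      have h: "A - lam * Mx powr p = - B" using id by linarith
      show ?thesis unfolding Ju h by (simp add: algebra_simps)
    qed
    then have "(1 / q - 1 / p) * B \<le> (1 / q - 1 / p) * \<beta> powr q" using min[OF w(1)] Jw by simp
    then have "\<beta> powr q \<le> b powr q" using neg unfolding B_def by (simp only: mult_le_cancel_left_neg)
    then have "\<beta> \<le> b" using pq0 AB \<beta> by (meson not_le powr_less_mono2)
    \<comment> \<open>Here b >= \<beta>, but the exponent is negative; in the other case b <=
      \<beta> and it is positive. Stated with p - q the two cases agree.\<close>
    then have "b powr (p - q) \<le> \<beta> powr (p - q)" using True \<beta> by (intro powr_mono2') auto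
    then show ?thesis using id Mx by blast
  next
    case False
    then have qp: "q < p" using ne by simp
    then have uN: "u \<in> Nehari \<Omega> p q lam" and min: "\<And>z. z \<in> Nehari \<Omega> p q lam \<Longrightarrow> J \<Omega> p q lam u \<le> J \<Omega> p q lam z"
      using sol by (auto simp: least_energy_solution_def)
    have id: "A + B = lam * Mx powr p" using uN by (simp add: Nehari_def A_def B_def b_def Mx_def)
    obtain y where y: "y \<in> \<Omega>" "u y \<noteq> 0" using uN by (auto simp: Nehari_def)
    then have "\<bar>u y\<bar> \<le> Mx" unfolding Mx_def using closure_subset by (intro continuous_Linf(3)[OF cu]) blast
    then have Mx: "Mx > 0" using y by linarith
    have "?w \<in> Nehari \<Omega> p q lam"
      unfolding Nehari_def using w wN t(1) x0 by (auto intro!: bexI[of _ x0])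
    then have "J \<Omega> p q lam u \<le> (1 / q - 1 / p) * \<beta> powr q" using min Jw by metis
    moreover have "J \<Omega> p q lam u = (1 / q - 1 / p) * B"
    proof -
      have h: "A - lam * Mx powr p = - B" using id by linarith
      show ?thesis unfolding Ju h by (simp add: algebra_simps)
    qed
    moreover have pos: "1 / q - 1 / p > 0" using qp pq0 by (simp add: field_simps)
    ultimately have "b powr q \<le> \<beta> powr q" unfolding B_def by (simp only: mult_le_cancel_left_pos)
    then have "b \<le> \<beta>" using pq0 AB \<beta> by (meson not_le powr_less_mono2 less_imp_le)
    then have "b powr (p - q) \<le> \<beta> powr (p - q)" using qp AB by (intro powr_mono2) auto
    then show ?thesis using id Mx by blast
  qed
  then have id: "A + B = lam * Mx powr p" and Mx: "Mx > 0" and bb: "b powr (p - q) \<le> \<beta> powr (p - q)" by auto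
  have "0 < C * b" using Mx MxC by linarith
  then show "b > 0" using C(1) by (simp add: zero_less_mult_iff)
  show "b powr q \<le> lam * Lnorm \<Omega> \<infinity> u powr p" using id AB by (simp add: B_def Mx_def)
  have "b powr (p - q) * (lam * m powr p - V) \<le> \<beta> powr (p - q) * D"
    using bb Dge large by (intro mult_mono) auto
  also have "\<dots> \<le> V powr (p / q)" unfolding \<beta>pq using AvV Bv pq0 by (intro powr_mono2) auto
  finally show "b powr (p - q) * (lam * m powr p - V) \<le> V powr (p / q)" .
qed

end

section \<open>Passage to the limit\<close>

text \<open>With y = L / \<Lambda> and z = L K the hypotheses read G powr Q <= z / y, z <= G and G
  powr (1 - Q) <= y. For Q < 1 the third bounds G, and the first two give z powr Q <= z / y. For Q >
  1 the first two give y <= G powr (1 - Q), so the third is an equality: G is determined and at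
  least 1, and then z >= y G powr Q = G >= 1.\<close>

lemma limit_exponent_estimates:
  fixes Q L \<Lambda> G K :: real
  assumes Q: "0 < Q" "Q \<noteq> 1" and L: "0 < L" "L < \<Lambda>" and G: "0 < G"
    and GK: "G powr Q \<le> \<Lambda> * K" and KG: "L * K \<le> G" and up: "G powr (1 - Q) \<le> L / \<Lambda>"
  shows "G \<le> (L / \<Lambda>) powr (1 / (1 - Q))"
    and "(if Q < 1 then inverse L * (L / \<Lambda>) powr (1 / (1 - Q)) else inverse L) \<le> K"
proof -
  define y where "y = L / \<Lambda>"
  have y: "0 < y" "y \<le> 1" using L by (auto simp: y_def)
  define e where "e = 1 / (1 - Q)"
  have pe: "(z powr (1 - Q)) powr e = z" if "z > 0" for z using that Q by (simp add: e_def powr_powr)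
  have "0 < \<Lambda> * K" using GK G by (smt (verit) powr_gt_zero)
  then have K: "K > 0" using L by (simp add: zero_less_mult_iff)
  define z where "z = L * K"
  have z: "z > 0" using K L by (simp add: z_def)
  have \<Lambda>K: "\<Lambda> * K = z / y" using L by (simp add: z_def y_def)
  have "G \<le> y powr e \<and> (if Q < 1 then y powr e else 1) \<le> z"
  proof (cases "Q < 1")
    case True
    then have e: "e > 0" by (simp add: e_def)
    have "(G powr (1 - Q)) powr e \<le> y powr e" using up e by (intro powr_mono2) (auto simp: y_def)
    then have 1: "G \<le> y powr e" using pe[OF G] by simp
    have "z powr Q \<le> G powr Q" using KG z Q by (intro powr_mono2) (auto simp: z_def)
    then have "z powr Q \<le> z / y" using GK \<Lambda>K by linarith
    moreover have "z = z powr Q * z powr (1 - Q)" using z by (simp add: powr_add[symmetric])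
    ultimately have "z powr Q * y \<le> z powr Q * z powr (1 - Q)" using y by (simp add: field_simps)
    then have "y \<le> z powr (1 - Q)" using z by simp
    then have "y powr e \<le> (z powr (1 - Q)) powr e" using y e by (intro powr_mono2) auto
    then show ?thesis using 1 True pe[OF z] by simp
  next
    case False
    then have e: "e < 0" using Q by (simp add: e_def)
    have GG: "G powr (1 - Q) * G powr Q = G" using G by (simp add: powr_add[symmetric])
    have "G powr Q \<le> z / y" using GK \<Lambda>K by simp
    also have "\<dots> \<le> G / y" using KG y by (intro divide_right_mono) (auto simp: z_def)
    finally have "y * G powr Q \<le> G powr (1 - Q) * G powr Q" using y GG by (simp add: field_simps)
    then have "y \<le> G powr (1 - Q)" using G by simp
    then have eq: "G powr (1 - Q) = y" using up by (simp add: y_def)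
    then have Ge: "G = y powr e" using pe[OF G] by simp
    have "1 powr e \<le> y powr e" using e y by (intro powr_mono2') auto
    then have "1 \<le> G" using Ge by simp
    also have "G = y * G powr Q" using GG eq by simp
    also have "\<dots> \<le> y * (z / y)" using GK \<Lambda>K y by (intro mult_left_mono) auto
    finally have "1 \<le> z" using y by simp
    then show ?thesis using Ge False by simp
  qed
  then have 1: "G \<le> y powr e" and 2: "(if Q < 1 then y powr e else 1) \<le> L * K" by (auto simp: z_def)
  show "G \<le> (L / \<Lambda>) powr (1 / (1 - Q))" using 1 by (simp add: y_def e_def)
  have "inverse L * (if Q < 1 then y powr e else 1) \<le> inverse L * (L * K)"
    using 2 L by (intro mult_left_mono) auto
  then have "inverse L * (if Q < 1 then y powr e else 1) \<le> K" using L by (simp add: mult.assoc[symmetric])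
  then show "(if Q < 1 then inverse L * (L / \<Lambda>) powr (1 / (1 - Q)) else inverse L) \<le> K"
    by (simp add: y_def e_def split: if_splits)
qed

text \<open>Comparison with the powers of a fixed base halfway between 1 and the limit. It is
  applied to the base (lam p) powr (1 / p) times m, where \<Lambda> m > 1.\<close>

lemma eventually_powr_large:
  fixes l :: "real \<Rightarrow> real"
  assumes l: "(l \<longlongrightarrow> a) at_top" and a: "1 < a"
  shows "\<forall>\<^sub>F p in at_top. K \<le> l p powr p"
proof -
  define \<rho> where "\<rho> = (1 + a) / 2"
  have \<rho>: "1 < \<rho>" "\<rho> < a" using a by (auto simp: \<rho>_def)
  have "filterlim (\<lambda>p. p * ln \<rho>) at_top at_top"
    using \<rho> by (intro filterlim_at_top_mult_tendsto_pos[OF tendsto_const] filterlim_ident) auto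
  then have "filterlim (\<lambda>p. exp (p * ln \<rho>)) at_top at_top" by (rule filterlim_compose[OF exp_at_top])
  then have "\<forall>\<^sub>F p in at_top. K \<le> exp (p * ln \<rho>)" by (simp add: filterlim_at_top)
  with order_tendstoD(1)[OF l \<rho>(2)] eventually_gt_at_top[of 0]
  show ?thesis
  proof eventually_elim
    fix p assume p: "\<rho> < l p" "0 < p" "K \<le> exp (p * ln \<rho>)"
    have "exp (p * ln \<rho>) = \<rho> powr p" using \<rho> by (simp add: powr_def)
    also have "\<dots> \<le> l p powr p" using p \<rho> by (intro powr_mono2) auto
    finally show "K \<le> l p powr p" using p by linarith
  qed
qed

context bounded_open begin

text \<open>Lower semicontinuity for growing exponents: for any G' > G, some \<open>un k\<close> is
  uniformly close to U, has exponent at least n + 2 and normalized gradient norm below G', and so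
  has some test function near it. Monotonicity of normalized norms bounds all its moments up to n +
  2, as the compactness result requires.\<close>

lemma Linf_weak_gradient_limit:
  fixes pn qn :: "nat \<Rightarrow> real" and un :: "nat \<Rightarrow> 'a \<Rightarrow> real"
  assumes pq: "\<And>n. 2 * real DIM('a) \<le> pn n" "\<And>n. 2 * real DIM('a) \<le> qn n"
    and u: "\<And>n. un n \<in> Xpq \<Omega> (pn n) (qn n)"
    and q: "filterlim qn at_top sequentially"
    and ul: "uniform_limit (closure \<Omega>) un U sequentially"
    and b: "(\<lambda>n. Lnorm \<Omega> (ereal (qn n)) (weak_gradient \<Omega> (un n))) \<longlonglongrightarrow> G"
  shows "U \<in> W1 \<Omega> \<infinity>" "Lnorm \<Omega> \<infinity> (weak_gradient \<Omega> U) \<le> G"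
proof -
  have "DIM('a) \<ge> 1" by (simp add: Suc_leI)
  then have N1: "2 * real DIM('a) \<ge> 1" by linarith
  have cu: "continuous_on (closure \<Omega>) (un n)" for n using u[of n] by (simp add: Xpq_def)
  have cU: "continuous_on (closure \<Omega>) U"
    by (rule uniform_limit_theorem[OF always_eventually[OF allI[OF cu]] ul]) simp
  have G0: "0 \<le> G" by (rule LIMSEQ_le_const[OF b]) (use Lnorm_ereal_nonneg in blast)
  have "(\<lambda>n. V powr (1 / qn n)) \<longlonglongrightarrow> V powr 0"
    using V_pos tendsto_divide_0[OF tendsto_const filterlim_at_top_imp_at_infinity[OF q], of 1]
    by (intro tendsto_powr tendsto_const) auto
  then have bV: "(\<lambda>n. Lnorm \<Omega> (ereal (qn n)) (weak_gradient \<Omega> (un n)) / V powr (1 / qn n)) \<longlonglongrightarrow> G / 1"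
    using V_pos by (intro tendsto_divide b) auto
  have *: "\<exists>f. has_weak_gradient \<Omega> U f \<and> (AE x in M. norm (f x) \<le> G')" if G': "G < G'" for G'
  proof (rule weak_gradient_of_uniform_limit[OF cU])
    show "0 \<le> G'" using G0 G' by linarith
    fix n :: nat
    \<comment> \<open>Two errors of this size, from U to \<open>un k\<close> and from there to a
      test function, add up to 1 / (n + 1).\<close>
    define e where "e = 1 / (2 * real (Suc n))"
    have e: "e > 0" by (simp add: e_def)
    have "\<forall>\<^sub>F k in sequentially. real (n + 2) \<le> qn k" using q by (simp add: filterlim_at_top)
    moreover have "\<forall>\<^sub>F k in sequentially. \<forall>x\<in>closure \<Omega>. dist (un k x) (U x) < e" by (rule uniform_limitD[OF ul e])
    moreover have "\<forall>\<^sub>F k in sequentially. Lnorm \<Omega> (ereal (qn k)) (weak_gradient \<Omega> (un k)) / V powr (1 / qn k) < G'"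
      using order_tendstoD(2)[OF bV] G' by simp
    ultimately have "\<forall>\<^sub>F k in sequentially. real (n + 2) \<le> qn k \<and> (\<forall>x\<in>closure \<Omega>. dist (un k x) (U x) < e) \<and>
        Lnorm \<Omega> (ereal (qn k)) (weak_gradient \<Omega> (un k)) / V powr (1 / qn k) < G'"
      by eventually_elim blast
    then obtain k where k: "real (n + 2) \<le> qn k" "\<forall>x\<in>closure \<Omega>. dist (un k x) (U x) < e"
        "Lnorm \<Omega> (ereal (qn k)) (weak_gradient \<Omega> (un k)) / V powr (1 / qn k) < G'"
      using eventually_happens'[OF trivial_limit_sequentially] by blast
    have s: "2 * real DIM('a) \<le> max (pn k) (qn k)" using pq(1)[of k] by simp
    have W: "un k \<in> W01 \<Omega> (ereal (max (pn k) (qn k)))" using u[of k] unfolding Xpq_def by blast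
    obtain \<phi> where \<phi>: "\<And>j. \<phi> j \<in> test_functions \<Omega>" and ul\<phi>: "uniform_limit (closure \<Omega>) \<phi> (un k) sequentially"
      and lr: "\<And>r. 1 \<le> r \<Longrightarrow> r \<le> max (pn k) (qn k) \<Longrightarrow> (\<lambda>j. Lnorm \<Omega> (ereal r) (grad (\<phi> j))) \<longlonglongrightarrow> Lnorm \<Omega> (ereal r) (weak_gradient \<Omega> (un k))"
      by (rule W01_approximation[OF s W cu]) (rule that)
    have "(\<lambda>j. Lnorm \<Omega> (ereal (qn k)) (grad (\<phi> j)) / V powr (1 / qn k)) \<longlonglongrightarrow> Lnorm \<Omega> (ereal (qn k)) (weak_gradient \<Omega> (un k)) / V powr (1 / qn k)"
      using N1 pq(2)[of k] V_pos by (intro tendsto_divide lr tendsto_const) auto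
    from order_tendstoD(2)[OF this k(3)] uniform_limitD[OF ul\<phi> e]
    have "\<forall>\<^sub>F j in sequentially. Lnorm \<Omega> (ereal (qn k)) (grad (\<phi> j)) / V powr (1 / qn k) < G' \<and> (\<forall>x\<in>closure \<Omega>. dist (\<phi> j x) (un k x) < e)"
      by eventually_elim blast
    then obtain j where j: "Lnorm \<Omega> (ereal (qn k)) (grad (\<phi> j)) / V powr (1 / qn k) < G'" "\<forall>x\<in>closure \<Omega>. dist (\<phi> j x) (un k x) < e"
      using eventually_happens'[OF trivial_limit_sequentially] by blast
    show "\<exists>\<psi>\<in>test_functions \<Omega>. (\<forall>x\<in>closure \<Omega>. \<bar>\<psi> x - U x\<bar> \<le> 1 / real (Suc n)) \<and>
      (\<forall>m\<in>{2..n+2}. (LINT x|M. norm (grad \<psi> x) powr real m) \<le> V * G' powr real m)"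
    proof (intro bexI[OF _ \<phi>[of j]] conjI ballI)
      fix x assume x: "x \<in> closure \<Omega>"
      have "\<bar>\<phi> j x - U x\<bar> \<le> dist (\<phi> j x) (un k x) + dist (un k x) (U x)" by (simp add: dist_real_def)
      also have "\<dots> \<le> e + e" using j(2) k(2) x by (intro add_mono) (auto intro: less_imp_le)
      also have "\<dots> = 1 / real (Suc n)" by (simp add: e_def field_simps)
      finally show "\<bar>\<phi> j x - U x\<bar> \<le> 1 / real (Suc n)" .
    next
      fix m assume m: "m \<in> {2..n+2}"
      then have m0: "0 < real m" "real m \<le> qn k" using k(1) by auto
      have q0: "0 < qn k" using m0 by linarith
      have "Lnorm \<Omega> (ereal (real m)) (grad (\<phi> j)) / V powr (1 / real m) \<le> Lnorm \<Omega> (ereal (qn k)) (grad (\<phi> j)) / V powr (1 / qn k)"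
        by (rule Lnorm_mono[OF m0 test_Lspace(2)[OF \<phi> q0]])
      then have "Lnorm \<Omega> (ereal (real m)) (grad (\<phi> j)) / V powr (1 / real m) \<le> G'" using j(1) by linarith
      then have "Lnorm \<Omega> (ereal (real m)) (grad (\<phi> j)) \<le> G' * V powr (1 / real m)" using V_pos by (simp add: divide_le_eq)
      then have "Lnorm \<Omega> (ereal (real m)) (grad (\<phi> j)) powr real m \<le> (G' * V powr (1 / real m)) powr real m"
        using m0 by (intro powr_mono2 Lnorm_ereal_nonneg) auto
      also have "\<dots> = V * G' powr real m" using m0 V_pos by (simp add: powr_mult powr_powr)
      finally show "(LINT x|M. norm (grad (\<phi> j) x) powr real m) \<le> V * G' powr real m"
        unfolding Lnorm_ereal_powr[OF m0(1)] .
    qed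
  qed
  have le: "Lnorm \<Omega> \<infinity> (weak_gradient \<Omega> U) \<le> G' \<and> U \<in> W1 \<Omega> \<infinity>" if G': "G < G'" for G'
  proof -
    obtain f where f: "has_weak_gradient \<Omega> U f" "AE x in M. norm (f x) \<le> G'" using *[OF G'] by blast
    note B = Linf_bounds[OF weak_gradient_measurable[OF open_\<Omega> f(1)] f(2)]
    have "U \<in> W1 \<Omega> \<infinity>" using B(1) f(1) continuous_Linf(1)[OF cU] by (auto simp: W1_def)
    then show ?thesis using B(3) Lnorm_weak_gradient[OF open_\<Omega> f(1)] by simp
  qed
  show "U \<in> W1 \<Omega> \<infinity>" using le[of "G + 1"] by simp
  show "Lnorm \<Omega> \<infinity> (weak_gradient \<Omega> U) \<le> G" by (rule dense_ge) (rule le[THEN conjunct1])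
qed

end

section \<open>The convergence theorem\<close>

theorem theorem4p3:
  fixes \<Omega> :: "'a::euclidean_space set"
    and q lam :: "real \<Rightarrow> real"
    and Q \<Lambda> :: real
    and u :: "real \<Rightarrow> 'a \<Rightarrow> real"
    and x :: "real \<Rightarrow> 'a"
  assumes N: "DIM('a) \<ge> 2"
    and dom: "smooth_bounded_domain \<Omega>"
    and q_lim: "((\<lambda>p. q p / p) \<longlongrightarrow> Q) at_top"
    and Q_cases:
      "(0 < Q \<and> Q < 1 \<and> (\<forall>\<^sub>F p in at_top. real DIM('a) < q p \<and> q p < p)) \<or>
       (1 < Q \<and> (\<forall>\<^sub>F p in at_top. real DIM('a) < p \<and> p < q p))"
    and Lam: "\<Lambda> > Lambda_inf \<Omega>"
    and lam_pos: "\<forall>\<^sub>F p in at_top. lam p > 0"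
    and lam_lim: "((\<lambda>p. lam p powr (1 / p)) \<longlongrightarrow> \<Lambda>) at_top"
    and u_sol: "\<forall>\<^sub>F p in at_top. least_energy_solution \<Omega> p (q p) (lam p) (u p)"
    and u_nonneg: "\<forall>\<^sub>F p in at_top. \<forall>y\<in>closure \<Omega>. u p y \<ge> 0"
    and x_max: "\<forall>\<^sub>F p in at_top. max_points \<Omega> (u p) = {x p}"
  shows "\<exists>(P :: nat \<Rightarrow> real) x\<Lambda> u\<Lambda>.
      filterlim P at_top sequentially \<and>
      x\<Lambda> \<in> \<Omega> \<and>
      u\<Lambda> \<in> W1 \<Omega> \<infinity> \<inter> C0 \<Omega> \<and>
      (\<lambda>n. x (P n)) \<longlonglongrightarrow> x\<Lambda> \<and>
      uniform_limit (closure \<Omega>) (\<lambda>n. u (P n)) u\<Lambda> sequentially \<and>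
      Lnorm \<Omega> \<infinity> (weak_gradient \<Omega> u\<Lambda>) \<le> (Lambda_inf \<Omega> / \<Lambda>) powr (1 / (1 - Q)) \<and>
      u\<Lambda> x\<Lambda> = Lnorm \<Omega> \<infinity> u\<Lambda> \<and>
      Lnorm \<Omega> \<infinity> u\<Lambda> \<ge>
        (if Q < 1 then inverse (Lambda_inf \<Omega>) * (Lambda_inf \<Omega> / \<Lambda>) powr (1 / (1 - Q))
         else inverse (Lambda_inf \<Omega>))"
proof -
  interpret bounded_open \<Omega> using dom by unfold_locales (auto simp: smooth_bounded_domain_def)
  have Q: "Q > 0" "Q \<noteq> 1" using Q_cases by auto
  let ?L = "Lambda_inf \<Omega>"
  let ?N = "2 * real DIM('a)"
  define \<theta> where "\<theta> p = q p / p" for p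
  define rl where "rl p = lam p powr (1 / p)" for p
  define b where "b p = Lnorm \<Omega> (ereal (q p)) (weak_gradient \<Omega> (u p))" for p
  obtain R x0 where R: "R > 0" and x0: "x0 \<in> \<Omega>" and ball: "ball x0 R \<subseteq> \<Omega>" and RL: "1 / R \<le> ?L"
    and Lmin: "\<forall>u. u \<in> W1 \<Omega> \<infinity> \<longrightarrow> u \<in> C0 \<Omega> \<longrightarrow> ?L * Lnorm \<Omega> \<infinity> u \<le> Lnorm \<Omega> \<infinity> (weak_gradient \<Omega> u)"
    by (rule Lambda_inf_properties) (rule that)
  have "0 < 1 / R" using R by simp
  then have L0: "?L > 0" using RL by linarith
  then have \<Lambda>: "\<Lambda> > 0" "1 / R < \<Lambda>" using Lam RL by linarith+
  obtain C where C: "C > 0" "\<forall>p q u. ?N \<le> p \<longrightarrow> ?N \<le> q \<longrightarrow> u \<in> Xpq \<Omega> p q \<longrightarrow>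
    (\<forall>x\<in>closure \<Omega>. \<forall>y\<in>closure \<Omega>.
      \<bar>u x - u y\<bar> \<le> C * sqrt (dist x y) * Lnorm \<Omega> (ereal q) (weak_gradient \<Omega> u) \<and>
      \<bar>u x\<bar> \<le> C * Lnorm \<Omega> (ereal q) (weak_gradient \<Omega> u))"
    using Xpq_Morrey by blast
  have \<theta>_lim: "(\<theta> \<longlongrightarrow> Q) at_top" using q_lim by (simp add: \<theta>_def [abs_def])
  have rl_lim: "(rl \<longlongrightarrow> \<Lambda>) at_top" using lam_lim by (simp add: rl_def [abs_def])
  have q_at_top: "filterlim q at_top at_top"
  proof -
    have "filterlim (\<lambda>p. \<theta> p * p) at_top at_top"
      by (rule filterlim_tendsto_pos_mult_at_top[OF \<theta>_lim Q(1) filterlim_ident])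
    moreover have "\<forall>\<^sub>F p in at_top. \<theta> p * p = q p"
      using eventually_gt_at_top[of 0] by eventually_elim (simp add: \<theta>_def)
    ultimately show ?thesis using filterlim_cong[OF refl refl] by fast
  qed
  have q_large: "\<forall>\<^sub>F p in at_top. ?N \<le> q p" using q_at_top by (simp add: filterlim_at_top)
  have neq: "\<forall>\<^sub>F p in at_top. q p \<noteq> p"
    using Q_cases by (auto elim: eventually_mono)
  \<comment> \<open>The factor 2 makes lam m^p - V at least half of lam m^p; it is lost in the limit
    because 2 powr (1 / p) tends to 1.\<close>
  have large: "\<forall>\<^sub>F p in at_top. 2 * V \<le> lam p * m powr p" if m: "0 < m" "1 < \<Lambda> * m" for m
  proof -
    have "((\<lambda>p. rl p * m) \<longlongrightarrow> \<Lambda> * m) at_top" by (intro tendsto_mult rl_lim tendsto_const)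
    from eventually_powr_large[OF this m(2), of "2 * V"] lam_pos eventually_gt_at_top[of 0]
    show ?thesis
    proof eventually_elim
      fix p assume p: "2 * V \<le> (rl p * m) powr p" "0 < lam p" "0 < p"
      have "(rl p * m) powr p = lam p * m powr p" using p m by (simp add: rl_def powr_mult powr_powr)
      then show "2 * V \<le> lam p * m powr p" using p by simp
    qed
  qed
  define y where "y p = b p powr (1 - \<theta> p)" for p
  \<comment> \<open>These are the energy estimates after taking p-th roots. The
    \<open>powr 1\<close> is what remains of \<open>powr p\<close> and disappears once the norm is
    known to be nonnegative.\<close>
  have est: "\<forall>\<^sub>F p in at_top. b p > 0 \<and> u p \<in> Xpq \<Omega> p (q p) \<and> b p powr \<theta> p \<le> rl p * Lnorm \<Omega> \<infinity> (u p) powr 1 \<and>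
      y p \<le> 2 powr (1 / p) * V powr (1 / q p) / (rl p * m)"
    if m: "0 < m" "m < R" "1 < \<Lambda> * m" for m
  proof -
    obtain v where v: "v \<in> test_functions \<Omega>" "\<forall>x. norm (grad v x) \<le> 1" "m < v x0"
      using exists_test_function_grad_le_1[OF ball m(1,2)] by blast
    show ?thesis
      using large[OF m(1,3)] lam_pos u_sol q_large eventually_ge_at_top[of ?N]
    proof eventually_elim
      fix p assume p: "2 * V \<le> lam p * m powr p" "0 < lam p" "least_energy_solution \<Omega> p (q p) (lam p) (u p)" "?N \<le> q p" "?N \<le> p"
      have N0: "?N > 0" by simp
      have pq0: "p > 0" "q p > 0" using p(4,5) N0 by linarith+
      have lg: "V < lam p * m powr p" using p(1) V_pos by linarith
      note E = least_energy_estimates[OF p(3) p(2) p(5) p(4) v(1,2) x0 m(1) less_imp_le[OF v(3)] lg, folded b_def]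
      have Mx: "0 \<le> Lnorm \<Omega> \<infinity> (u p)" using E(4) by (intro continuous_Linf(2)) (simp add: Xpq_def)
      have rlp: "rl p > 0" using p(2) by (simp add: rl_def)
      have "(b p powr q p) powr (1 / p) \<le> (lam p * Lnorm \<Omega> \<infinity> (u p) powr p) powr (1 / p)"
        using E(2) pq0 by (intro powr_mono2) auto
      then have 1: "b p powr \<theta> p \<le> rl p * Lnorm \<Omega> \<infinity> (u p) powr 1"
        using pq0 by (simp add: powr_mult powr_powr \<theta>_def rl_def)
      have "b p powr (p - q p) * (lam p * m powr p / 2) \<le> b p powr (p - q p) * (lam p * m powr p - V)"
        using p(1) by (intro mult_left_mono) auto
      also have "\<dots> \<le> V powr (p / q p)" by (rule E(3))
      finally have "b p powr (p - q p) * (lam p * m powr p) \<le> 2 * V powr (p / q p)" by simp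
      then have "(b p powr (p - q p) * (lam p * m powr p)) powr (1 / p) \<le> (2 * V powr (p / q p)) powr (1 / p)"
        using p(2) pq0 by (intro powr_mono2) auto
      moreover have "(b p powr (p - q p) * (lam p * m powr p)) powr (1 / p) = y p * (rl p * m)"
        using pq0 m by (simp add: powr_mult powr_powr y_def rl_def \<theta>_def diff_divide_distrib)
      moreover have "(2 * V powr (p / q p)) powr (1 / p) = 2 powr (1 / p) * V powr (1 / q p)"
        using pq0 by (simp add: powr_mult powr_powr)
      ultimately have "y p * (rl p * m) \<le> 2 powr (1 / p) * V powr (1 / q p)" by simp
      then have "y p \<le> 2 powr (1 / p) * V powr (1 / q p) / (rl p * m)"
        using rlp m by (simp add: pos_le_divide_eq)
      then show "b p > 0 \<and> u p \<in> Xpq \<Omega> p (q p) \<and> b p powr \<theta> p \<le> rl p * Lnorm \<Omega> \<infinity> (u p) powr 1 \<and>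
        y p \<le> 2 powr (1 / p) * V powr (1 / q p) / (rl p * m)" using E 1 by blast
    qed
  qed
  have up_lim: "((\<lambda>p. 2 powr (1 / p) * V powr (1 / q p) / (rl p * m)) \<longlongrightarrow> 1 / (\<Lambda> * m)) at_top" if m: "0 < m" for m
  proof -
    have "((\<lambda>p. 2 powr (1 / p)) \<longlongrightarrow> 2 powr (0::real)) at_top"
      by (intro tendsto_powr tendsto_const tendsto_divide_0[OF tendsto_const filterlim_at_top_imp_at_infinity[OF filterlim_ident]]) auto
    moreover have "((\<lambda>p. V powr (1 / q p)) \<longlongrightarrow> V powr 0) at_top"
      using V_pos by (intro tendsto_powr tendsto_const tendsto_divide_0[OF tendsto_const filterlim_at_top_imp_at_infinity[OF q_at_top]]) auto
    ultimately have "((\<lambda>p. 2 powr (1 / p) * V powr (1 / q p) / (rl p * m)) \<longlongrightarrow> 2 powr 0 * V powr 0 / (\<Lambda> * m)) at_top"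
      using m \<Lambda> by (intro tendsto_divide tendsto_mult rl_lim tendsto_const) auto
    then show ?thesis using V_pos by simp
  qed
  \<comment> \<open>Admissible heights lie strictly between 1 / \<Lambda> and R, an interval that is
    nonempty because 1 / R <= \<open>Lambda_inf\<close> < \<Lambda>.\<close>
  define m1 where "m1 = (1 / \<Lambda> + R) / 2"
  have "1 / \<Lambda> < R" using \<Lambda> R by (simp add: field_simps)
  then have m1: "1 / \<Lambda> < m1" "m1 < R" by (auto simp: m1_def)
  moreover have "0 < 1 / \<Lambda>" using \<Lambda> by simp
  ultimately have m1pos: "0 < m1" by linarith
  have m1L: "1 < \<Lambda> * m1" using m1(1) \<Lambda> by (simp add: field_simps)
  have "\<forall>\<^sub>F p in at_top. 2 powr (1 / p) * V powr (1 / q p) / (rl p * m1) < 1 / (\<Lambda> * m1) + 1"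
    using order_tendstoD(2)[OF up_lim[OF m1pos]] by simp
  with est[OF m1pos m1(2) m1L] lam_pos q_large eventually_ge_at_top[of ?N] neq u_nonneg x_max
  have "\<forall>\<^sub>F p in at_top. (b p > 0 \<and> u p \<in> Xpq \<Omega> p (q p) \<and> b p powr \<theta> p \<le> rl p * Lnorm \<Omega> \<infinity> (u p) powr 1) \<and>
      y p \<le> 1 / (\<Lambda> * m1) + 1 \<and> lam p > 0 \<and> ?N \<le> q p \<and> ?N \<le> p \<and> q p \<noteq> p \<and> (\<forall>z\<in>closure \<Omega>. u p z \<ge> 0) \<and> max_points \<Omega> (u p) = {x p}"
    by eventually_elim (intro conjI; (blast | linarith))
  then obtain p0 where p0: "\<And>p. p \<ge> p0 \<Longrightarrow> (b p > 0 \<and> u p \<in> Xpq \<Omega> p (q p) \<and> b p powr \<theta> p \<le> rl p * Lnorm \<Omega> \<infinity> (u p) powr 1) \<and>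
      y p \<le> 1 / (\<Lambda> * m1) + 1 \<and> lam p > 0 \<and> ?N \<le> q p \<and> ?N \<le> p \<and> q p \<noteq> p \<and> (\<forall>z\<in>closure \<Omega>. u p z \<ge> 0) \<and> max_points \<Omega> (u p) = {x p}"
    unfolding eventually_at_top_linorder by blast
  define P0 where "P0 n = p0 + real n" for n
  have P0: "filterlim P0 at_top sequentially"
    unfolding P0_def [abs_def] by (rule filterlim_tendsto_add_at_top[OF tendsto_const filterlim_real_sequentially])
  have F: "b (P0 n) > 0" "u (P0 n) \<in> Xpq \<Omega> (P0 n) (q (P0 n))" "b (P0 n) powr \<theta> (P0 n) \<le> rl (P0 n) * Lnorm \<Omega> \<infinity> (u (P0 n))"
    "y (P0 n) \<le> 1 / (\<Lambda> * m1) + 1" "lam (P0 n) > 0" "?N \<le> q (P0 n)" "?N \<le> P0 n" "q (P0 n) \<noteq> P0 n"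
    "\<And>z. z \<in> closure \<Omega> \<Longrightarrow> u (P0 n) z \<ge> 0" "max_points \<Omega> (u (P0 n)) = {x (P0 n)}" for n
  proof -
    have "p0 \<le> P0 n" by (simp add: P0_def)
    note * = p0[OF this]
    then have cX: "continuous_on (closure \<Omega>) (u (P0 n))" by (simp add: Xpq_def)
    show "b (P0 n) powr \<theta> (P0 n) \<le> rl (P0 n) * Lnorm \<Omega> \<infinity> (u (P0 n))"
      using * continuous_Linf(2)[OF cX] by simp
  qed (use p0[of "P0 n"] in \<open>auto simp: P0_def\<close>)
  have N0: "?N > 0" by simp
  have P0pos: "P0 n > 0" for n using F(7)[of n] N0 by linarith
  have cont: "continuous_on (closure \<Omega>) (u (P0 n))" for n using F(2)[of n] by (simp add: Xpq_def)
  have Linf_le: "Lnorm \<Omega> \<infinity> (u (P0 n)) \<le> C * b (P0 n)" for n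
    unfolding b_def
  proof (rule continuous_Linf(4)[OF cont])
    fix z assume "z \<in> \<Omega>"
    then have "z \<in> closure \<Omega>" using closure_subset by blast
    then show "\<bar>u (P0 n) z\<bar> \<le> C * Lnorm \<Omega> (ereal (q (P0 n))) (weak_gradient \<Omega> (u (P0 n)))"
      using C(2) F(2,6,7) by blast
  qed
  \<comment> \<open>Insert the bound of the maximum by C b into b powr \<theta> <= rl times the
    maximum, write b as b powr \<theta> times y, and cancel.\<close>
  have y_lower: "1 / (rl (P0 n) * C) \<le> y (P0 n)" for n
  proof -
    have rlp: "rl (P0 n) > 0" using F(5)[of n] by (simp add: rl_def)
    have "b (P0 n) powr \<theta> (P0 n) \<le> rl (P0 n) * (C * b (P0 n))"
      by (rule order_trans[OF F(3)]) (use Linf_le rlp in \<open>intro mult_left_mono, auto\<close>)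
    also have "\<dots> = rl (P0 n) * C * (b (P0 n) powr \<theta> (P0 n) * y (P0 n))"
      using F(1)[of n] by (simp add: y_def powr_add[symmetric])
    also have "\<dots> = b (P0 n) powr \<theta> (P0 n) * (rl (P0 n) * C * y (P0 n))" by (simp only: mult_ac)
    finally have "b (P0 n) powr \<theta> (P0 n) * 1 \<le> b (P0 n) powr \<theta> (P0 n) * (rl (P0 n) * C * y (P0 n))"
      by (simp only: mult_1_right)
    then have "1 \<le> rl (P0 n) * C * y (P0 n)" using F(1)[of n] by (simp only: mult_le_cancel_left_pos powr_gt_zero)
    then show ?thesis using rlp C(1) by (simp add: pos_divide_le_eq mult.commute)
  qed
  have "y (P0 n) \<in> {0..1 / (\<Lambda> * m1) + 1}" for n using F(4)[of n] by (simp add: y_def)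
  then obtain y0 r1 where r1: "strict_mono r1" and y0: "((\<lambda>n. y (P0 n)) \<circ> r1) \<longlonglongrightarrow> y0"
    using seq_compactE[OF compact_imp_seq_compact[OF compact_Icc], of "\<lambda>n. y (P0 n)" 0 "1 / (\<Lambda> * m1) + 1"] by metis
  have P1: "filterlim (\<lambda>n. P0 (r1 n)) at_top sequentially"
    by (rule filterlim_compose[OF P0 filterlim_subseq[OF r1]])
  have \<theta>1: "(\<lambda>n. \<theta> (P0 (r1 n))) \<longlonglongrightarrow> Q" by (rule filterlim_compose[OF \<theta>_lim P1])
  have rl1: "(\<lambda>n. rl (P0 (r1 n))) \<longlonglongrightarrow> \<Lambda>" by (rule filterlim_compose[OF rl_lim P1])
  have y1: "(\<lambda>n. y (P0 (r1 n))) \<longlonglongrightarrow> y0" using y0 by (simp add: comp_def)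
  have y0pos: "y0 > 0"
  proof -
    have "(\<lambda>n. 1 / (rl (P0 (r1 n)) * C)) \<longlonglongrightarrow> 1 / (\<Lambda> * C)"
      using \<Lambda> C by (intro tendsto_divide tendsto_mult tendsto_const rl1) auto
    then have "1 / (\<Lambda> * C) \<le> y0" by (rule LIMSEQ_le[OF _ y1]) (use y_lower in blast)
    moreover have "0 < 1 / (\<Lambda> * C)" using \<Lambda> C by simp
    ultimately show ?thesis by linarith
  qed
  have y0_upper: "y0 \<le> ?L / \<Lambda>"
  proof -
    have le: "y0 \<le> 1 / (\<Lambda> * m)" if m: "m1 \<le> m" "m < R" for m
    proof -
      have mpos: "0 < m" using m m1pos by linarith
      have "\<Lambda> * m1 \<le> \<Lambda> * m" using m(1) \<Lambda> by (intro mult_left_mono) auto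
      then have mL: "1 < \<Lambda> * m" using m1L by linarith
      have ev: "\<forall>\<^sub>F p in at_top. y p \<le> 2 powr (1 / p) * V powr (1 / q p) / (rl p * m)"
        using est[OF mpos m(2) mL] by eventually_elim blast
      have lim: "(\<lambda>n. 2 powr (1 / P0 (r1 n)) * V powr (1 / q (P0 (r1 n))) / (rl (P0 (r1 n)) * m)) \<longlonglongrightarrow> 1 / (\<Lambda> * m)"
        by (rule filterlim_compose[OF up_lim[OF mpos] P1])
      show ?thesis
        by (rule tendsto_le[OF trivial_limit_sequentially lim y1]) (rule eventually_compose_filterlim[OF ev P1])
    qed
    \<comment> \<open>Heights increasing from m1 towards the inradius R, for which the bound 1 /
      (\<Lambda> m) becomes 1 / (\<Lambda> R).\<close>
    have "(\<lambda>k. 1 / (\<Lambda> * (R - (R - m1) / real (Suc k)))) \<longlonglongrightarrow> 1 / (\<Lambda> * (R - (R - m1) * 0))"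
      using \<Lambda> R LIMSEQ_inverse_real_of_nat unfolding divide_inverse[of "R - m1"]
      by (intro tendsto_divide tendsto_mult tendsto_diff tendsto_const) auto
    moreover have "y0 \<le> 1 / (\<Lambda> * (R - (R - m1) / real (Suc k)))" for k
    proof (rule le)
      have "(R - m1) / real (Suc k) \<le> (R - m1) / 1" using m1(2) by (intro divide_left_mono) auto
      then show "m1 \<le> R - (R - m1) / real (Suc k)" by simp
      show "R - (R - m1) / real (Suc k) < R" using m1(2) by simp
    qed
    ultimately have "y0 \<le> 1 / (\<Lambda> * (R - (R - m1) * 0))" by (intro LIMSEQ_le_const) blast+
    also have "\<dots> = (1 / R) / \<Lambda>" by simp
    also have "\<dots> \<le> ?L / \<Lambda>" using RL \<Lambda> by (intro divide_right_mono) auto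
    finally show ?thesis .
  qed
  \<comment> \<open>The limit of \<open>b\<close> obtained by inverting y = b powr (1 - \<theta>) in
    the limit; positivity of y0 makes the power continuous there.\<close>
  define G where "G = y0 powr (1 / (1 - Q))"
  have G0: "G > 0" using y0pos by (simp add: G_def)
  have GQ: "G powr (1 - Q) = y0" using y0pos Q by (simp add: G_def powr_powr)
  have b1: "(\<lambda>n. b (P0 (r1 n))) \<longlonglongrightarrow> G"
  proof -
    have "(\<lambda>n. y (P0 (r1 n)) powr (1 / (1 - \<theta> (P0 (r1 n))))) \<longlonglongrightarrow> G"
      unfolding G_def using Q y0pos by (intro tendsto_powr tendsto_divide tendsto_diff tendsto_const y1 \<theta>1) auto
    moreover have "y (P0 n) powr (1 / (1 - \<theta> (P0 n))) = b (P0 n)" for n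
    proof -
      \<comment> \<open>Inverting the power for finite p needs q p to differ from p, which the two
        cases for Q ensure.\<close>
      have "\<theta> (P0 n) \<noteq> 1" using F(8)[of n] P0pos[of n] by (simp add: \<theta>_def)
      then show ?thesis using F(1)[of n] by (simp add: y_def powr_powr)
    qed
    ultimately show ?thesis by simp
  qed
  then obtain Bd where Bd: "\<And>n. \<bar>b (P0 (r1 n))\<bar> \<le> Bd"
    using Bseq_def convergentI convergent_imp_Bseq by (metis real_norm_def)
  have Bd0: "Bd \<ge> 0" using Bd[of 0] by linarith
  have comp: "compact (closure \<Omega>)" using bounded_\<Omega> by simp
  have osc: "\<bar>u (P0 (r1 n)) z - u (P0 (r1 n)) w\<bar> \<le> C * sqrt (dist z w) * Bd \<and> \<bar>u (P0 (r1 n)) z\<bar> \<le> C * Bd"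
    if "z \<in> closure \<Omega>" "w \<in> closure \<Omega>" for n z w
  proof -
    have 1: "\<bar>u (P0 (r1 n)) z - u (P0 (r1 n)) w\<bar> \<le> C * sqrt (dist z w) * b (P0 (r1 n))"
      "\<bar>u (P0 (r1 n)) z\<bar> \<le> C * b (P0 (r1 n))"
      using C(2) F(2,6,7) that unfolding b_def by blast+
    have "b (P0 (r1 n)) \<le> Bd" using Bd[of n] by linarith
    then have "C * sqrt (dist z w) * b (P0 (r1 n)) \<le> C * sqrt (dist z w) * Bd" "C * b (P0 (r1 n)) \<le> C * Bd"
      using C(1) by (auto intro!: mult_left_mono)
    then show ?thesis using 1 by linarith
  qed
  obtain U k where k: "strict_mono (k :: nat \<Rightarrow> nat)" and cU: "continuous_on (closure \<Omega>) U"
    and Uk: "\<And>e. 0 < e \<Longrightarrow> \<exists>N. \<forall>n z. n \<ge> N \<and> z \<in> closure \<Omega> \<longrightarrow> norm (u (P0 (r1 (k n))) z - U z) < e"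
  proof (rule Arzela_Ascoli[OF comp, of "\<lambda>n. u (P0 (r1 n))" "C * Bd"])
    show "norm (u (P0 (r1 n)) z) \<le> C * Bd" if "z \<in> closure \<Omega>" for n z using osc[OF that that] by simp
    fix z :: 'a and e :: real assume z: "z \<in> closure \<Omega>" and e: "0 < e"
    \<comment> \<open>Squared because the common modulus of continuity is C Bd sqrt; the summand 1
      makes the resulting bound strictly less than e, even if the constant vanishes.\<close>
    define d where "d = (e / (C * Bd + 1))\<^sup>2"
    have CB: "C * Bd + 1 > 0" using C(1) Bd0 by (simp add: add_nonneg_pos)
    have d: "d > 0" using e CB by (simp add: d_def)
    have "norm (u (P0 (r1 n)) z - u (P0 (r1 n)) w) < e" if w: "w \<in> closure \<Omega>" "norm (z - w) < d" for n w
    proof -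
      have "sqrt (dist z w) \<le> sqrt d" using w(2) by (simp add: dist_norm)
      also have "\<dots> = e / (C * Bd + 1)" using e CB by (simp add: d_def)
      finally have "C * Bd * sqrt (dist z w) \<le> C * Bd * (e / (C * Bd + 1))" using C(1) Bd0 by (intro mult_left_mono) auto
      also have "\<dots> < e" using e CB by (simp add: field_simps)
      finally show ?thesis using osc[OF z w(1), of n] by (simp add: mult_ac)
    qed
    then show "\<exists>d>0. \<forall>n w. w \<in> closure \<Omega> \<and> norm (z - w) < d \<longrightarrow> norm (u (P0 (r1 n)) z - u (P0 (r1 n)) w) < e"
      using d by blast
  next
    fix g k assume gk: "continuous_on (closure \<Omega>) g" "strict_mono (k :: nat \<Rightarrow> nat)"
      "\<And>e. 0 < e \<Longrightarrow> \<exists>N. \<forall>n z. n \<ge> N \<and> z \<in> closure \<Omega> \<longrightarrow> norm (u (P0 (r1 (k n))) z - g z) < e"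
    show thesis by (rule that[OF gk(2,1)]) (rule gk(3))
  qed
  have xcl: "x (P0 n) \<in> closure \<Omega>" and xmax: "\<And>z. z \<in> closure \<Omega> \<Longrightarrow> u (P0 n) z \<le> u (P0 n) (x (P0 n))" for n
  proof -
    have "x (P0 n) \<in> max_points \<Omega> (u (P0 n))" using F(10)[of n] by simp
    then have *: "x (P0 n) \<in> closure \<Omega>" "\<And>z. z \<in> closure \<Omega> \<Longrightarrow> \<bar>u (P0 n) z\<bar> \<le> \<bar>u (P0 n) (x (P0 n))\<bar>"
      by (auto simp: max_points_def)
    show "x (P0 n) \<in> closure \<Omega>" by (rule *(1))
    show "u (P0 n) z \<le> u (P0 n) (x (P0 n))" if "z \<in> closure \<Omega>" for z
      using *(2)[OF that] F(9)[OF that, of n] F(9)[OF *(1), of n] by simp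
  qed
  obtain xl r3 where xl: "xl \<in> closure \<Omega>" and r3: "strict_mono r3" and x3: "((\<lambda>n. x (P0 (r1 (k n)))) \<circ> r3) \<longlonglongrightarrow> xl"
    using seq_compactE[OF compact_imp_seq_compact[OF comp], of "\<lambda>n. x (P0 (r1 (k n)))"] xcl by metis
  define j where "j n = k (r3 n)" for n
  have j: "strict_mono j" using k r3 by (simp add: j_def [abs_def] strict_mono_def)
  define P where "P n = P0 (r1 (j n))" for n
  have P: "filterlim P at_top sequentially"
    unfolding P_def [abs_def] by (rule filterlim_compose[OF P1 filterlim_subseq[OF j]])
  have x_lim: "(\<lambda>n. x (P n)) \<longlonglongrightarrow> xl" using x3 by (simp add: comp_def P_def j_def)
  have u_lim: "uniform_limit (closure \<Omega>) (\<lambda>n. u (P n)) U sequentially"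
    unfolding uniform_limit_sequentially_iff
  proof (intro allI impI)
    fix e :: real assume "0 < e"
    then obtain N where N: "\<And>n z. n \<ge> N \<Longrightarrow> z \<in> closure \<Omega> \<Longrightarrow> norm (u (P0 (r1 (k n))) z - U z) < e" using Uk by meson
    have "dist (u (P n) z) (U z) < e" if "n \<ge> N" "z \<in> closure \<Omega>" for n z
    proof -
      have "N \<le> r3 n" using that(1) seq_suble[OF r3, of n] by linarith
      then show ?thesis using N[OF _ that(2)] by (simp add: P_def j_def dist_norm)
    qed
    then show "\<exists>N. \<forall>n\<ge>N. \<forall>z\<in>closure \<Omega>. dist (u (P n) z) (U z) < e" by blast
  qed
  have b_lim: "(\<lambda>n. b (P n)) \<longlonglongrightarrow> G"
    unfolding P_def using filterlim_compose[OF b1 filterlim_subseq[OF j]] .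
  have \<theta>P: "(\<lambda>n. \<theta> (P n)) \<longlonglongrightarrow> Q" by (rule filterlim_compose[OF \<theta>_lim P])
  have rlP: "(\<lambda>n. rl (P n)) \<longlonglongrightarrow> \<Lambda>" by (rule filterlim_compose[OF rl_lim P])
  have qP: "filterlim (\<lambda>n. q (P n)) at_top sequentially" by (rule filterlim_compose[OF q_at_top P])
  have U_pt: "(\<lambda>n. u (P n) z) \<longlonglongrightarrow> U z" if "z \<in> closure \<Omega>" for z by (rule tendsto_uniform_limitI[OF u_lim that])
  have U_C0: "U \<in> C0 \<Omega>"
  proof -
    have "U z = 0" if z: "z \<in> frontier \<Omega>" for z
    proof -
      have "z \<in> closure \<Omega>" using z by (simp add: frontier_def)
      moreover have "u (P n) z = 0" for n
        using Xpq_C0[OF F(7,2)] z unfolding P_def C0_def by blast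
      ultimately show ?thesis using U_pt[of z] LIMSEQ_unique[OF _ tendsto_const] by simp
    qed
    then show ?thesis using cU by (simp add: C0_def)
  qed
  have pqP: "\<And>n. ?N \<le> P n" "\<And>n. ?N \<le> q (P n)" "\<And>n. u (P n) \<in> Xpq \<Omega> (P n) (q (P n))"
    unfolding P_def by (rule F(7), rule F(6), rule F(2))
  note U_W = Linf_weak_gradient_limit[OF pqP qP u_lim b_lim[unfolded b_def]]
  have xcl': "x (P n) \<in> closure \<Omega>" for n unfolding P_def by (rule xcl)
  \<comment> \<open>Uniform convergence is what allows the evaluation point to move with n.\<close>
  have u_max_lim: "(\<lambda>n. u (P n) (x (P n))) \<longlonglongrightarrow> U xl"
  proof -
    have "(\<lambda>n. U (x (P n))) \<longlonglongrightarrow> U xl"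
      using continuous_on_tendsto_compose[OF cU x_lim xl] xcl' by simp
    moreover have "(\<lambda>n. u (P n) (x (P n)) - U (x (P n))) \<longlonglongrightarrow> 0"
    proof (rule tendstoI)
      fix e :: real assume "0 < e"
      from uniform_limitD[OF u_lim this]
      show "\<forall>\<^sub>F n in sequentially. dist (u (P n) (x (P n)) - U (x (P n))) 0 < e"
        by eventually_elim (use xcl' in \<open>simp add: dist_real_def\<close>)
    qed
    ultimately show ?thesis using tendsto_add by fastforce
  qed
  have U_nonneg: "0 \<le> U z" if "z \<in> closure \<Omega>" for z
    by (rule LIMSEQ_le_const[OF U_pt[OF that]]) (use F(9)[OF that] in \<open>auto simp: P_def\<close>)
  have U_le: "U z \<le> U xl" if "z \<in> closure \<Omega>" for z
    by (rule LIMSEQ_le[OF U_pt[OF that] u_max_lim]) (use xmax[OF that] in \<open>auto simp: P_def\<close>)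
  have Lnorm_U: "Lnorm \<Omega> \<infinity> U = U xl"
  proof (rule antisym)
    show "Lnorm \<Omega> \<infinity> U \<le> U xl"
    proof (rule continuous_Linf(4)[OF cU])
      fix z assume "z \<in> \<Omega>"
      then have "z \<in> closure \<Omega>" using closure_subset by blast
      then show "\<bar>U z\<bar> \<le> U xl" using U_nonneg U_le by simp
    qed
    show "U xl \<le> Lnorm \<Omega> \<infinity> U" using continuous_Linf(3)[OF cU xl] by linarith
  qed
  \<comment> \<open>The sup norm is first replaced by the value at the maximum point, whose limit is
    already known.\<close>
  have G_le: "G powr Q \<le> \<Lambda> * U xl"
  proof (rule LIMSEQ_le)
    show "(\<lambda>n. b (P n) powr \<theta> (P n)) \<longlonglongrightarrow> G powr Q" using G0 by (intro tendsto_powr b_lim \<theta>P) auto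
    show "(\<lambda>n. rl (P n) * u (P n) (x (P n))) \<longlonglongrightarrow> \<Lambda> * U xl" by (intro tendsto_mult rlP u_max_lim)
    have "b (P n) powr \<theta> (P n) \<le> rl (P n) * u (P n) (x (P n))" for n
    proof -
      have "Lnorm \<Omega> \<infinity> (u (P n)) \<le> u (P n) (x (P n))"
        unfolding P_def
      proof (rule continuous_Linf(4)[OF cont])
        fix z assume "z \<in> \<Omega>"
        then have z: "z \<in> closure \<Omega>" using closure_subset by blast
        then show "\<bar>u (P0 (r1 (j n))) z\<bar> \<le> u (P0 (r1 (j n))) (x (P0 (r1 (j n))))" using F(9)[OF z] xmax[OF z] by simp
      qed
      then have "rl (P n) * Lnorm \<Omega> \<infinity> (u (P n)) \<le> rl (P n) * u (P n) (x (P n))"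
        by (intro mult_left_mono) (simp_all add: rl_def)
      then show ?thesis using F(3)[of "r1 (j n)"] unfolding P_def by linarith
    qed
    then show "\<exists>N. \<forall>n\<ge>N. b (P n) powr \<theta> (P n) \<le> rl (P n) * u (P n) (x (P n))" by blast
  qed
  have L_le: "?L * U xl \<le> G" using Lmin U_W U_C0 Lnorm_U by (metis order_trans)
  have up: "G powr (1 - Q) \<le> ?L / \<Lambda>" using GQ y0_upper by simp
  note E = limit_exponent_estimates[OF Q L0 Lam G0 G_le L_le up]
  \<comment> \<open>Since G > 0 the limit has a positive maximum, so the limit point cannot lie on
    the boundary, where U vanishes.\<close>
  have "0 < \<Lambda> * U xl" using G_le G0 by (smt (verit) powr_gt_zero)
  then have "U xl \<noteq> 0" by auto
  then have "xl \<notin> frontier \<Omega>" using U_C0 by (auto simp: C0_def)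
  then have "xl \<in> \<Omega>" using xl open_\<Omega> by (simp add: frontier_def interior_open)
  moreover have "Lnorm \<Omega> \<infinity> (weak_gradient \<Omega> U) \<le> (?L / \<Lambda>) powr (1 / (1 - Q))"
    using U_W(2) E(1) by linarith
  ultimately show ?thesis
    using P U_W(1) U_C0 x_lim u_lim Lnorm_U E(2)
    by (intro exI[of _ P] exI[of _ xl] exI[of _ U]) simp
qed

end
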